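(* Let $p$ be a prime and let $G$ be a finite commutative group such that $p^2$ does not divide $\#G$. Then for every finite $\mathbf{Z}_p[G]$-module $M$, $$\#M \,\le\, \#\,\mathbf{Z}_p[G]/\mathrm{Fit}_{\mathbf{Z}_p[G]}(M).$$ If the ideal $\mathrm{Fit}_{\mathbf{Z}_p[G]}(M)$ is a principal ideal of $\mathbf{Z}_p[G]$, then equality holds.
   Context: $\mathbf{Z}_p[G]$ denotes the group ring over the $p$-adic integers. "Finite module" means a module whose underlying set is finite, and $\#$ denotes cardinality. For a commutative ring $R$ with identity and a finitely generated $R$-module $M$, choose a surjective $R$-morphism $f:R^t\to M$; the $R$-Fitting ideal $\mathrm{Fit}_R(M)$ is the ideal of $R$ generated by all $\det(v_1,\dots,v_t)$ with $v_1,\dots,v_t\in\mathrm{Ker}\, f$. It does not depend on the choice of $f$. *)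

theory Defs
  imports
    "HOL-Algebra.Module"
    "HOL-Algebra.QuotRing"
    "HOL-Combinatorics.Permutations"
    "HOL-Computational_Algebra.Primes"
begin

text \<open>
  The ring of \<open>p\<close>-adic integers as the inverse limit of the rings
  \<open>\<int>/p\<^sup>n\<int>\<close>: an element is a compatible sequence of residues \<open>x n\<close> in \<open>{0..<p\<^sup>n}\<close>.
\<close>

definition padic_int_ring :: "nat \<Rightarrow> (nat \<Rightarrow> int) ring" where
  "padic_int_ring p =
    \<lparr>carrier = {x. \<forall>n. x n \<in> {0..<int p ^ n} \<and> x (Suc n) mod int p ^ n = x n},
     monoid.mult = (\<lambda>x y n. (x n * y n) mod int p ^ n),
     one = (\<lambda>n. 1 mod int p ^ n),
     ring.zero = (\<lambda>n. 0),
     ring.add = (\<lambda>x y n. (x n + y n) mod int p ^ n)\<rparr>"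

text \<open>
  The group ring \<open>R[G]\<close> of a finite group \<open>G\<close>, with convolution as product.  All functions
  on \<open>G\<close> are admitted, so this is the group ring only when \<open>G\<close> is finite.
\<close>

definition group_ring ::
    "('a, 'x) ring_scheme \<Rightarrow> ('g, 'y) monoid_scheme \<Rightarrow> ('g \<Rightarrow> 'a) ring" where
  "group_ring R G =
    \<lparr>carrier = carrier G \<rightarrow>\<^sub>E carrier R,
     monoid.mult = (\<lambda>a b. \<lambda>x\<in>carrier G. \<Oplus>\<^bsub>R\<^esub>y\<in>carrier G. a y \<otimes>\<^bsub>R\<^esub> b (inv\<^bsub>G\<^esub> y \<otimes>\<^bsub>G\<^esub> x)),
     one = (\<lambda>x\<in>carrier G. if x = \<one>\<^bsub>G\<^esub> then \<one>\<^bsub>R\<^esub> else \<zero>\<^bsub>R\<^esub>),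
     ring.zero = (\<lambda>x\<in>carrier G. \<zero>\<^bsub>R\<^esub>),
     ring.add = (\<lambda>a b. \<lambda>x\<in>carrier G. a x \<oplus>\<^bsub>R\<^esub> b x)\<rparr>"

abbreviation padic_group_ring ::
    "nat \<Rightarrow> ('g, 'y) monoid_scheme \<Rightarrow> ('g \<Rightarrow> nat \<Rightarrow> int) ring" where
  "padic_group_ring p G \<equiv> group_ring (padic_int_ring p) G"

text \<open>
  The module \<open>R\<^sup>t\<close>.  The record type for modules extends the one for rings; the fields
  \<open>mult\<close> and \<open>one\<close> play no role for a module.
\<close>

definition free_module :: "('a, 'x) ring_scheme \<Rightarrow> nat \<Rightarrow> ('a, nat \<Rightarrow> 'a) module" where
  "free_module R t =
    \<lparr>carrier = {..<t} \<rightarrow>\<^sub>E carrier R,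
     monoid.mult = undefined,
     one = undefined,
     ring.zero = (\<lambda>i\<in>{..<t}. \<zero>\<^bsub>R\<^esub>),
     ring.add = (\<lambda>v w. \<lambda>i\<in>{..<t}. v i \<oplus>\<^bsub>R\<^esub> w i),
     smult = (\<lambda>r v. \<lambda>i\<in>{..<t}. r \<otimes>\<^bsub>R\<^esub> v i)\<rparr>"

definition module_hom ::
    "('a, 'x) ring_scheme \<Rightarrow> ('a, 'b, 'y) module_scheme \<Rightarrow> ('a, 'c, 'z) module_scheme
      \<Rightarrow> ('b \<Rightarrow> 'c) set" where
  "module_hom R M N =
    {f \<in> carrier M \<rightarrow> carrier N.
      (\<forall>v\<in>carrier M. \<forall>w\<in>carrier M. f (v \<oplus>\<^bsub>M\<^esub> w) = f v \<oplus>\<^bsub>N\<^esub> f w) \<and>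
      (\<forall>r\<in>carrier R. \<forall>v\<in>carrier M. f (r \<odot>\<^bsub>M\<^esub> v) = r \<odot>\<^bsub>N\<^esub> f v)}"

text \<open>
  The Leibniz formula for the determinant \<open>det(V 0, \<dots>, V (t - 1))\<close>, where \<open>V i j\<close> is the \<open>j\<close>-th coordinate
  of the vector \<open>V i\<close>.
\<close>

definition det_vectors :: "('a, 'x) ring_scheme \<Rightarrow> nat \<Rightarrow> (nat \<Rightarrow> nat \<Rightarrow> 'a) \<Rightarrow> 'a" where
  "det_vectors R t V =
    (\<Oplus>\<^bsub>R\<^esub>\<sigma>\<in>{\<sigma>. \<sigma> permutes {..<t}}. [sign \<sigma>] \<cdot>\<^bsub>R\<^esub> (\<Otimes>\<^bsub>R\<^esub>i\<in>{..<t}. V i (\<sigma> i)))"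

definition free_presentation ::
    "('a, 'x) ring_scheme \<Rightarrow> ('a, 'b, 'y) module_scheme \<Rightarrow> nat \<Rightarrow> ((nat \<Rightarrow> 'a) \<Rightarrow> 'b) \<Rightarrow> bool" where
  "free_presentation R M t f \<longleftrightarrow>
    f \<in> module_hom R (free_module R t) M \<and> f ` carrier (free_module R t) = carrier M"

definition fitting_ideal_wrt ::
    "('a, 'x) ring_scheme \<Rightarrow> ('a, 'b, 'y) module_scheme \<Rightarrow> nat \<Rightarrow> ((nat \<Rightarrow> 'a) \<Rightarrow> 'b) \<Rightarrow> 'a set" where
  "fitting_ideal_wrt R M t f =
    Idl\<^bsub>R\<^esub> {det_vectors R t V | V. \<forall>i<t. V i \<in> carrier (free_module R t) \<and> f (V i) = \<zero>\<^bsub>M\<^esub>}"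

text \<open>
  The Fitting ideal of a finitely generated module over a commutative ring.  The ideal does not
  depend on the surjection \<open>f : R\<^sup>t \<rightarrow> M\<close>, so an arbitrary one is chosen.
\<close>

definition fitting_ideal ::
    "('a, 'x) ring_scheme \<Rightarrow> ('a, 'b, 'y) module_scheme \<Rightarrow> 'a set" where
  "fitting_ideal R M =
    (case (SOME (t, f). free_presentation R M t f) of (t, f) \<Rightarrow> fitting_ideal_wrt R M t f)"

end

theory Submission
  imports Defs "HOL-Library.Function_Algebras" "HOL-Algebra.Sylow" "HOL-Number_Theory.Residues"
begin

text \<open>
  Let \<open>R\<close> be the group ring and \<open>M = R\<^sup>t / K\<close>. The claim compares the index of \<open>K\<close> in \<open>R\<^sup>t\<close> with the
  index in \<open>R\<close> of the ideal \<open>F\<close> spanned by the determinants of vectors of \<open>K\<close>. Both indices are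
  multiplicative over a splitting of \<open>1\<close> into orthogonal idempotents (\<open>fitting_bound_add\<close>), so it
  suffices to treat the factors \<open>f R\<close> for primitive idempotents \<open>f\<close>, and these are local
  (\<open>primitive_local\<close>): modulo a power of \<open>p\<close> the powers of an element are eventually periodic, so
  \<open>r\<^bsup>k!\<^esup>\<close> converges to an idempotent (\<open>split\<close>), and the residue rings are reduced because a power
  of Frobenius acts on them as the identity (\<open>Frobenius\<close>).

  If \<open>p\<close> does not divide the order of \<open>G\<close>, each local factor is a discrete valuation ring with
  uniformizer \<open>p\<close>. Then \<open>K\<close> has a triangular basis, \<open>F\<close> is generated by its determinant, and both
  indices are the product of the indices of the diagonal entries.

  Otherwise let \<open>x\<close> generate a subgroup of order \<open>p\<close>, and put \<open>a = x - 1\<close> and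
  \<open>b = 1 + x + \<dots> + x\<^bsup>p-1\<^esup>\<close>. Each of \<open>a\<close> and \<open>b\<close> generates the annihilator of the other, and since
  \<open>p\<^sup>2\<close> does not divide the order of \<open>G\<close> the maximal ideal of each local factor is generated by both.
  Hence the factor is the fibre product of the discrete valuation rings \<open>R / b R \<cong> a R\<close> and
  \<open>R / a R \<cong> b R\<close> over their common residue field, say of order \<open>q\<close>: a node. Triangular bases on
  each branch give \<open>[a R\<^sup>t : a K] = [a R : a F]\<close> and \<open>[b R\<^sup>t : b K] = [b R : b F]\<close>
  (\<open>uniformizer.Fit_scaled\<close>). Splitting \<open>R\<^sup>t\<close> and \<open>R\<close> along multiplication by \<open>a\<close>, whose kernel is
  the multiples of \<open>b\<close>, turns these into
  \<open>[R\<^sup>t : K] \<cdot> [K \<inter> ker a : b K] = [R : F] \<cdot> [F \<inter> ker a : b F]\<close>.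
  The factor on the left is \<open>1\<close> or at least \<open>q\<close>. The factor on the right is at most \<open>q\<close>, and it is
  \<open>1\<close> if the one on the left is: then \<open>K\<close> is, up to \<open>b K\<close>, spanned by \<open>t\<close> vectors, so that \<open>F\<close> is
  principal up to \<open>b F\<close>. This gives the inequality. If \<open>F\<close> is principal, Cramer's rule on both branches
  shows that both factors are \<open>1\<close> (\<open>node.fitting_bound\<close>).

  The linear algebra is carried out inside corners \<open>e U\<close> of rings \<open>U\<close> given by a type, so that the
  algebra of type classes applies; every commutative ring with a carrier is such a corner of one
  universal ring type.
\<close>

section \<open>Indices of additive subgroups\<close>

definition subgrp :: "'b::ab_group_add set \<Rightarrow> bool" where
  "subgrp A \<longleftrightarrow> 0 \<in> A \<and> (\<forall>x\<in>A. \<forall>y\<in>A. x - y \<in> A)"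

definition cosets :: "'b::ab_group_add set \<Rightarrow> 'b set \<Rightarrow> 'b set set" where
  "cosets A B = (\<lambda>a. (+) a ` B) ` A"

text \<open>
  As the cardinality of an infinite set is \<open>0\<close>, an index is positive exactly when it is finite, and the
  multiplicativity laws below hold without finiteness assumptions.
\<close>

definition index :: "'b::ab_group_add set \<Rightarrow> 'b set \<Rightarrow> nat" where
  "index A B = card (cosets A B)"

lemma subgrpD:
  assumes "subgrp A"
  shows "0 \<in> A" "x \<in> A \<Longrightarrow> y \<in> A \<Longrightarrow> x - y \<in> A" "x \<in> A \<Longrightarrow> - x \<in> A"
    "x \<in> A \<Longrightarrow> y \<in> A \<Longrightarrow> x + y \<in> A"
proof -
  show z: "0 \<in> A" and d: "x \<in> A \<Longrightarrow> y \<in> A \<Longrightarrow> x - y \<in> A" for x y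
    using assms by (auto simp: subgrp_def)
  show n: "x \<in> A \<Longrightarrow> - x \<in> A" for x using d[OF z] by simp
  show "x \<in> A \<Longrightarrow> y \<in> A \<Longrightarrow> x + y \<in> A" using d[OF _ n] by simp
qed

lemma coset_eq_iff:
  assumes "subgrp B"
  shows "(+) a ` B = (+) a' ` B \<longleftrightarrow> a - a' \<in> B"
proof
  assume "(+) a ` B = (+) a' ` B"
  moreover have "a \<in> (+) a ` B" using subgrpD(1)[OF assms] by force
  ultimately obtain b where "b \<in> B" "a = a' + b" by auto
  then show "a - a' \<in> B" by simp
next
  have *: "(+) a ` B \<subseteq> (+) a' ` B" if "a - a' \<in> B" for a a'
  proof
    fix x assume "x \<in> (+) a ` B"
    then obtain b where b: "b \<in> B" "x = a + b" by auto
    have "x = a' + ((a - a') + b)" using b by simp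
    then show "x \<in> (+) a' ` B" using subgrpD(4)[OF assms that b(1)] by blast
  qed
  assume h: "a - a' \<in> B"
  moreover have "a' - a \<in> B" using subgrpD(3)[OF assms h] by simp
  ultimately show "(+) a ` B = (+) a' ` B" using * by blast
qed

lemma bij_cosets_image:
  assumes "subgrp B" "\<And>a a'. a \<in> A \<Longrightarrow> a' \<in> A \<Longrightarrow> h a = h a' \<longleftrightarrow> a - a' \<in> B"
  shows "\<exists>g. bij_betw g (cosets A B) (h ` A)"
proof -
  define t where "t X = (SOME a. a \<in> A \<and> (+) a ` B = X)" for X
  have t: "t X \<in> A \<and> (+) (t X) ` B = X" if "X \<in> cosets A B" for X
    using that unfolding t_def cosets_def by (intro someI_ex[of "\<lambda>a. a \<in> A \<and> (+) a ` B = X"]) auto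
  have ht: "h (t ((+) a ` B)) = h a" if "a \<in> A" for a
  proof -
    have "(+) a ` B \<in> cosets A B" using that by (auto simp: cosets_def)
    from t[OF this] show ?thesis using assms(2) that coset_eq_iff[OF assms(1)] by blast
  qed
  have "bij_betw (h \<circ> t) (cosets A B) (h ` A)"
    unfolding bij_betw_def
  proof
    show "inj_on (h \<circ> t) (cosets A B)"
      by (rule inj_onI) (metis t assms(2) coset_eq_iff[OF assms(1)] comp_apply)
    show "(h \<circ> t) ` cosets A B = h ` A"
      unfolding cosets_def image_image comp_def using ht by (auto simp: image_def)
  qed
  then show ?thesis by blast
qed

lemma index_eq_card_image:
  assumes "subgrp B" "\<And>a a'. a \<in> A \<Longrightarrow> a' \<in> A \<Longrightarrow> h a = h a' \<longleftrightarrow> a - a' \<in> B"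
  shows "index A B = card (h ` A)"
  using bij_cosets_image[OF assms] bij_betw_same_card unfolding index_def by blast

lemma index_pos_iff: "0 < index A B \<longleftrightarrow> finite (cosets A B) \<and> A \<noteq> {}"
  by (auto simp: index_def card_gt_0_iff cosets_def)

text \<open>
  A choice \<open>s a\<close> of representatives modulo \<open>B\<close> sends \<open>a\<close> to the pair of its class modulo \<open>B\<close> and the
  class of \<open>a - s a\<close> modulo \<open>D\<close>.
\<close>

lemma index_tower:
  assumes "subgrp A" "subgrp B" "subgrp D" "D \<subseteq> B" "B \<subseteq> A"
  shows "index A D = index A B * index B D"
proof -
  define t where "t X = (SOME a. a \<in> A \<and> (+) a ` B = X)" for X
  define s where "s a = t ((+) a ` B)" for a
  have s: "s a \<in> A" "s a - a \<in> B" if "a \<in> A" for a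
  proof -
    have "s a \<in> A \<and> (+) (s a) ` B = (+) a ` B"
      unfolding s_def t_def using that by (intro someI_ex[of "\<lambda>a'. a' \<in> A \<and> (+) a' ` B = (+) a ` B"]) auto
    then show "s a \<in> A" "s a - a \<in> B" using coset_eq_iff[OF assms(2)] by auto
  qed
  have sB: "a - s a \<in> B" if "a \<in> A" for a
    using subgrpD(3)[OF assms(2) s(2)[OF that]] by simp
  define h where "h a = ((+) a ` B, (+) (a - s a) ` D)" for a
  have "h a = h a' \<longleftrightarrow> a - a' \<in> D" if "a \<in> A" "a' \<in> A" for a a'
  proof
    assume "h a = h a'"
    then have "(+) a ` B = (+) a' ` B" "(+) (a - s a) ` D = (+) (a' - s a') ` D"
      by (auto simp: h_def)
    then have "s a = s a'" "(a - s a) - (a' - s a') \<in> D"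
      by (auto simp: s_def coset_eq_iff[OF assms(3)])
    then show "a - a' \<in> D" by simp
  next
    assume d: "a - a' \<in> D"
    then have "(+) a ` B = (+) a' ` B" using assms(4) coset_eq_iff[OF assms(2)] by blast
    then show "h a = h a'" using d by (simp add: h_def s_def coset_eq_iff[OF assms(3)])
  qed
  then have "index A D = card (h ` A)" by (rule index_eq_card_image[OF assms(3)])
  also have "h ` A = cosets A B \<times> cosets B D"
  proof
    show "h ` A \<subseteq> cosets A B \<times> cosets B D" using sB by (auto simp: h_def cosets_def)
    show "cosets A B \<times> cosets B D \<subseteq> h ` A"
    proof (clarsimp simp: cosets_def)
      fix a b assume a: "a \<in> A" and b: "b \<in> B"
      let ?c = "s a + b"
      have c: "?c \<in> A" using subgrpD(4)[OF assms(1)] s(1)[OF a] b assms(5) by blast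
      have "?c - a = (s a - a) + b" by simp
      then have "?c - a \<in> B" using subgrpD(4)[OF assms(2) s(2)[OF a] b] by metis
      then have eq: "(+) ?c ` B = (+) a ` B" using coset_eq_iff[OF assms(2)] by blast
      then have "s ?c = s a" by (simp add: s_def)
      then have "h ?c = ((+) a ` B, (+) b ` D)" by (simp add: h_def eq)
      then show "((+) a ` B, (+) b ` D) \<in> h ` A" using c by (metis image_eqI)
    qed
  qed
  finally show ?thesis by (simp add: index_def card_cartesian_product)
qed

lemma index_self: "subgrp A \<Longrightarrow> index A A = 1"
proof -
  assume A: "subgrp A"
  have "index A A = card ((\<lambda>_. 0::nat) ` A)"
    using subgrpD[OF A] by (intro index_eq_card_image[OF A]) auto
  also have "(\<lambda>_. 0::nat) ` A = {0}" using subgrpD(1)[OF A] by auto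
  finally show ?thesis by simp
qed

lemma index_eq_1:
  assumes "subgrp A" "subgrp B" "B \<subseteq> A" "index A B = 1"
  shows "A = B"
proof -
  obtain X where X: "cosets A B = {X}" using assms(4) card_1_singletonE unfolding index_def by blast
  have "x \<in> B" if x: "x \<in> A" for x
  proof -
    have "(+) x ` B \<in> cosets A B" "(+) 0 ` B \<in> cosets A B"
      unfolding cosets_def using x subgrpD(1)[OF assms(1)] by blast+
    then have "(+) x ` B = (+) 0 ` B" unfolding X by blast
    then show ?thesis using coset_eq_iff[OF assms(2), of x 0] by simp
  qed
  then show ?thesis using assms(3) by blast
qed

definition additive_on :: "'b::ab_group_add set \<Rightarrow> ('b \<Rightarrow> 'c::ab_group_add) \<Rightarrow> bool" where
  "additive_on A f \<longleftrightarrow> (\<forall>x\<in>A. \<forall>y\<in>A. f (x - y) = f x - f y)"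

lemma subgrp_image:
  assumes "subgrp A" "additive_on A f" shows "subgrp (f ` A)"
  unfolding subgrp_def
proof (intro conjI ballI)
  have "f (0 - 0) = f 0 - f 0" using assms(2) subgrpD(1)[OF assms(1)] unfolding additive_on_def by blast
  then have "f 0 = 0" by simp
  then show "0 \<in> f ` A" using subgrpD(1)[OF assms(1)] by force
  fix x y assume "x \<in> f ` A" "y \<in> f ` A"
  then obtain a b where ab: "a \<in> A" "b \<in> A" "x = f a" "y = f b" by auto
  then have "x - y = f (a - b)" using assms(2) by (simp add: additive_on_def)
  then show "x - y \<in> f ` A" using subgrpD(2)[OF assms(1) ab(1,2)] by blast
qed

lemma subgrp_Int: "subgrp A \<Longrightarrow> subgrp B \<Longrightarrow> subgrp (A \<inter> B)"
  by (auto simp: subgrp_def)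

lemma subgrp_kernel:
  assumes "subgrp A" "additive_on A f" shows "subgrp {x\<in>A. f x = 0}"
proof -
  have "f (0 - 0) = f 0 - f 0" using assms(2) subgrpD(1)[OF assms(1)] unfolding additive_on_def by blast
  then show ?thesis using assms unfolding subgrp_def additive_on_def by auto
qed

text \<open>
  The group \<open>B + ker f\<close> lies between \<open>A\<close> and \<open>B\<close>; its index in \<open>A\<close> is seen in the image of \<open>f\<close>, and the
  index of \<open>B\<close> in it is seen in the kernel.
\<close>

lemma index_image_kernel:
  assumes A: "subgrp A" and B: "subgrp B" and BA: "B \<subseteq> A" and f: "additive_on A f"
  shows "index A B = index (f ` A) (f ` B) * index {x\<in>A. f x = 0} {x\<in>B. f x = 0}"
proof -
  have fB: "additive_on B f" using f BA by (auto simp: additive_on_def)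
  have f0: "f 0 = 0" using subgrp_kernel[OF A f] by (auto simp: subgrp_def)
  let ?S = "{x\<in>A. f x \<in> f ` B}"
  have "0 \<in> f ` B" using f0 subgrpD(1)[OF B] by force
  then have fS: "subgrp ?S"
    using subgrp_image[OF B fB] A f f0 unfolding subgrp_def additive_on_def by auto
  have BS: "B \<subseteq> ?S" using BA by auto
  have 1: "index A ?S = index (f ` A) (f ` B)"
  proof -
    let ?h = "\<lambda>a. (+) (f a) ` f ` B"
    have "index A ?S = card (?h ` A)"
    proof (rule index_eq_card_image[OF fS])
      fix a a' assume a: "a \<in> A" "a' \<in> A"
      then have "f (a - a') = f a - f a'" using f by (simp add: additive_on_def)
      then show "?h a = ?h a' \<longleftrightarrow> a - a' \<in> ?S"
        using coset_eq_iff[OF subgrp_image[OF B fB]] subgrpD(2)[OF A a] by auto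
    qed
    also have "?h ` A = cosets (f ` A) (f ` B)" by (auto simp: cosets_def)
    finally show ?thesis by (simp add: index_def)
  qed
  let ?K = "{x\<in>A. f x = 0}" and ?L = "{x\<in>B. f x = 0}"
  have K: "subgrp ?K" and L: "subgrp ?L" using subgrp_kernel A B f fB by blast+
  have 2: "index ?K ?L = index ?S B"
  proof -
    let ?h = "\<lambda>a. (+) a ` B"
    have "index ?K ?L = card (?h ` ?K)"
    proof (rule index_eq_card_image[OF L])
      fix a a' assume a: "a \<in> ?K" "a' \<in> ?K"
      then have "f (a - a') = 0" using f by (simp add: additive_on_def)
      then show "?h a = ?h a' \<longleftrightarrow> a - a' \<in> ?L" using coset_eq_iff[OF B] by auto
    qed
    also have "?h ` ?K = cosets ?S B" unfolding cosets_def
    proof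
      show "?h ` ?K \<subseteq> ?h ` ?S" using f0 subgrpD(1)[OF B] by force
      show "?h ` ?S \<subseteq> ?h ` ?K"
      proof
        fix X assume "X \<in> ?h ` ?S"
        then obtain a b where ab: "a \<in> A" "b \<in> B" "f a = f b" "X = (+) a ` B" by auto
        then have "a - b \<in> ?K" using f subgrpD(2)[OF A, of a b] BA by (auto simp: additive_on_def)
        moreover have "X = ?h (a - b)" using ab coset_eq_iff[OF B, of a "a - b"] by simp
        ultimately show "X \<in> ?h ` ?K" by blast
      qed
    qed
    finally show ?thesis by (simp add: index_def)
  qed
  show ?thesis using index_tower[OF A fS B BS] 1 2 by auto
qed

lemma index_inj_image:
  assumes A: "subgrp A" and B: "subgrp B" and BA: "B \<subseteq> A" and f: "additive_on A f"
    and inj: "\<And>x. x \<in> A \<Longrightarrow> f x = 0 \<Longrightarrow> x = 0"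
  shows "index (f ` A) (f ` B) = index A B"
proof -
  have f0: "f 0 = 0" using subgrp_kernel[OF A f] by (auto simp: subgrp_def)
  have "{x\<in>A. f x = 0} = {0}" using inj f0 subgrpD(1)[OF A] by auto
  moreover have "{x\<in>B. f x = 0} = {0}" using inj f0 subgrpD(1)[OF B] BA by auto
  moreover have "subgrp {0::'a}" by (auto simp: subgrp_def)
  ultimately show ?thesis using index_image_kernel[OF A B BA f] index_self[of "{0::'a}"] by simp
qed

text \<open>
  The index of \<open>f B\<close> in \<open>A\<close> is both \<open>[A : B] [B : f B]\<close> and \<open>[A : f A] [f A : f B]\<close>, and
  \<open>[f A : f B] = [A : B]\<close> by injectivity.
\<close>

lemma index_commensurable:
  assumes A: "subgrp A" and B: "subgrp B" and BA: "B \<subseteq> A" and f: "additive_on A f"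
    and inj: "\<And>x. x \<in> A \<Longrightarrow> f x = 0 \<Longrightarrow> x = 0"
    and fA: "f ` A \<subseteq> A" and fB: "f ` B \<subseteq> B" and fin: "0 < index A B"
  shows "index B (f ` B) = index A (f ` A)"
proof -
  have addB: "additive_on B f" using f BA by (auto simp: additive_on_def)
  have "index A B * index B (f ` B) = index A (f ` B)"
    using index_tower[OF A B subgrp_image[OF B addB] fB BA] by simp
  also have "\<dots> = index A (f ` A) * index (f ` A) (f ` B)"
    using index_tower[OF A subgrp_image[OF A f] subgrp_image[OF B addB] image_mono[OF BA] fA] .
  also have "index (f ` A) (f ` B) = index A B" by (rule index_inj_image[OF A B BA f inj])
  finally show ?thesis using fin by (simp add: mult.commute)
qed

lemma index_le_of_subset:
  assumes "subgrp A" "subgrp B" "subgrp D" "D \<subseteq> B" "B \<subseteq> A" "0 < index A D"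
  shows "index A B \<le> index A D" "index B D \<le> index A D" "0 < index A B" "0 < index B D"
  using index_tower[OF assms(1-5)] assms(6) by auto

section \<open>Determinants and Fitting ideals in corners of a commutative ring\<close>

text \<open>
  Vectors are functions on all natural numbers, so that they form a group of type class \<open>ab_group_add\<close>;
  a module of rank \<open>n\<close> is cut out by vanishing from \<open>n\<close> on.
\<close>

definition smul :: "'a::comm_ring_1 \<Rightarrow> (nat \<Rightarrow> 'a) \<Rightarrow> nat \<Rightarrow> 'a" where
  "smul r v = (\<lambda>i. r * v i)"

lemma smul_apply [simp]: "smul r v i = r * v i"
  by (simp add: smul_def)

context Modules.module
begin

lemma subspace_subgrp: "subspace S \<Longrightarrow> subgrp S"
  by (auto simp: subgrp_def subspace_0 subspace_diff)

lemma additive_scale: "additive_on S (scale c)"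
  by (simp add: additive_on_def scale_right_diff_distrib)

lemma subspace_scale_image:
  assumes S: "subspace S" shows "subspace (scale c ` S)"
proof (rule subspaceI)
  show "0 \<in> scale c ` S" using subspace_0[OF S] by (metis image_eqI scale_zero_right)
  show "u + v \<in> scale c ` S" if "u \<in> scale c ` S" "v \<in> scale c ` S" for u v
    using that subspace_add[OF S] by (force simp: scale_right_distrib[symmetric])
  show "scale r u \<in> scale c ` S" if "u \<in> scale c ` S" for r u
    using that subspace_scale[OF S] by (force simp: scale_left_commute[of r] simp del: scale_scale)
qed

lemma subspace_scale_kernel:
  assumes S: "subspace S" shows "subspace {x\<in>S. scale c x = 0}"
  by (rule subspaceI)
    (auto simp: subspace_0[OF S] subspace_add[OF S] subspace_scale[OF S] scale_right_distrib
      scale_left_commute[of c] simp del: scale_scale)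

text \<open>
  Multiplication by \<open>a\<close> splits the index of \<open>B\<close> into a part in \<open>a A\<close> and a part in its kernel \<open>b A\<close>;
  in the latter \<open>b B\<close> may be smaller than the elements of \<open>B\<close> killed by \<open>a\<close>, which is the correction on
  the left.
\<close>

lemma index_scale_kernel:
  assumes A: "subspace A" and B: "subspace B" and BA: "B \<subseteq> A"
    and ker: "{x\<in>A. scale a x = 0} = scale b ` A"
  shows "index A B * index {x\<in>B. scale a x = 0} (scale b ` B) =
    index (scale a ` A) (scale a ` B) * index (scale b ` A) (scale b ` B)"
proof -
  have "scale a (scale b x) = 0" if "x \<in> A" for x using that ker by blast
  then have sub: "scale b ` B \<subseteq> {x\<in>B. scale a x = 0}" using subspace_scale[OF B] BA by auto
  have "index A B = index (scale a ` A) (scale a ` B) * index {x\<in>A. scale a x = 0} {x\<in>B. scale a x = 0}"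
    by (intro index_image_kernel subspace_subgrp A B BA additive_scale)
  moreover have "index {x\<in>A. scale a x = 0} (scale b ` B) =
      index {x\<in>A. scale a x = 0} {x\<in>B. scale a x = 0} * index {x\<in>B. scale a x = 0} (scale b ` B)"
    using sub BA by (intro index_tower subspace_subgrp subspace_scale_kernel subspace_scale_image A B) auto
  ultimately show ?thesis unfolding ker by (simp add: mult.assoc)
qed

text \<open>
  Multiplication by \<open>f\<close> has the component of \<open>g\<close> as its kernel.
\<close>

lemma index_component:
  assumes fg: "f * g = 0" and A: "subspace A" and B: "subspace B" and BA: "B \<subseteq> A"
    and unit: "\<And>x. x \<in> A \<Longrightarrow> scale (f + g) x = x"
  shows "index A B = index (scale f ` A) (scale f ` B) * index (scale g ` A) (scale g ` B)"
proof -
  have ker: "{x\<in>S. scale f x = 0} = scale g ` S" if S: "subspace S" "S \<subseteq> A" for S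
  proof (intro equalityI subsetI)
    fix x assume x: "x \<in> {x\<in>S. scale f x = 0}"
    then have "x = scale g x" using unit[of x] S(2) by (auto simp: scale_left_distrib)
    then show "x \<in> scale g ` S" using x by blast
  qed (use subspace_scale[OF S(1)] fg in auto)
  show ?thesis
    unfolding ker[OF A order.refl, symmetric] ker[OF B BA, symmetric]
    by (intro index_image_kernel subspace_subgrp A B BA additive_scale)
qed

end

interpretation vec: Modules.module "smul :: 'a::comm_ring_1 \<Rightarrow> _"
  by unfold_locales (auto simp: algebra_simps fun_eq_iff)

interpretation idl: Modules.module "(*) :: 'a::comm_ring_1 \<Rightarrow> 'a \<Rightarrow> 'a"
  by unfold_locales (auto simp: algebra_simps)

\<comment> \<open>as a rewrite rule it reassociates products and competes with \<open>mult_ac\<close>\<close>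
declare idl.scale_scale [simp del]

\<comment> \<open>so that \<open>module\<close> and \<open>module_hom\<close> denote the notions for rings with a carrier\<close>
hide_const (open) Modules.module Modules.module_hom

lemmas subspace_subgrp = idl.subspace_subgrp vec.subspace_subgrp
  and additive_mult = idl.additive_scale vec.additive_scale
  and subspace_kernel = idl.subspace_scale_kernel vec.subspace_scale_kernel
  and subspace_mult_image = idl.subspace_scale_image
  and subspace_smul_image = vec.subspace_scale_image

lemma sum_fun_apply [simp]: "(\<Sum>j\<in>J. f j) i = (\<Sum>j\<in>J. f j i :: 'b::comm_monoid_add)"
  by (induction J rule: infinite_finite_induct) auto

definition det :: "nat \<Rightarrow> (nat \<Rightarrow> nat \<Rightarrow> 'a::comm_ring_1) \<Rightarrow> 'a" where
  "det n V = (\<Sum>\<sigma> | \<sigma> permutes {..<n}. of_int (sign \<sigma>) * (\<Prod>i<n. V i (\<sigma> i)))"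

lemma finite_perms [simp]: "finite {\<sigma>. \<sigma> permutes {..<n::nat}}"
  by (rule finite_permutations) simp

lemma perm_less: "\<sigma> permutes {..<n::nat} \<Longrightarrow> i < n \<Longrightarrow> \<sigma> i < n"
  using permutes_in_image by fastforce

lemma det_cong:
  "(\<And>i j. i < n \<Longrightarrow> j < n \<Longrightarrow> V i j = W i j) \<Longrightarrow> det n V = det n W"
  unfolding det_def by (intro sum.cong prod.cong arg_cong2[of _ _ _ _ "(*)"]) (auto simp: perm_less)

text \<open>
  A relation that holds after multiplication by \<open>c\<close> may be used in every factor of a product, since \<open>c\<close>
  can be moved from factor to factor. This is how computations in \<open>c R\<close>, that is, modulo the annihilator of
  \<open>c\<close>, are made without passing to a quotient ring.
\<close>

lemma mult_prod_cong:
  fixes c :: "'a::comm_ring_1"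
  assumes "\<And>i. i \<in> A \<Longrightarrow> c * f i = c * g i"
  shows "c * prod f A = c * prod g A"
  using assms
proof (induction A rule: infinite_finite_induct)
  case (insert x F)
  have IH: "c * prod f F = c * prod g F" and x: "c * f x = c * g x" using insert by simp_all
  have "c * prod f (insert x F) = f x * (c * prod f F)" using insert(1,2) by (simp add: mult_ac)
  also have "\<dots> = (c * f x) * prod g F" unfolding IH by (simp add: mult_ac)
  also have "\<dots> = c * prod g (insert x F)" unfolding x using insert(1,2) by (simp add: mult_ac)
  finally show ?case .
qed auto

lemma mult_det_cong:
  assumes "\<And>i j. i < n \<Longrightarrow> j < n \<Longrightarrow> c * V i j = c * W i j"
  shows "c * det n V = c * det n W"
proof -
  have "c * (of_int (sign \<sigma>) * (\<Prod>i<n. V i (\<sigma> i))) = c * (of_int (sign \<sigma>) * (\<Prod>i<n. W i (\<sigma> i)))"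
    if "\<sigma> permutes {..<n}" for \<sigma>
    using mult_prod_cong[of "{..<n}" c "\<lambda>i. V i (\<sigma> i)" "\<lambda>i. W i (\<sigma> i)"] assms that
    by (simp add: perm_less mult.left_commute[of c "of_int _"])
  then show ?thesis unfolding det_def sum_distrib_left by (intro sum.cong) auto
qed

lemma det_row_split:
  assumes "k < n"
  shows "det n (V(k := x)) = (\<Sum>\<sigma> | \<sigma> permutes {..<n}. of_int (sign \<sigma>) * (x (\<sigma> k) * (\<Prod>i\<in>{..<n}-{k}. V i (\<sigma> i))))"
  unfolding det_def
proof (intro sum.cong refl arg_cong2[of _ _ _ _ "(*)"])
  fix \<sigma>
  show "(\<Prod>i<n. (V(k := x)) i (\<sigma> i)) = x (\<sigma> k) * (\<Prod>i\<in>{..<n}-{k}. V i (\<sigma> i))"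
    using assms by (subst prod.remove[of _ k]) (auto intro!: arg_cong2[of _ _ _ _ "(*)"] prod.cong)
qed

lemma det_row_add: "k < n \<Longrightarrow> det n (V(k := x + y)) = det n (V(k := x)) + det n (V(k := y))"
  by (simp add: det_row_split sum.distrib[symmetric] distrib_left distrib_right)

lemma det_row_smul: "k < n \<Longrightarrow> det n (V(k := smul c x)) = c * det n (V(k := x))"
  by (simp add: det_row_split sum_distrib_left mult_ac)

lemma det_row_sum:
  assumes "k < n"
  shows "det n (V(k := (\<Sum>j\<in>J. smul (s j) (a j)))) = (\<Sum>j\<in>J. s j * det n (V(k := a j)))"
proof -
  have z: "det n (V(k := 0)) = 0" using assms by (simp add: det_row_split)
  show ?thesis
  proof (induction J rule: infinite_finite_induct)
    case (insert x F)
    show ?case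
      unfolding sum.insert[OF insert(1,2)] det_row_add[OF assms] det_row_smul[OF assms] insert(3) ..
  qed (simp_all only: sum.infinite sum.empty z not_False_eq_True)
qed

lemma det_eq_rows:
  assumes "k < n" "l < n" "k \<noteq> l" "V k = V l"
  shows "det n V = (0 :: 'a::comm_ring_1)"
proof -
  let ?t = "transpose k l" and ?S = "{\<sigma>. \<sigma> permutes {..<n}}"
  let ?E = "{\<sigma>\<in>?S. evenperm \<sigma>}" and ?O = "{\<sigma>\<in>?S. \<not> evenperm \<sigma>}"
  let ?f = "\<lambda>\<sigma>. \<Prod>i<n. V i (\<sigma> i)"
  have t: "?t permutes {..<n}" using assms by (auto intro: permutes_swap_id)
  have perm: "permutation \<sigma>" if "\<sigma> \<in> ?S" for \<sigma>
    using that permutation_permutes by fastforce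
  have pt: "permutation ?t" by (rule permutation_swap_id)
  have f: "?f (\<sigma> \<circ> ?t) = ?f \<sigma>" for \<sigma>
  proof -
    have "?f (\<sigma> \<circ> ?t) = (\<Prod>i<n. V (?t i) (\<sigma> (?t i)))"
      using assms by (intro prod.cong) (auto simp: transpose_def)
    also have "\<dots> = ?f \<sigma>"
      using prod.permute[OF t, of "\<lambda>i. V i (\<sigma> i)"] by (simp add: comp_def)
    finally show ?thesis .
  qed
  have bij: "bij_betw (\<lambda>\<sigma>. \<sigma> \<circ> ?t) ?E ?O"
  proof (rule bij_betw_byWitness[where f' = "\<lambda>\<sigma>. \<sigma> \<circ> ?t"])
    have flip: "evenperm (\<sigma> \<circ> ?t) \<longleftrightarrow> \<not> evenperm \<sigma>" if "\<sigma> \<in> ?S" for \<sigma>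
      using evenperm_comp[OF perm[OF that] pt] assms by (simp add: evenperm_swap)
    show "(\<lambda>\<sigma>. \<sigma> \<circ> ?t) ` ?E \<subseteq> ?O" "(\<lambda>\<sigma>. \<sigma> \<circ> ?t) ` ?O \<subseteq> ?E"
      using flip permutes_compose[OF t] by auto
  qed (auto simp: comp_assoc)
  have "det n V = (\<Sum>\<sigma>\<in>?E. of_int (sign \<sigma>) * ?f \<sigma>) + (\<Sum>\<sigma>\<in>?O. of_int (sign \<sigma>) * ?f \<sigma>)"
    unfolding det_def by (subst sum.union_disjoint[symmetric]) (auto intro!: sum.cong)
  also have "(\<Sum>\<sigma>\<in>?E. of_int (sign \<sigma>) * ?f \<sigma>) = (\<Sum>\<sigma>\<in>?E. ?f \<sigma>)"
    by (intro sum.cong) (auto simp: sign_def)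
  also have "(\<Sum>\<sigma>\<in>?O. of_int (sign \<sigma>) * ?f \<sigma>) = (\<Sum>\<sigma>\<in>?O. - ?f \<sigma>)"
    by (intro sum.cong) (auto simp: sign_def)
  also have "\<dots> = (\<Sum>\<sigma>\<in>?E. - ?f (\<sigma> \<circ> ?t))"
    by (rule sum.reindex_bij_betw[OF bij, symmetric])
  finally show ?thesis unfolding f by (simp add: sum_negf)
qed

text \<open>
  Rows chosen with a repetition give \<open>0\<close>, and rows chosen without one give a signed copy of the
  determinant.
\<close>

lemma det_select_rows: "\<exists>c. det n (\<lambda>i. a (f i)) = c * det n (a :: nat \<Rightarrow> nat \<Rightarrow> 'a::comm_ring_1)"
  if "f \<in> {..<n} \<rightarrow> {..<n}"
proof (cases "inj_on f {..<n}")
  case False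
  then obtain k l where "k < n" "l < n" "k \<noteq> l" "f k = f l" by (auto simp: inj_on_def)
  then have "det n (\<lambda>i. a (f i)) = 0" by (intro det_eq_rows[of k n l]) auto
  then show ?thesis by (intro exI[of _ 0]) simp
next
  case True
  define p where "p i = (if i < n then f i else i)" for i
  have "f ` {..<n} = {..<n}" using True that by (intro endo_inj_surj) auto
  then have "bij_betw f {..<n} {..<n}" using True by (simp add: bij_betw_def)
  then have "bij_betw p {..<n} {..<n}" by (rule bij_betw_cong[THEN iffD1, rotated]) (simp add: p_def)
  then have p: "p permutes {..<n}" by (rule bij_imp_permutes) (simp add: p_def)
  have perm: "permutation \<sigma>" if "\<sigma> permutes {..<n}" for \<sigma>
    using that permutation_permutes by fastforce
  have "det n (\<lambda>i. a (f i)) = det n (\<lambda>i. a (p i))" by (rule det_cong) (simp add: p_def)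
  also have "\<dots> = (\<Sum>\<sigma> | \<sigma> permutes {..<n}. of_int (sign (\<sigma> \<circ> p)) * (\<Prod>i<n. a (p i) (\<sigma> (p i))))"
    unfolding det_def by (subst sum_permutations_compose_right[OF p]) simp
  also have "\<dots> = (\<Sum>\<sigma> | \<sigma> permutes {..<n}. of_int (sign p) * (of_int (sign \<sigma>) * (\<Prod>i<n. a i (\<sigma> i))))"
  proof (intro sum.cong refl)
    fix \<sigma> assume "\<sigma> \<in> {\<sigma>. \<sigma> permutes {..<n}}"
    then have "sign (\<sigma> \<circ> p) = sign \<sigma> * sign p" using perm p by (intro sign_compose) auto
    moreover have "(\<Prod>i<n. a (p i) (\<sigma> (p i))) = (\<Prod>i<n. a i (\<sigma> i))"
      using prod.permute[OF p, of "\<lambda>i. a i (\<sigma> i)"] by (simp add: comp_def)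
    ultimately show "of_int (sign (\<sigma> \<circ> p)) * (\<Prod>i<n. a (p i) (\<sigma> (p i)))
        = of_int (sign p) * (of_int (sign \<sigma>) * (\<Prod>i<n. a i (\<sigma> i)))" by (simp add: mult_ac)
  qed
  also have "\<dots> = of_int (sign p) * det n a" by (simp add: det_def sum_distrib_left)
  finally show ?thesis by blast
qed

text \<open>
  The Leibniz sum for the rows \<open>\<Sum>\<^sub>j r i j a j\<close> expands over all choices of one \<open>a (f i)\<close> for each
  row. Only divisibility by the determinant of \<open>a\<close> is kept of the product formula for determinants.
\<close>

lemma det_combination:
  "\<exists>c. det n (\<lambda>i. \<Sum>j<n. smul (r i j) (a j)) = c * det n (a :: nat \<Rightarrow> nat \<Rightarrow> 'a::comm_ring_1)"
proof -
  let ?F = "PiE {..<n} (\<lambda>_. {..<n})"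
  have "det n (\<lambda>i. \<Sum>j<n. smul (r i j) (a j)) =
      (\<Sum>\<sigma> | \<sigma> permutes {..<n}. of_int (sign \<sigma>) * (\<Sum>f\<in>?F. \<Prod>i<n. r i (f i) * a (f i) (\<sigma> i)))"
    unfolding det_def by (simp add: prod_sum_PiE)
  also have "\<dots> = (\<Sum>f\<in>?F. (\<Prod>i<n. r i (f i)) * det n (\<lambda>i. a (f i)))"
    unfolding det_def sum_distrib_left
    by (subst sum.swap) (auto intro!: sum.cong simp: prod.distrib mult_ac)
  also have "\<dots> \<in> idl.span {det n a}"
  proof (rule idl.span_sum)
    fix f assume "f \<in> ?F"
    then obtain c where "det n (\<lambda>i. a (f i)) = c * det n a" using det_select_rows[of f n a] by (auto simp: PiE_def)
    then show "(\<Prod>i<n. r i (f i)) * det n (\<lambda>i. a (f i)) \<in> idl.span {det n a}"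
      by (metis idl.span_base idl.span_scale insertI1)
  qed
  finally show ?thesis by (auto simp: idl.span_singleton)
qed

text \<open>
  A permutation other than the identity moves some \<open>i\<close> upwards, and picks an entry that \<open>c\<close> kills.
\<close>

lemma mult_det_triangular:
  assumes "\<And>i j. i < j \<Longrightarrow> j < n \<Longrightarrow> c * V i j = 0"
  shows "c * det n V = c * (\<Prod>i<n. V i i)"
proof -
  have z: "c * (\<Prod>i<n. V i (\<sigma> i)) = 0" if "\<sigma> permutes {..<n}" "\<sigma> \<noteq> id" for \<sigma>
  proof -
    have "\<not> (\<forall>i\<in>{..<n}. \<sigma> i \<le> i)" using permutes_natset_le that by blast
    then obtain i where i: "i < n" "i < \<sigma> i" by (auto simp: not_le)
    then have "c * V i (\<sigma> i) = 0" using assms that perm_less by blast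
    then show ?thesis using i by (subst prod.remove[of _ i]) (auto simp: mult.assoc[symmetric])
  qed
  have "c * det n V = (\<Sum>\<sigma> | \<sigma> permutes {..<n}. of_int (sign \<sigma>) * (c * (\<Prod>i<n. V i (\<sigma> i))))"
    by (simp add: det_def sum_distrib_left mult_ac)
  also have "\<dots> = (\<Sum>\<sigma> | \<sigma> permutes {..<n}. if \<sigma> = id then c * (\<Prod>i<n. V i i) else 0)"
    using z by (intro sum.cong) (auto simp: sign_id)
  also have "\<dots> = c * (\<Prod>i<n. V i i)" by (subst sum.delta) (auto simp: permutes_id)
  finally show ?thesis .
qed

lemma span_pair: "idl.span {a, b} = {a * s + b * t | s t. True}"
proof -
  have "x \<in> idl.span {a, b} \<longleftrightarrow> (\<exists>s t. x = a * s + b * t)" for x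
    unfolding idl.span_breakdown_eq idl.span_empty singleton_iff diff_diff_eq eq_iff_diff_eq_0[symmetric]
    by (simp only: mult.commute)
  then show ?thesis by blast
qed

text \<open>
  For an idempotent \<open>e\<close> of a ring \<open>U\<close> this is the ring \<open>e U\<close> with unit \<open>e\<close>. Its ideals, and the
  submodules of its free modules, are the \<open>U\<close>-submodules that they contain.
\<close>

definition corner :: "'a::comm_ring_1 \<Rightarrow> 'a set" where
  "corner e = {r. e * r = r}"

definition free :: "'a::comm_ring_1 \<Rightarrow> nat \<Rightarrow> (nat \<Rightarrow> 'a) set" where
  "free e n = {v. (\<forall>i<n. v i \<in> corner e) \<and> (\<forall>i\<ge>n. v i = 0)}"

text \<open>
  The factor \<open>e\<close> brings the determinants into the corner also for \<open>n = 0\<close>, where the determinant is \<open>1\<close>.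
\<close>

definition Fit :: "'a::comm_ring_1 \<Rightarrow> nat \<Rightarrow> (nat \<Rightarrow> 'a) set \<Rightarrow> 'a set" where
  "Fit e n K = idl.span {e * det n V | V. \<forall>i<n. V i \<in> K}"

lemma subspace_corner: "idl.subspace (corner e)"
  by (rule idl.subspaceI) (auto simp: corner_def algebra_simps)

lemmas corner_zero = idl.subspace_0[OF subspace_corner]
  and corner_add = idl.subspace_add[OF subspace_corner]
  and corner_diff = idl.subspace_diff[OF subspace_corner]

lemma subspace_free: "vec.subspace (free e n)"
  using subspace_corner[of e] corner_zero
  by (intro vec.subspaceI) (auto simp: free_def idl.subspace_add idl.subspace_scale)

lemma subspace_Fit: "idl.subspace (Fit e n K)"
  by (simp add: Fit_def)

lemmas Fit_zero = idl.subspace_0[OF subspace_Fit]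
  and Fit_add = idl.subspace_add[OF subspace_Fit]
  and Fit_scale = idl.subspace_scale[OF subspace_Fit]

lemma Fit_det: "(\<And>i. i < n \<Longrightarrow> V i \<in> K) \<Longrightarrow> e * det n V \<in> Fit e n K"
  unfolding Fit_def by (rule idl.span_base) auto

lemma Fit_subset_corner: "e * e = e \<Longrightarrow> Fit e n K \<subseteq> corner e"
  unfolding Fit_def
  using subspace_corner[of e]
  by (intro idl.span_minimal) (auto simp: corner_def mult.assoc[symmetric])

text \<open>
  By multilinearity, changing a row by \<open>b w\<close> changes the determinant by \<open>b\<close> times a determinant of
  vectors of \<open>K\<close>; the rows are changed one after the other.
\<close>

lemma det_perturb:
  assumes K: "vec.subspace K" and a: "\<And>i. i < n \<Longrightarrow> a i \<in> K" and w: "\<And>i. i < n \<Longrightarrow> w i \<in> K"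
  shows "e * det n (\<lambda>i. a i + smul b (w i)) - e * det n a \<in> (*) b ` Fit e n K"
proof -
  let ?W = "\<lambda>m i. if i < m then a i + smul b (w i) else a i"
  have sub: "idl.subspace ((*) b ` Fit e n K)" by (intro subspace_mult_image subspace_Fit)
  have "e * det n (?W m) - e * det n a \<in> (*) b ` Fit e n K" if "m \<le> n" for m
    using that
  proof (induction m)
    case 0
    then show ?case using idl.subspace_0[OF sub] by simp
  next
    case (Suc m)
    have "?W (Suc m) = (?W m)(m := a m + smul b (w m))" by (auto simp: fun_eq_iff less_Suc_eq)
    moreover have "(?W m)(m := a m) = ?W m" by (auto simp: fun_eq_iff)
    ultimately have "det n (?W (Suc m)) = det n (?W m) + b * det n ((?W m)(m := w m))"
      using Suc.prems by (simp add: det_row_add det_row_smul)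
    then have eq: "e * det n (?W (Suc m)) - e * det n a
        = (e * det n (?W m) - e * det n a) + b * (e * det n ((?W m)(m := w m)))"
      by (simp add: algebra_simps)
    have "e * det n ((?W m)(m := w m)) \<in> Fit e n K"
      using a w K Suc.prems by (intro Fit_det) (auto intro!: vec.subspace_add vec.subspace_scale)
    then show ?case unfolding eq using Suc by (intro idl.subspace_add[OF sub]) auto
  qed
  from this[of n] show ?thesis
    using det_cong[of n "?W n" "\<lambda>i. a i + smul b (w i)"] by simp
qed

section \<open>Lattices over a discrete valuation ring\<close>

lemma cornerI: "e * e = e \<Longrightarrow> e * r \<in> corner e"
  by (simp add: corner_def mult.assoc[symmetric])

lemma corner_unit: "r \<in> corner e \<Longrightarrow> e * r = r" "r \<in> corner e \<Longrightarrow> r * e = r"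
  by (simp_all add: corner_def mult.commute)

lemma corner_mult: "r \<in> corner e \<Longrightarrow> s * r \<in> corner e" "r \<in> corner e \<Longrightarrow> r * s \<in> corner e"
  using idl.subspace_scale[OF subspace_corner] by (auto simp: mult.commute)

lemma free_unit: "v \<in> free e n \<Longrightarrow> smul e v = v"
proof
  fix i assume "v \<in> free e n"
  then show "smul e v i = v i" by (cases "i < n") (auto simp: free_def corner_def)
qed

lemma smul_det_cong:
  assumes "\<And>i. i < n \<Longrightarrow> smul c (V i) = smul c (W i)"
  shows "c * det n V = c * det n W"
  using assms by (intro mult_det_cong) (metis smul_apply)

text \<open>
  The corner acts on \<open>c R\<close> through its quotient by the annihilator of \<open>c\<close>. The assumptions say that this
  quotient behaves as a discrete valuation ring with uniformizer \<open>c\<close>: \<open>reduced\<close> makes \<open>c\<close> regular on it,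
  and by \<open>local\<close> every non-unit is a multiple of \<open>c\<close> there.
\<close>

locale uniformizer =
  fixes e c :: "'a::comm_ring_1"
  assumes idem: "e * e = e"
    and reduced: "\<And>r. r \<in> corner e \<Longrightarrow> c * (c * r) = 0 \<Longrightarrow> c * r = 0"
    and sep: "\<And>r. r \<in> corner e \<Longrightarrow> (\<And>i. \<exists>s. r = c ^ i * s) \<Longrightarrow> r = 0"
    and local: "\<And>r. r \<in> corner e \<Longrightarrow> (\<exists>s. r * s = e) \<or> (\<exists>s\<in>corner e. c * r = c * (c * s))"
begin

abbreviation D where "D \<equiv> (*) c ` corner e"

lemma e_corner: "e \<in> corner e" by (simp add: corner_def idem)

lemma subspace_D: "idl.subspace D"
  by (intro subspace_mult_image subspace_corner)

lemma power_cancel: "x \<in> D \<Longrightarrow> c ^ i * x = 0 \<Longrightarrow> x = 0"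
proof (induction i)
  case (Suc i)
  obtain r where r: "r \<in> corner e" "x = c * r" using Suc.prems by auto
  have "c * (c * (c ^ i * r)) = 0" using Suc.prems r by (simp add: mult_ac)
  then have "c * (c ^ i * r) = 0" using reduced corner_mult(1)[OF r(1)] by blast
  then show ?case using Suc r by (simp add: mult_ac)
qed simp

text \<open>
  By the first assumption \<open>d\<close> divides a power of \<open>c\<close> on \<open>D\<close>, and these powers act injectively.
\<close>

lemma generator_regular:
  assumes "c ^ k * (c * e) \<in> (*) d ` D" and r: "r \<in> corner e" and z: "d * (c * r) = 0"
  shows "c * r = 0"
proof -
  obtain t where "c ^ k * (c * e) = d * (c * t)" using assms(1) by auto
  then have "c ^ k * (c * e) * r = t * (d * (c * r))" by (simp add: mult_ac)
  then have "c ^ k * (c * r) = 0" by (simp add: mult.assoc corner_unit(1)[OF r] z)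
  then show ?thesis using power_cancel[of "c * r" k] r by blast
qed

text \<open>
  Then \<open>c e\<close> is divisible by all powers of \<open>c\<close>.
\<close>

lemma unit_divisible_imp_zero:
  assumes s: "s \<in> corner e" and ce: "c * e = c * (c * s)"
  shows "c * e = 0"
proof (rule sep)
  have "c * (c * s) = c * (c * (s * e))" unfolding corner_unit(2)[OF s] ..
  also have "\<dots> = c * s * (c * e)" by (simp only: mult_ac)
  finally have step: "c * e = c * s * (c * e)" using ce by simp
  fix i
  have "c * e = c ^ i * (s ^ i * (c * e))"
  proof (induction i)
    case (Suc i)
    have "c ^ i * (s ^ i * (c * s * (c * e))) = c ^ Suc i * (s ^ Suc i * (c * e))"
      by (simp only: power_Suc mult_ac)
    with Suc show ?case unfolding step[symmetric] by (rule trans)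
  qed simp
  then show "\<exists>s. c * e = c ^ i * s" ..
qed (use corner_mult(1)[OF e_corner] in blast)

lemma power_unit:
  assumes "r \<in> corner e" "c * r \<noteq> 0"
  shows "\<exists>i u s. u \<in> corner e \<and> u * s = e \<and> c * r = c ^ i * (c * u)"
proof (rule ccontr)
  assume no: "\<not> ?thesis"
  have "\<exists>u\<in>corner e. c * r = c ^ i * (c * u)" for i
  proof (induction i)
    case 0
    then show ?case using assms by auto
  next
    case (Suc i)
    then obtain u where u: "u \<in> corner e" "c * r = c ^ i * (c * u)" by blast
    then obtain s where "s \<in> corner e" "c * u = c * (c * s)" using local[OF u(1)] no by blast
    then show ?case using u by (intro bexI[of _ s]) (auto simp: mult_ac)
  qed
  then have "\<exists>s. c * r = c ^ i * s" for i by blast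
  then show False using sep[of "c * r"] corner_mult assms by blast
qed

text \<open>
  A nonzero ideal is generated by the element of least valuation. If \<open>0\<close> has finite index, then \<open>D\<close> is
  finite, two powers of \<open>c\<close> agree on it, and separatedness makes that power of \<open>c\<close> vanish
  on \<open>D\<close>.
\<close>

lemma subspace_eq_power:
  assumes I: "idl.subspace I" "I \<subseteq> D" and fin: "0 < index D I"
  shows "\<exists>k. I = (*) (c ^ k) ` D"
proof (cases "I = {0}")
  case True
  let ?x = "\<lambda>i. c ^ i * (c * e)"
  have "index D I = card ((\<lambda>x. x) ` D)"
    using True subspace_subgrp(1)[OF I(1)] by (intro index_eq_card_image) auto
  then have "finite D" using fin by (simp add: card_gt_0_iff)
  moreover have "range ?x \<subseteq> D"
    using corner_mult(1)[OF e_corner] by (auto simp: image_iff mult.left_commute)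
  ultimately have "\<not> inj ?x" using finite_subset finite_imageD infinite_UNIV_nat by blast
  then obtain i j where ij: "i < j" "?x i = ?x j"
    unfolding inj_def by (metis linorder_neqE_nat)
  have "c ^ (j - i) * ?x i = c ^ (j - i + i) * (c * e)" by (simp add: power_add mult.assoc)
  then have step: "?x i = c ^ (j - i) * ?x i" using ij by simp
  have "?x i = c ^ (m * (j - i)) * ?x i" for m
    by (induction m) (use step in \<open>auto simp: power_add mult.assoc\<close>)
  moreover have "m \<le> m * (j - i)" for m using mult_le_mono2[of 1 "j - i" m] ij(1) by linarith
  ultimately have "?x i = c ^ m * (c ^ (m * (j - i) - m) * ?x i)" for m
    by (metis mult.assoc power_add le_add_diff_inverse)
  then have "?x i = 0" using corner_mult(1)[OF corner_mult(1)[OF e_corner]] by (intro sep) blast+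
  then have "c ^ i * (c * r) = 0" if "r \<in> corner e" for r
    using corner_unit(1)[OF that] by (metis mult.assoc mult_zero_left)
  then have "(*) (c ^ i) ` D = {0}" using e_corner by (auto simp: image_iff)
  then show ?thesis using True by blast
next
  case False
  then obtain x where x: "x \<in> I" "x \<noteq> 0" using idl.subspace_0[OF I(1)] by auto
  have ex: "c ^ i * (c * e) \<in> I" if "c ^ i * (c * u) \<in> I" "u * s = e" for i u s
    using idl.subspace_scale[OF I(1) that(1), of s] that(2) by (metis mult.commute mult.left_commute)
  obtain r where r: "r \<in> corner e" "x = c * r" using x I(2) by auto
  obtain i u s where "u * s = e" "c * r = c ^ i * (c * u)" using power_unit[OF r(1)] x r by blast
  then have ex_i: "c ^ i * (c * e) \<in> I" using ex[of i u s] x r by auto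
  define k where "k = (LEAST i. c ^ i * (c * e) \<in> I)"
  have k: "c ^ k * (c * e) \<in> I" unfolding k_def by (rule LeastI) (rule ex_i)
  have least: "k \<le> i" if "c ^ i * (c * e) \<in> I" for i unfolding k_def by (rule Least_le) (rule that)
  have "I = (*) (c ^ k) ` D"
  proof
    show "(*) (c ^ k) ` D \<subseteq> I"
    proof clarify
      fix r assume "r \<in> corner e"
      then have "c ^ k * (c * r) = r * (c ^ k * (c * e))"
        by (simp add: corner_unit mult.left_commute[of r])
      then show "c ^ k * (c * r) \<in> I" using idl.subspace_scale[OF I(1) k] by simp
    qed
    show "I \<subseteq> (*) (c ^ k) ` D"
    proof
      fix y assume y: "y \<in> I"
      show "y \<in> (*) (c ^ k) ` D"
      proof (cases "y = 0")
        case True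
        then show ?thesis
          using idl.subspace_0[OF subspace_mult_image[OF subspace_D]] by blast
      next
        case False
        obtain r where r: "r \<in> corner e" "y = c * r" using y I(2) by auto
        obtain i u s where u: "u \<in> corner e" "u * s = e" "y = c ^ i * (c * u)"
          using power_unit[OF r(1)] False r(2) by blast
        have "k \<le> i" using ex[of i u s] y u least by blast
        then have "c ^ i = c ^ k * c ^ (i - k)" by (simp add: power_add[symmetric])
        then have "y = c ^ k * (c * (c ^ (i - k) * u))" using u(3) by (simp only: mult_ac)
        then show ?thesis using corner_mult(1)[OF u(1)] by blast
      qed
    qed
  qed
  then show ?thesis by blast
qed

lemma index_power_add:
  "index D ((*) (c ^ (k + l)) ` D) = index D ((*) (c ^ k) ` D) * index D ((*) (c ^ l) ` D)"
proof -
  have sub: "subgrp ((*) (c ^ i) ` D)" for i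
    by (intro subspace_subgrp subspace_mult_image subspace_corner)
  have in_D: "(*) (c ^ i) ` D \<subseteq> D" for i
    using idl.subspace_scale[OF subspace_D] by auto
  have eq: "(*) (c ^ (k + l)) ` D = (*) (c ^ k) ` (*) (c ^ l) ` D"
    by (simp add: image_image power_add mult.assoc)
  have "index ((*) (c ^ k) ` D) ((*) (c ^ k) ` (*) (c ^ l) ` D) = index D ((*) (c ^ l) ` D)"
    using sub[of 0] sub[of l] in_D power_cancel
    by (intro index_inj_image additive_mult) (auto simp: image_image)
  then show ?thesis
    using index_tower[of D "(*) (c ^ k) ` D" "(*) (c ^ (k + l)) ` D"] sub[of 0] sub[of k] sub[of "k + l"]
      in_D image_mono[OF in_D, of "(*) (c ^ k)"] eq by (simp add: image_image)
qed

text \<open>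
  The last coordinates of the vectors of \<open>X\<close> form an ideal \<open>c\<^sup>k D\<close>; a vector attaining a generator, together
  with a triangular basis of the vectors with last coordinate \<open>0\<close>, is a triangular basis of \<open>X\<close>. The
  indices multiply along this projection.
\<close>

lemma triangular_basis:
  assumes "vec.subspace X" "X \<subseteq> smul c ` free e n" "0 < index (smul c ` free e n) X"
  shows "\<exists>l u. (\<forall>i<n. u i \<in> X \<and> (\<forall>j>i. u i j = 0) \<and> u i i = c ^ l i * (c * e)) \<and>
    (\<forall>x\<in>X. \<exists>s. x = (\<Sum>i<n. smul (s i) (u i))) \<and>
    index (smul c ` free e n) X = index D ((*) (c ^ (\<Sum>i<n. l i)) ` D)"
  using assms
proof (induction n arbitrary: X)
  case 0
  have "free e 0 = {0}" by (auto simp: free_def fun_eq_iff)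
  then have L: "smul c ` free e 0 = {0}" by (simp add: fun_eq_iff)
  then have X: "X = {0}" using 0(2) vec.subspace_0[OF 0(1)] by blast
  have "subgrp {0 :: nat \<Rightarrow> 'a}" by (simp add: subgrp_def)
  then show ?case unfolding L X using index_self[of "{0 :: nat \<Rightarrow> 'a}"] index_self[of D] subspace_subgrp(1)[OF subspace_D] by simp
next
  case (Suc n)
  let ?L = "smul c ` free e (Suc n)" and ?p = "\<lambda>v::nat \<Rightarrow> 'a. v n"
  let ?X = "{x\<in>X. ?p x = 0}"
  have L: "subgrp ?L" by (intro subspace_subgrp subspace_smul_image subspace_free)
  have add: "additive_on A ?p" for A by (simp add: additive_on_def)
  have idx: "index ?L X = index (?p ` ?L) (?p ` X) * index {x\<in>?L. ?p x = 0} ?X"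
    by (rule index_image_kernel[OF L subspace_subgrp(2)[OF Suc.prems(1)] Suc.prems(2) add])
  have pL: "?p ` ?L = D"
  proof
    show "?p ` ?L \<subseteq> D" by (auto simp: free_def)
    show "D \<subseteq> ?p ` ?L"
    proof clarify
      fix r assume r: "r \<in> corner e"
      let ?v = "(\<lambda>i. if i = n then r else 0)"
      have "?v \<in> free e (Suc n)" using r corner_zero by (auto simp: free_def)
      then show "c * r \<in> ?p ` ?L" by (intro image_eqI[of _ ?p "smul c ?v"]) auto
    qed
  qed
  have kL: "{x\<in>?L. ?p x = 0} = smul c ` free e n"
  proof
    show "{x\<in>?L. ?p x = 0} \<subseteq> smul c ` free e n"
    proof clarify
      fix v assume v: "v \<in> free e (Suc n)" "smul c v n = 0"
      then have "v(n := 0) \<in> free e n" by (auto simp: free_def)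
      moreover have "smul c v = smul c (v(n := 0))" using v(2) by (auto simp: fun_eq_iff)
      ultimately show "smul c v \<in> smul c ` free e n" by blast
    qed
    show "smul c ` free e n \<subseteq> {x\<in>?L. ?p x = 0}"
    proof clarify
      fix v assume v: "v \<in> free e n"
      then have "v \<in> free e (Suc n)"
        using corner_zero by (auto simp: free_def less_Suc_eq)
      then show "smul c v \<in> ?L \<and> smul c v n = 0" using v by (auto simp: free_def)
    qed
  qed
  have X': "vec.subspace ?X"
    by (rule vec.subspaceI)
      (auto simp: vec.subspace_0[OF Suc.prems(1)] vec.subspace_add[OF Suc.prems(1)] vec.subspace_scale[OF Suc.prems(1)])
  have pX: "idl.subspace (?p ` X)"
  proof (rule idl.subspaceI)
    show "0 \<in> ?p ` X" using vec.subspace_0[OF Suc.prems(1)] by (intro image_eqI[of _ ?p 0]) auto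
    show "x + y \<in> ?p ` X" if xy: "x \<in> ?p ` X" "y \<in> ?p ` X" for x y
    proof -
      obtain v w where "v \<in> X" "w \<in> X" "x = v n" "y = w n" using xy by blast
      then show ?thesis using vec.subspace_add[OF Suc.prems(1)] by (intro image_eqI[of _ ?p "v + w"]) auto
    qed
    show "r * x \<in> ?p ` X" if x: "x \<in> ?p ` X" for r x
    proof -
      obtain v where "v \<in> X" "x = v n" using x by blast
      then show ?thesis using vec.subspace_scale[OF Suc.prems(1)] by (intro image_eqI[of _ ?p "smul r v"]) simp_all
    qed
  qed
  have pos: "0 < index D (?p ` X)" "0 < index (smul c ` free e n) ?X"
    using Suc.prems(3) unfolding idx pL kL by simp_all
  have sub: "?X \<subseteq> smul c ` free e n" using Suc.prems(2) kL by blast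
  obtain l u where IH: "\<And>i. i < n \<Longrightarrow> u i \<in> ?X \<and> (\<forall>j>i. u i j = 0) \<and> u i i = c ^ l i * (c * e)"
    "\<And>x. x \<in> ?X \<Longrightarrow> \<exists>s. x = (\<Sum>i<n. smul (s i) (u i))"
    "index (smul c ` free e n) ?X = index D ((*) (c ^ (\<Sum>i<n. l i)) ` D)"
    using Suc.IH[OF X' sub pos(2)] by blast
  have "?p ` X \<subseteq> D" unfolding pL[symmetric] by (rule image_mono[OF Suc.prems(2)])
  then obtain k where k: "?p ` X = (*) (c ^ k) ` D" using subspace_eq_power[OF pX _ pos(1)] by blast
  have "c ^ k * (c * e) \<in> ?p ` X" unfolding k using e_corner by blast
  then obtain w where w: "w \<in> X" "w n = c ^ k * (c * e)" by force
  define u' where "u' = u(n := w)"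
  define l' where "l' = l(n := k)"
  have big: "x j = 0" if xj: "x \<in> X" "n < j" for x j
  proof -
    obtain v where "v \<in> free e (Suc n)" "x = smul c v" using xj(1) Suc.prems(2) by blast
    then show ?thesis using xj(2) by (simp add: free_def)
  qed
  have 1: "u' i \<in> X \<and> (\<forall>j>i. u' i j = 0) \<and> u' i i = c ^ l' i * (c * e)" if "i < Suc n" for i
    using that IH(1)[of i] w big[OF w(1)] by (auto simp: u'_def l'_def less_Suc_eq)
  have 2: "\<exists>s. x = (\<Sum>i<Suc n. smul (s i) (u' i))" if x: "x \<in> X" for x
  proof -
    obtain r where r: "r \<in> corner e" "x n = c ^ k * (c * r)" using x k by (metis (mono_tags, lifting) image_iff)
    have "x - smul r w \<in> ?X"
      using vec.subspace_diff[OF Suc.prems(1) x vec.subspace_scale[OF Suc.prems(1) w(1)]] r w(2)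
        corner_unit(2)[OF r(1)] by (simp add: mult.left_commute[of r])
    then obtain s where "x - smul r w = (\<Sum>i<n. smul (s i) (u i))" using IH(2) by blast
    then have "x = (\<Sum>i<n. smul (s i) (u i)) + smul r w" by (simp add: algebra_simps)
    also have "\<dots> = (\<Sum>i<Suc n. smul ((s(n := r)) i) (u' i))" by (simp add: u'_def)
    finally show ?thesis by blast
  qed
  have "(\<Sum>i<n. l' i) = (\<Sum>i<n. l i)" by (intro sum.cong) (auto simp: l'_def)
  then have sl: "(\<Sum>i<Suc n. l' i) = k + (\<Sum>i<n. l i)" by (simp add: l'_def)
  have 3: "index ?L X = index D ((*) (c ^ (\<Sum>i<Suc n. l' i)) ` D)"
    unfolding sl index_power_add idx pL kL k IH(3) ..
  show ?case using 1 2 3 by blast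
qed

text \<open>
  The vectors \<open>c w i\<close> are a triangular basis of \<open>c K\<close>. Every determinant of vectors of \<open>K\<close> is, after
  multiplication by \<open>c\<close>, a multiple of the one of \<open>w\<close>, whose value is the product of the diagonal
  entries; so \<open>c F\<close> and \<open>c K\<close> have the same index.
\<close>

theorem Fit_scaled:
  assumes K: "vec.subspace K" "K \<subseteq> free e n" and fin: "0 < index (free e n) K"
  obtains w k where "\<forall>i<n. w i \<in> K"
    "\<forall>v\<in>K. \<exists>s. (\<forall>i. s i \<in> corner e) \<and> smul c v = smul c (\<Sum>i<n. smul (s i) (w i))"
    "c * (e * det n w) = c ^ k * (c * e)"
    "(*) c ` Fit e n K = (*) (c ^ k) ` D"
    "index (smul c ` free e n) (smul c ` K) = index D ((*) c ` Fit e n K)"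
proof -
  have "index (free e n) K = index (smul c ` free e n) (smul c ` K) *
      index {v\<in>free e n. smul c v = 0} {v\<in>K. smul c v = 0}"
    by (intro index_image_kernel subspace_subgrp subspace_free K additive_mult)
  then have "0 < index (smul c ` free e n) (smul c ` K)" using fin by simp
  from triangular_basis[OF subspace_smul_image[OF K(1)] image_mono[OF K(2)] this]
  obtain l u where lu: "(\<forall>i<n. u i \<in> smul c ` K \<and> (\<forall>j>i. u i j = 0) \<and> u i i = c ^ l i * (c * e)) \<and>
      (\<forall>x\<in>smul c ` K. \<exists>s. x = (\<Sum>i<n. smul (s i) (u i))) \<and>
      index (smul c ` free e n) (smul c ` K) = index D ((*) (c ^ (\<Sum>i<n. l i)) ` D)"
    by (elim exE) (rule that)
  have u: "\<And>i. i < n \<Longrightarrow> u i \<in> smul c ` K \<and> (\<forall>j>i. u i j = 0) \<and> u i i = c ^ l i * (c * e)"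
    and span: "\<And>x. x \<in> smul c ` K \<Longrightarrow> \<exists>s. x = (\<Sum>i<n. smul (s i) (u i))"
    and idx: "index (smul c ` free e n) (smul c ` K) = index D ((*) (c ^ (\<Sum>i<n. l i)) ` D)"
    using lu by blast+
  define k where "k = (\<Sum>i<n. l i)"
  have "\<forall>i. \<exists>w. i < n \<longrightarrow> w \<in> K \<and> u i = smul c w" using u by blast
  then obtain w where w: "\<And>i. i < n \<Longrightarrow> w i \<in> K \<and> u i = smul c (w i)" by metis
  have comb: "\<exists>s. (\<forall>i. s i \<in> corner e) \<and> smul c v = smul c (\<Sum>i<n. smul (s i) (w i))" if v: "v \<in> K" for v
  proof -
    obtain s where s: "smul c v = (\<Sum>i<n. smul (s i) (u i))" using span v by blast
    have "smul c v = smul e (smul c v)" using free_unit[of v e n] v K(2)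
      by (metis subsetD vec.scale_left_commute)
    also have "\<dots> = smul c (\<Sum>i<n. smul (e * s i) (w i))"
      unfolding s using w by (simp add: fun_eq_iff sum_distrib_left mult_ac)
    finally show ?thesis using cornerI[OF idem] by (intro exI[of _ "\<lambda>i. e * s i"]) auto
  qed
  have dw: "c * (e * det n w) = c ^ k * (c * e)"
  proof -
    have wc: "c * w i j = u i j" if "i < n" for i j using w[OF that] by (simp add: fun_eq_iff)
    have "(c * e) * det n w = (c * e) * (\<Prod>i<n. w i i)"
    proof (rule mult_det_triangular)
      fix i j assume ij: "i < j" "j < n"
      then have "c * w i j = 0" using u[of i] wc[of i j] by auto
      then show "c * e * w i j = 0" by (metis mult.assoc mult.commute mult_zero_right)
    qed
    also have "\<dots> = (c * e) * (\<Prod>i<n. c ^ l i)"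
    proof (rule mult_prod_cong)
      fix i assume "i \<in> {..<n}"
      then have "c * w i i = c ^ l i * (c * e)" using u[of i] wc[of i i] by auto
      then have "e * (c * w i i) = c ^ l i * (c * (e * e))" by (simp only: mult_ac)
      then show "c * e * w i i = c * e * c ^ l i" unfolding idem by (simp only: mult_ac)
    qed
    finally show ?thesis by (simp add: k_def power_sum mult_ac)
  qed
  have Fit: "(*) c ` Fit e n K = (*) (c ^ k) ` D"
  proof
    have pD: "idl.subspace ((*) (c ^ k) ` D)" by (intro subspace_mult_image subspace_corner)
    have "Fit e n K \<subseteq> {x. c * x \<in> (*) (c ^ k) ` D}"
      unfolding Fit_def
    proof (rule idl.span_minimal)
      show "idl.subspace {x. c * x \<in> (*) (c ^ k) ` D}"
        using idl.subspace_0[OF pD] idl.subspace_add[OF pD] idl.subspace_scale[OF pD]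
        by (intro idl.subspaceI) (auto simp only: mem_Collect_eq distrib_left mult.left_commute[of c] mult_zero_right)
      show "{e * det n V | V. \<forall>i<n. V i \<in> K} \<subseteq> {x. c * x \<in> (*) (c ^ k) ` D}"
      proof clarify
        fix V assume "\<forall>i<n. V i \<in> K"
        then have "\<forall>i. \<exists>s. i < n \<longrightarrow> smul c (V i) = smul c (\<Sum>j<n. smul (s j) (w j))" using comb by blast
        then obtain s where "\<And>i. i < n \<Longrightarrow> smul c (V i) = smul c (\<Sum>j<n. smul (s i j) (w j))" by metis
        then have "c * det n V = c * det n (\<lambda>i. \<Sum>j<n. smul (s i j) (w j))"
          by (rule smul_det_cong)
        moreover obtain d where "det n (\<lambda>i. \<Sum>j<n. smul (s i j) (w j)) = d * det n w"
          using det_combination by blast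
        ultimately have "c * (e * det n V) = d * (c * (e * det n w))" by (metis mult.left_commute)
        then have "c * (e * det n V) = d * (c ^ k * (c * e))" unfolding dw .
        moreover have "c ^ k * (c * e) \<in> (*) (c ^ k) ` D" using e_corner by blast
        ultimately show "c * (e * det n V) \<in> (*) (c ^ k) ` D" using idl.subspace_scale[OF pD] by metis
      qed
    qed
    then show "(*) c ` Fit e n K \<subseteq> (*) (c ^ k) ` D" by blast
    show "(*) (c ^ k) ` D \<subseteq> (*) c ` Fit e n K"
    proof clarify
      fix r assume "r \<in> corner e"
      then have "c ^ k * (c * r) = r * (c * (e * det n w))"
        unfolding dw by (simp add: corner_unit mult.left_commute[of r])
      also have "\<dots> = c * (r * (e * det n w))" by (simp add: mult_ac)
      finally have "c ^ k * (c * r) = c * (r * (e * det n w))" .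
      moreover have "r * (e * det n w) \<in> Fit e n K"
        using w by (intro Fit_scale Fit_det) auto
      ultimately show "c ^ k * (c * r) \<in> (*) c ` Fit e n K" by (rule image_eqI)
    qed
  qed
  show ?thesis
  proof (rule that)
    show "\<forall>i<n. w i \<in> K" using w by blast
    show "\<forall>v\<in>K. \<exists>s. (\<forall>i. s i \<in> corner e) \<and> smul c v = smul c (\<Sum>i<n. smul (s i) (w i))"
      using comb by blast
    show "index (smul c ` free e n) (smul c ` K) = index D ((*) c ` Fit e n K)"
      unfolding Fit idx k_def ..
  qed (fact dw Fit)+
qed

end

section \<open>Local rings with a node\<close>

text \<open>
  The claim for the ring \<open>corner e\<close> and its finite modules \<open>free e n / K\<close>. As the index of \<open>K\<close> is positive,
  the inequality includes that the Fitting ideal has finite index.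
\<close>

definition fitting_bound :: "'a::comm_ring_1 \<Rightarrow> bool" where
  "fitting_bound e \<longleftrightarrow> (\<forall>n K. vec.subspace K \<longrightarrow> K \<subseteq> free e n \<longrightarrow> 0 < index (free e n) K \<longrightarrow>
     index (free e n) K \<le> index (corner e) (Fit e n K) \<and>
     ((\<exists>g. Fit e n K = (*) g ` corner e) \<longrightarrow> index (free e n) K = index (corner e) (Fit e n K)))"

text \<open>
  By \<open>local\<close> the ring has the maximal ideal generated by \<open>a\<close> and \<open>b\<close>. By \<open>ker_ab\<close> it embeds into
  the product of its quotients by \<open>a\<close> and by \<open>b\<close>, the two branches, which the annihilator conditions
  identify with \<open>b R\<close> and \<open>a R\<close>.
\<close>

locale node =
  fixes e a b :: "'a::comm_ring_1"
  assumes idem: "e * e = e"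
    and ker_a: "\<And>r. r \<in> corner e \<Longrightarrow> a * r = 0 \<longleftrightarrow> (\<exists>s\<in>corner e. r = b * s)"
    and ker_b: "\<And>r. r \<in> corner e \<Longrightarrow> b * r = 0 \<longleftrightarrow> (\<exists>s\<in>corner e. r = a * s)"
    and ker_ab: "\<And>r. r \<in> corner e \<Longrightarrow> a * r = 0 \<Longrightarrow> b * r = 0 \<Longrightarrow> r = 0"
    and sep_a: "\<And>r. r \<in> corner e \<Longrightarrow> (\<And>i. \<exists>s. r = a ^ i * s) \<Longrightarrow> r = 0"
    and sep_b: "\<And>r. r \<in> corner e \<Longrightarrow> (\<And>i. \<exists>s. r = b ^ i * s) \<Longrightarrow> r = 0"
    and local: "\<And>r. r \<in> corner e \<Longrightarrow>
      (\<exists>s. r * s = e) \<or> (\<exists>s\<in>corner e. \<exists>t\<in>corner e. r = a * s + b * t)"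
    and finite_residue: "0 < index (corner e) {a * s + b * t | s t. s \<in> corner e \<and> t \<in> corner e}"
begin

lemma e_corner: "e \<in> corner e" by (simp add: corner_def idem)

lemma ab: "r \<in> corner e \<Longrightarrow> a * (b * r) = 0" "r \<in> corner e \<Longrightarrow> b * (a * r) = 0"
  using ker_a[of "b * r"] ker_b[of "a * r"] corner_mult(1) by blast+

lemma reduced_a: assumes r: "r \<in> corner e" and "a * (a * r) = 0" shows "a * r = 0"
  using ker_ab[of "a * r"] corner_mult(1)[OF r] assms(2) ab(2)[OF r] by blast

lemma reduced_b: assumes r: "r \<in> corner e" and "b * (b * r) = 0" shows "b * r = 0"
  using ker_ab[of "b * r"] corner_mult(1)[OF r] assms(2) ab(1)[OF r] by blast

sublocale A: uniformizer e a
proof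
  show "(\<exists>s. r * s = e) \<or> (\<exists>s\<in>corner e. a * r = a * (a * s))" if "r \<in> corner e" for r
    using local[OF that] ab(1) by (force simp: distrib_left)
qed (use idem reduced_a sep_a in blast)+

sublocale B: uniformizer e b
proof
  show "(\<exists>s. r * s = e) \<or> (\<exists>s\<in>corner e. b * r = b * (b * s))" if "r \<in> corner e" for r
    using local[OF that] ab(2) by (force simp: distrib_left)
qed (use idem reduced_b sep_b in blast)+

definition J where "J = {a * s + b * t | s t. s \<in> corner e \<and> t \<in> corner e}"

lemma J_I: "s \<in> corner e \<Longrightarrow> t \<in> corner e \<Longrightarrow> a * s + b * t \<in> J"
  unfolding J_def by blast

lemma subspace_J: "idl.subspace J"
proof -
  have "idl.span {a * e, b * e} = J"
    unfolding span_pair J_def mult.assoc using cornerI[OF idem] corner_unit(1) by (metis (lifting))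
  then show ?thesis using idl.subspace_span by metis
qed

lemma J_subset: "J \<subseteq> corner e"
  unfolding J_def using corner_mult(1) corner_add by blast

lemma ker_a_eq: "{x\<in>corner e. a * x = 0} = (*) b ` corner e"
  using ker_a corner_mult(1) by auto

lemma ker_b_eq: "{x\<in>corner e. b * x = 0} = (*) a ` corner e"
  using ker_b corner_mult(1) by auto

lemma ker_a_free: "{v\<in>free e n. smul a v = 0} = smul b ` free e n"
proof
  show "smul b ` free e n \<subseteq> {v\<in>free e n. smul a v = 0}"
  proof clarify
    fix v assume v: "v \<in> free e n"
    have "a * (b * v i) = 0" for i using v ab(1) by (cases "i < n") (auto simp: free_def)
    then show "smul b v \<in> free e n \<and> smul a (smul b v) = 0"
      using vec.subspace_scale[OF subspace_free v] by (auto simp: fun_eq_iff mult.assoc)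
  qed
  show "{v\<in>free e n. smul a v = 0} \<subseteq> smul b ` free e n"
  proof clarify
    fix v assume v: "v \<in> free e n" "smul a v = 0"
    have "\<exists>s. (i < n \<longrightarrow> s \<in> corner e) \<and> (n \<le> i \<longrightarrow> s = 0) \<and> v i = b * s" for i
    proof (cases "i < n")
      case True
      then have "v i \<in> corner e" "a * v i = 0" using v by (auto simp: free_def fun_eq_iff)
      then show ?thesis using True ker_a[of "v i"] by auto
    next
      case False
      then show ?thesis using v by (intro exI[of _ 0]) (auto simp: free_def)
    qed
    then obtain s where "\<And>i. (i < n \<longrightarrow> s i \<in> corner e) \<and> (n \<le> i \<longrightarrow> s i = 0) \<and> v i = b * s i" by metis
    then have "s \<in> free e n" "v = smul b s" by (auto simp: free_def fun_eq_iff)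
    then show "v \<in> smul b ` free e n" by blast
  qed
qed

text \<open>
  The branch \<open>b R\<close> has the same residue field as \<open>R\<close>: \<open>b r\<close> lies in \<open>b\<^sup>2 R\<close> exactly when \<open>r\<close> lies in
  \<open>b R + ker b = J\<close>.
\<close>

lemma index_b_square: "index ((*) b ` corner e) ((*) b ` (*) b ` corner e) = index (corner e) J"
proof -
  have "{x\<in>J. b * x = 0} = {x\<in>corner e. b * x = 0}"
  proof -
    have "(*) a ` corner e \<subseteq> J"
      using J_I[of _ 0] idl.subspace_0[OF subspace_corner[of e]] by force
    then show ?thesis using J_subset ker_b_eq by blast
  qed
  moreover have "(*) b ` J = (*) b ` (*) b ` corner e"
  proof
    show "(*) b ` J \<subseteq> (*) b ` (*) b ` corner e"
      using ab(2) by (force simp: J_def distrib_left)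
    show "(*) b ` (*) b ` corner e \<subseteq> (*) b ` J"
      using J_I[of 0] idl.subspace_0[OF subspace_corner[of e]] by force
  qed
  moreover have "index (corner e) J = index ((*) b ` corner e) ((*) b ` J) *
      index {x\<in>corner e. b * x = 0} {x\<in>J. b * x = 0}"
    by (intro index_image_kernel subspace_subgrp subspace_corner subspace_J J_subset additive_mult)
  ultimately show ?thesis
    using index_self[OF subspace_subgrp(1)[OF subspace_kernel(1)[OF subspace_corner]], of e b] by simp
qed

text \<open>
  The element \<open>v\<close> spans a copy of the residue field in \<open>X / Y\<close>, because the ring elements that map \<open>v\<close>
  into \<open>Y\<close> form a proper ideal containing \<open>a\<close> and \<open>b\<close>.
\<close>

lemma residue_le_index:
  assumes X: "vec.subspace X" and Y: "vec.subspace Y" and fin: "0 < index X Y"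
    and v: "v \<in> X" "v \<notin> Y" "smul e v = v" "smul a v \<in> Y" "smul b v \<in> Y"
  shows "index (corner e) J \<le> index X Y"
proof -
  let ?h = "\<lambda>r. (+) (smul r v) ` Y"
  have "index (corner e) J = card (?h ` corner e)"
  proof (rule index_eq_card_image)
    show "subgrp J" by (intro subspace_subgrp subspace_J)
    fix r r' assume r: "r \<in> corner e" "r' \<in> corner e"
    have d: "smul r v - smul r' v = smul (r - r') v" by (simp add: fun_eq_iff algebra_simps)
    have "smul (r - r') v \<in> Y \<longleftrightarrow> r - r' \<in> J"
    proof
      assume "r - r' \<in> J"
      then obtain s t where "r - r' = a * s + b * t" by (auto simp: J_def)
      then have "smul (r - r') v = smul s (smul a v) + smul t (smul b v)"
        by (simp add: fun_eq_iff algebra_simps)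
      then show "smul (r - r') v \<in> Y"
        using vec.subspace_add[OF Y] vec.subspace_scale[OF Y] v by metis
    next
      assume y: "smul (r - r') v \<in> Y"
      have "\<not> (\<exists>s. (r - r') * s = e)"
      proof
        assume "\<exists>s. (r - r') * s = e"
        then obtain s where "(r - r') * s = e" ..
        then have "smul s (smul (r - r') v) = v" using v(3) by (simp add: mult.commute)
        then show False using vec.subspace_scale[OF Y y, of s] v(2) by simp
      qed
      then obtain s t where "s \<in> corner e" "t \<in> corner e" "r - r' = a * s + b * t"
        using local[OF idl.subspace_diff[OF subspace_corner r]] by blast
      then show "r - r' \<in> J" using J_I by metis
    qed
    then show "?h r = ?h r' \<longleftrightarrow> r - r' \<in> J"
      by (simp only: coset_eq_iff[OF subspace_subgrp(2)[OF Y]] d)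
  qed
  also have "\<dots> \<le> index X Y"
    unfolding index_def using fin vec.subspace_scale[OF X v(1)]
    by (intro card_mono) (auto simp: index_pos_iff cosets_def)
  finally show ?thesis .
qed

text \<open>
  The correction factors are \<open>x = [K \<inter> ker a : b K]\<close> and \<open>y = [F \<inter> ker a : b F]\<close>, where \<open>w\<close> and \<open>w'\<close>
  are the triangular bases on the two branches.
\<close>

theorem fitting_bound: "fitting_bound e"
  unfolding fitting_bound_def
proof (intro allI impI)
  fix n K
  assume K: "vec.subspace K" "K \<subseteq> free e n" and fin: "0 < index (free e n) K"
  let ?C = "corner e" and ?L = "free e n" and ?F = "Fit e n K"
  let ?X = "{v\<in>K. smul a v = 0}" and ?I = "{x\<in>?F. a * x = 0}"
  let ?q = "index ?C J"
  have FC: "?F \<subseteq> ?C" by (rule Fit_subset_corner[OF idem])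
  obtain w k where all_w: "\<forall>i<n. w i \<in> K"
    and all_span_w: "\<forall>v\<in>K. \<exists>s. (\<forall>i. s i \<in> corner e) \<and> smul a v = smul a (\<Sum>i<n. smul (s i) (w i))"
    and dw: "a * (e * det n w) = a ^ k * (a * e)"
    and aF: "(*) a ` ?F = (*) (a ^ k) ` (*) a ` ?C"
    and idx_a: "index (smul a ` ?L) (smul a ` K) = index ((*) a ` ?C) ((*) a ` ?F)"
    by (rule A.Fit_scaled[OF K fin]) (rule that)
  note w = all_w[rule_format] and span_w = all_span_w[rule_format]
  obtain w' k' where all_w': "\<forall>i<n. w' i \<in> K"
    and all_span_w': "\<forall>v\<in>K. \<exists>s. (\<forall>i. s i \<in> corner e) \<and> smul b v = smul b (\<Sum>i<n. smul (s i) (w' i))"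
    and dw': "b * (e * det n w') = b ^ k' * (b * e)"
    and bF: "(*) b ` ?F = (*) (b ^ k') ` (*) b ` ?C"
    and idx_b: "index (smul b ` ?L) (smul b ` K) = index ((*) b ` ?C) ((*) b ` ?F)"
    by (rule B.Fit_scaled[OF K fin]) (rule that)
  note w' = all_w'[rule_format] and span_w' = all_span_w'[rule_format]
  define x where "x = index ?X (smul b ` K)"
  define y where "y = index ?I ((*) b ` ?F)"
  have main: "index ?L K * x = index ?C ?F * y"
    unfolding x_def y_def
    using vec.index_scale_kernel[OF subspace_free K ker_a_free]
      idl.index_scale_kernel[OF subspace_corner subspace_Fit FC ker_a_eq] idx_a idx_b by simp
  have Xsub: "vec.subspace ?X" and Isub: "idl.subspace ?I"
    by (intro subspace_kernel K subspace_Fit)+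
  have bK: "smul b ` K \<subseteq> ?X"
    using vec.subspace_scale[OF K(1)] ker_a_free[of n] K(2) by blast
  have bF_I: "(*) b ` ?F \<subseteq> ?I"
    using Fit_scale ker_a_eq FC by blast
  have pos: "0 < index (smul c ` ?L) (smul c ` K)" for c
  proof -
    have eq: "index ?L K = index (smul c ` ?L) (smul c ` K) * index {v\<in>?L. smul c v = 0} {v\<in>K. smul c v = 0}"
      by (intro index_image_kernel subspace_subgrp subspace_free K additive_mult)
    show ?thesis using fin unfolding eq nat_0_less_mult_iff by (rule conjunct1)
  qed
  note pos_a = pos[of a] and pos_b = pos[of b]
  have X_bL: "?X \<subseteq> smul b ` ?L" using ker_a_free[of n] K(2) by blast
  have "0 < index (smul b ` ?L) ?X \<and> 0 < x"
    using pos_b index_tower[of "smul b ` ?L" ?X "smul b ` K"] bK X_bL unfolding x_def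
    by (simp add: subspace_subgrp subspace_smul_image subspace_free Xsub K)
  then have x_pos: "0 < x" ..
  have "0 < index ?C ?F * y"
    using idl.index_scale_kernel[OF subspace_corner subspace_Fit FC ker_a_eq] idx_a idx_b pos_a pos_b
    unfolding y_def by simp
  then have F_pos: "0 < index ?C ?F" and y_pos: "0 < y" by auto
  \<comment> \<open>\<open>b F\<close> contains \<open>b (F \<inter> ker a)\<close>, and \<open>F \<inter> ker a\<close> is commensurable with \<open>b R\<close>\<close>
  have yq: "y \<le> ?q"
  proof -
    have I_bC: "?I \<subseteq> (*) b ` ?C" using ker_a_eq FC by blast
    have pI: "0 < index ((*) b ` ?C) ?I"
    proof -
      have "index ((*) b ` ?C) ((*) b ` ?F) = index ((*) b ` ?C) ?I * y"
        unfolding y_def using bF_I I_bC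
        by (intro index_tower subspace_subgrp subspace_mult_image subspace_corner Isub subspace_Fit)
      then show ?thesis using idx_b pos_b by simp
    qed
    have "index ?I ((*) b ` ?I) = index ((*) b ` ?C) ((*) b ` (*) b ` ?C)"
    proof (rule index_commensurable)
      show "x = 0" if "x \<in> (*) b ` ?C" "b * x = 0" for x using that reduced_b by blast
      show "(*) b ` (*) b ` ?C \<subseteq> (*) b ` ?C" using corner_mult(1) by blast
      show "(*) b ` ?I \<subseteq> ?I" using bF_I by blast
    qed (use pI I_bC in \<open>simp_all add: subspace_subgrp subspace_mult_image subspace_corner Isub additive_mult\<close>)
    then have "index ?I ((*) b ` ?I) = ?q" using index_b_square by simp
    moreover have "index ?I ((*) b ` ?I) = y * index ((*) b ` ?F) ((*) b ` ?I)"
      unfolding y_def using bF_I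
      by (intro index_tower subspace_subgrp subspace_mult_image Isub subspace_Fit) auto
    ultimately have "?q = y * index ((*) b ` ?F) ((*) b ` ?I)" by simp
    then show ?thesis using finite_residue unfolding J_def[symmetric] by (cases "index ((*) b ` ?F) ((*) b ` ?I)") auto
  qed
  have xq: "?q \<le> x" if ne: "?X \<noteq> smul b ` K"
  proof -
    obtain v where v: "v \<in> ?X" "v \<notin> smul b ` K" using ne bK by blast
    then have "smul e v = v" using K(2) free_unit[of v e n] by blast
    moreover have "smul a v \<in> smul b ` K"
      using v(1) vec.subspace_0[OF subspace_smul_image[OF K(1)]] by force
    moreover have "smul b v \<in> smul b ` K" using v(1) by blast
    ultimately show ?thesis unfolding x_def
      using residue_le_index[OF Xsub subspace_smul_image[OF K(1)] _ v] x_pos x_def by simp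
  qed
  have inj_a: "a * r = 0" if "r \<in> ?C" "d * (a * r) = 0" "(*) a ` ?F = (*) d ` (*) a ` ?C" for d r
    using A.generator_regular[of k d r] that aF e_corner by blast
  have inj_b: "b * r = 0" if "r \<in> ?C" "d * (b * r) = 0" "(*) b ` ?F = (*) d ` (*) b ` ?C" for d r
    using B.generator_regular[of k' d r] that bF e_corner by blast
  have y1: "?I = (*) b ` ?F" if eq: "?X = smul b ` K"
  proof
    let ?d = "e * det n w"
    have adF: "(*) a ` ?F = (*) ?d ` (*) a ` ?C"
    proof -
      have "a ^ k * (a * r) = ?d * (a * r)" if "r \<in> ?C" for r
      proof -
        have "?d * (a * r) = (a * ?d) * r" by (simp only: mult_ac)
        also have "\<dots> = a ^ k * (a * (e * r))" unfolding dw by (simp only: mult_ac)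
        finally show ?thesis unfolding corner_unit(1)[OF that] by simp
      qed
      then show ?thesis unfolding aF by (simp add: image_image cong: image_cong)
    qed
    have dF: "?d \<in> ?F" using w by (intro Fit_det)
    \<comment> \<open>modulo \<open>b K = K \<inter> ker a\<close> the vectors \<open>w\<close> span \<open>K\<close>, so modulo \<open>b F\<close> their determinant spans \<open>F\<close>\<close>
    have gen: "\<exists>r\<in>?C. \<exists>g\<in>?F. f = ?d * r + b * g" if "f \<in> ?F" for f
      using that unfolding Fit_def[of e n K]
    proof (induction rule: idl.span_induct_alt)
      case base
      show ?case using corner_zero idl.subspace_0[OF subspace_Fit, of e n K]
        unfolding Fit_def by force
    next
      case (step c z f)
      then obtain V where V: "\<And>i. i < n \<Longrightarrow> V i \<in> K" "z = e * det n V" by blast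
      obtain r g where rg: "r \<in> ?C" "g \<in> ?F" "f = ?d * r + b * g" using step unfolding Fit_def by blast
      have "\<exists>s u. i < n \<longrightarrow> u \<in> K \<and> V i = (\<Sum>j<n. smul (s j) (w j)) + smul b u" for i
      proof (cases "i < n")
        case True
        obtain s where s: "smul a (V i) = smul a (\<Sum>j<n. smul (s j) (w j))" using span_w V(1)[OF True] by blast
        let ?t = "\<Sum>j<n. smul (s j) (w j)"
        have "?t \<in> K" using w by (intro vec.subspace_sum[OF K(1)] vec.subspace_scale[OF K(1)]) auto
        then have "V i - ?t \<in> ?X" using s V(1)[OF True] vec.subspace_diff[OF K(1)]
          by (simp add: fun_eq_iff algebra_simps)
        then obtain u where "u \<in> K" "V i - ?t = smul b u" unfolding eq by blast
        then have "V i = ?t + smul b u" by (simp add: algebra_simps)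
        then show ?thesis using \<open>u \<in> K\<close> by blast
      qed blast
      then obtain s u where su: "\<And>i. i < n \<Longrightarrow> u i \<in> K \<and> V i = (\<Sum>j<n. smul (s i j) (w j)) + smul b (u i)"
        by metis
      let ?t = "\<lambda>i. \<Sum>j<n. smul (s i j) (w j)"
      have "e * det n (\<lambda>i. ?t i + smul b (u i)) - e * det n ?t \<in> (*) b ` ?F"
        using w su by (intro det_perturb K vec.subspace_sum[OF K(1)] vec.subspace_scale[OF K(1)]) auto
      moreover have "det n (\<lambda>i. ?t i + smul b (u i)) = det n V" using su by (intro det_cong) auto
      ultimately obtain g' where g': "g' \<in> ?F" "z - e * det n ?t = b * g'" using V(2) by auto
      obtain c' where c': "det n ?t = c' * det n w" using det_combination by blast
      have "z = e * det n ?t + b * g'" using g'(2) by (simp add: algebra_simps)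
      also have "e * det n ?t = (e * e) * (c' * det n w)" unfolding c' idem ..
      also have "\<dots> = ?d * (e * c')" by (simp only: mult_ac)
      finally have "c * z + f = ?d * (c * (e * c') + r) + b * (c * g' + g)"
        using rg(3) by (simp add: algebra_simps)
      moreover have "c * (e * c') + r \<in> ?C"
        using cornerI[OF idem] corner_mult(1) rg(1) corner_add by blast
      moreover have "c * g' + g \<in> ?F"
        using g' rg Fit_add Fit_scale by blast
      ultimately show ?case unfolding Fit_def by blast
    qed
    show "?I \<subseteq> (*) b ` ?F"
    proof clarify
      fix f assume f: "f \<in> ?F" "a * f = 0"
      obtain r g where rg: "r \<in> ?C" "g \<in> ?F" "f = ?d * r + b * g" using gen[OF f(1)] by blast
      have "a * (b * g) = 0" using ab(1) rg(2) FC by blast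
      then have "?d * (a * r) = 0" using f(2) rg(3) by (simp add: distrib_left mult_ac)
      then have "a * r = 0" using inj_a[OF rg(1) _ adF] by blast
      then obtain s where "r = b * s" "s \<in> ?C" using ker_a[OF rg(1)] by blast
      then have "f = b * (s * ?d + g)" using rg(3) by (simp add: algebra_simps)
      moreover have "s * ?d + g \<in> ?F"
        using dF rg Fit_add Fit_scale by blast
      ultimately show "f \<in> (*) b ` ?F" by blast
    qed
  qed (rule bF_I)
  have le: "index ?L K \<le> index ?C ?F"
  proof (cases "?X = smul b ` K")
    case True
    have "x = 1" "y = 1" unfolding x_def y_def y1[OF True] True
      using index_self subspace_subgrp subspace_smul_image[OF K(1)] subspace_mult_image[OF subspace_Fit]
      by blast+
    then show ?thesis using main by simp
  next
    case False
    then have "y \<le> x" using yq xq by simp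
    then have "index ?L K * x \<le> index ?C ?F * x" using main by simp
    then show ?thesis using x_pos by simp
  qed
  have equal: "index ?L K = index ?C ?F" if principal: "?F = (*) g ` ?C" for g
  proof -
    have img: "(*) c ` ?F = (*) h ` (*) c ` ?C" if "?F = (*) h ` ?C" for c h
      unfolding that by (simp add: image_image mult.left_commute)
    have "?I \<subseteq> (*) b ` ?F"
    proof clarify
      fix f assume f: "f \<in> ?F" "a * f = 0"
      then obtain r where r: "r \<in> ?C" "f = g * r" using principal by blast
      then have "a * r = 0" using f(2) inj_a[OF r(1) _ img[OF principal], of] by (simp add: mult.left_commute)
      then obtain s where "r = b * s" "s \<in> ?C" using ker_a[OF r(1)] by blast
      then show "f \<in> (*) b ` ?F" using r principal by (auto simp: mult.left_commute)
    qed
    then have "?I = (*) b ` ?F" using bF_I by blast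
    then have y: "y = 1" unfolding y_def
      using index_self subspace_subgrp subspace_mult_image[OF subspace_Fit] by metis
    let ?d = "e * det n w'"
    have dF: "?d \<in> ?F" using w' by (intro Fit_det)
    then obtain r where r: "r \<in> ?C" "?d = g * r" using principal by blast
    have bdF: "(*) b ` ?F = (*) ?d ` (*) b ` ?C"
    proof -
      have "b ^ k' * (b * r) = ?d * (b * r)" if "r \<in> ?C" for r
      proof -
        have "?d * (b * r) = (b * ?d) * r" by (simp only: mult_ac)
        also have "\<dots> = b ^ k' * (b * (e * r))" unfolding dw' by (simp only: mult_ac)
        finally show ?thesis unfolding corner_unit(1)[OF that] by simp
      qed
      then show ?thesis unfolding bF by (simp add: image_image cong: image_cong)
    qed
    \<comment> \<open>\<open>g\<close> and \<open>?d\<close> generate the same ideal on the branch \<open>b R\<close>, so their quotient \<open>r\<close> is a unit there\<close>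
    have "\<exists>t. r * t = e"
    proof -
      have "b * (g * e) \<in> (*) ?d ` (*) b ` ?C" using bdF principal e_corner by blast
      then obtain s where s: "s \<in> ?C" "b * (g * e) = ?d * (b * s)" by blast
      have es: "e - r * s \<in> ?C" using idl.subspace_diff[OF subspace_corner e_corner] corner_mult(1) s by blast
      have "g * (b * (e - r * s)) = 0" using s(2) r(2) by (simp add: algebra_simps)
      then have "b * (e - r * s) = 0" using inj_b[OF es _ img[OF principal]] by blast
      then obtain t where t: "t \<in> ?C" "e - r * s = a * t" using ker_b[OF es] by blast
      show ?thesis
      proof (rule ccontr)
        assume no: "\<not> ?thesis"
        then obtain s' t' where st: "s' \<in> ?C" "t' \<in> ?C" "r = a * s' + b * t'" using local[OF r(1)] by blast
        \<comment> \<open>then \<open>e\<close> lies in the maximal ideal, so all powers of \<open>a\<close> divide \<open>a e\<close>, and likewise for \<open>b\<close>\<close>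
        have e: "e = a * (t + s * s') + b * (s * t')" using t(2) st(3) by (simp add: algebra_simps)
        let ?\<sigma> = "t + s * s'" and ?\<tau> = "s * t'"
        have \<sigma>: "?\<sigma> \<in> ?C" "?\<tau> \<in> ?C"
          using t st corner_mult(1) corner_add by blast+
        have "a * e = a * (a * ?\<sigma>)"
          using arg_cong[OF e, of "(*) a"] ab(1)[OF \<sigma>(2)] by (simp add: distrib_left)
        then have ae: "a * e = 0" by (rule A.unit_divisible_imp_zero[OF \<sigma>(1)])
        have "b * e = b * (b * ?\<tau>)"
          using arg_cong[OF e, of "(*) b"] ab(2)[OF \<sigma>(1)] by (simp add: distrib_left)
        then have be: "b * e = 0" by (rule B.unit_divisible_imp_zero[OF \<sigma>(2)])
        have "e = 0" using ker_ab[OF e_corner ae be] .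
        then show False using no by (metis mult_zero_right)
      qed
    qed
    then obtain t where t: "r * t = e" ..
    have Fd: "?F = (*) ?d ` ?C"
    proof
      show "(*) ?d ` ?C \<subseteq> ?F" using idl.subspace_scale[OF subspace_Fit dF] by (auto simp: mult.commute)
      show "?F \<subseteq> (*) ?d ` ?C"
      proof
        fix f assume "f \<in> ?F"
        then obtain u where u: "u \<in> ?C" "f = g * u" using principal by blast
        have "?d * (t * u) = g * ((r * t) * u)" unfolding r(2) by (simp only: mult_ac)
        then have "f = ?d * (t * u)" unfolding t corner_unit(1)[OF u(1)] using u(2) by simp
        then show "f \<in> (*) ?d ` ?C" using corner_mult(1)[OF u(1)] by blast
      qed
    qed
    \<comment> \<open>Cramer's rule: replacing the \<open>j\<close>-th vector by \<open>v\<close> gives a determinant \<open>?d * u\<close>, so \<open>u\<close> agrees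
       with the \<open>j\<close>-th coefficient of \<open>v\<close> on the branch of \<open>b\<close> and with \<open>0\<close> on the branch of \<open>a\<close>\<close>
    have "?X \<subseteq> smul b ` K"
    proof clarify
      fix v assume v: "v \<in> K" "smul a v = 0"
      obtain s where s: "\<And>i. s i \<in> ?C" "smul b v = smul b (\<Sum>i<n. smul (s i) (w' i))"
        using span_w'[OF v(1)] by blast
      have "\<exists>u. u \<in> ?C \<and> (j < n \<longrightarrow> b * s j = b * u \<and> (\<exists>t\<in>?C. u = b * t))" for j
      proof (cases "j < n")
        case j: True
        have "e * det n (w'(j := v)) \<in> ?F" using w' v by (intro Fit_det) auto
        then obtain u where u: "u \<in> ?C" "e * det n (w'(j := v)) = ?d * u" using Fd by blast
        have "b * det n (w'(j := v)) = b * det n (w'(j := (\<Sum>i<n. smul (s i) (w' i))))"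
          using s(2) by (intro smul_det_cong) simp
        also have "det n (w'(j := (\<Sum>i<n. smul (s i) (w' i)))) = (\<Sum>i<n. s i * det n (w'(j := w' i)))"
          by (rule det_row_sum[OF j])
        also have "\<dots> = (\<Sum>i<n. if i = j then s j * det n w' else 0)"
        proof (rule sum.cong[OF refl])
          fix i assume "i \<in> {..<n}"
          then have "i \<noteq> j \<Longrightarrow> det n (w'(j := w' i)) = 0" using j by (intro det_eq_rows[of i n j]) auto
          then show "s i * det n (w'(j := w' i)) = (if i = j then s j * det n w' else 0)" by auto
        qed
        also have "\<dots> = s j * det n w'" using j by simp
        finally have "e * (b * det n (w'(j := v))) = e * (b * (s j * det n w'))"
          by (rule arg_cong)
        then have "b * (e * det n (w'(j := v))) = b * (?d * s j)" by (simp only: mult_ac)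
        then have "b * (?d * u) = b * (?d * s j)" unfolding u(2) .
        then have "?d * (b * (u - s j)) = 0" by (simp add: algebra_simps)
        then have "b * (u - s j) = 0"
          using inj_b[OF idl.subspace_diff[OF subspace_corner u(1) s(1)] _ img[OF Fd]] by blast
        then have bu: "b * s j = b * u" by (simp add: algebra_simps)
        have "a * det n (w'(j := v)) = a * det n (w'(j := smul 0 v))"
          using v(2) by (intro smul_det_cong) (simp add: fun_eq_iff)
        then have "a * det n (w'(j := v)) = 0" using det_row_smul[OF j, of w' 0 v] by simp
        then have "e * (a * det n (w'(j := v))) = 0" by (simp del: fun_upd_apply)
        then have "a * (e * det n (w'(j := v))) = 0" by (simp only: mult_ac)
        then have "?d * (a * u) = 0" unfolding u(2) by (simp only: mult_ac)
        then have "a * u = 0" using inj_a[OF u(1) _ img[OF Fd]] by blast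
        then show ?thesis using bu u(1) ker_a[OF u(1)] by blast
      next
        case False
        then show ?thesis using e_corner by blast
      qed
      then obtain u where u: "\<And>j. u j \<in> ?C" "\<And>j. j < n \<Longrightarrow> b * s j = b * u j \<and> (\<exists>t\<in>?C. u j = b * t)"
        by metis
      then have "\<forall>j. \<exists>t. j < n \<longrightarrow> t \<in> ?C \<and> u j = b * t" by blast
      then obtain t where t: "\<And>j. j < n \<Longrightarrow> t j \<in> ?C \<and> u j = b * t j" by metis
      let ?z = "\<Sum>i<n. smul (t i) (w' i)"
      have zK: "?z \<in> K" using w' by (intro vec.subspace_sum[OF K(1)] vec.subspace_scale[OF K(1)]) auto
      have bz: "smul b ?z = (\<Sum>i<n. smul (u i) (w' i))"
        using t by (auto simp: fun_eq_iff sum_distrib_left mult.assoc intro!: sum.cong)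
      have "v i = smul b ?z i" for i
      proof (cases "i < n")
        case True
        have d: "v i - b * ?z i \<in> ?C"
        proof -
          have "v - smul b ?z \<in> free e n"
            using v(1) zK K(2) subspace_free by (meson vec.subspace_diff vec.subspace_scale subsetD)
          then show ?thesis using True by (simp add: free_def)
        qed
        have "a * (b * ?z i) = 0" using zK K(2) True ab(1) by (auto simp: free_def)
        then have 1: "a * (v i - b * ?z i) = 0" using fun_cong[OF v(2), of i] by (simp add: algebra_simps)
        have "b * v i = b * (\<Sum>j<n. smul (s j) (w' j)) i" using fun_cong[OF s(2), of i] by simp
        also have "\<dots> = b * (\<Sum>j<n. smul (u j) (w' j)) i"
          using u(2) by (auto simp: sum_distrib_left mult.assoc[symmetric] intro!: sum.cong)
        also have "(\<Sum>j<n. smul (u j) (w' j)) i = b * ?z i" using fun_cong[OF bz, of i] by simp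
        finally have 2: "b * (v i - b * ?z i) = 0" by (simp add: algebra_simps)
        show ?thesis using ker_ab[OF d 1 2] by simp
      next
        case False
        then have "v i = 0" "?z i = 0"
          using subsetD[OF K(2) v(1)] subsetD[OF K(2) zK] unfolding free_def by (blast intro: leI)+
        then show ?thesis unfolding smul_apply by simp
      qed
      then have "v = smul b ?z" by (rule ext)
      then show "v \<in> smul b ` K" using zK by blast
    qed
    then have "?X = smul b ` K" using bK by blast
    then have "x = 1" unfolding x_def using index_self subspace_subgrp(2) Xsub by metis
    then show ?thesis using main y by simp
  qed
  show "index ?L K \<le> index ?C ?F \<and>
      ((\<exists>g. ?F = (*) g ` ?C) \<longrightarrow> index ?L K = index ?C ?F)"
    using le equal by blast
qed

end

section \<open>Decomposition along idempotents\<close>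

text \<open>
  If \<open>c\<close> is regular, multiplication by \<open>c\<close> changes no index, and the comparison of \<open>c K\<close> with \<open>c F\<close> is
  the claim.
\<close>

lemma (in uniformizer) fitting_bound_torsion_free:
  assumes inj: "\<And>r. r \<in> corner e \<Longrightarrow> c * r = 0 \<Longrightarrow> r = 0"
  shows "fitting_bound e"
  unfolding fitting_bound_def
proof (intro allI impI)
  fix n K
  assume K: "vec.subspace K" "K \<subseteq> free e n" and fin: "0 < index (free e n) K"
  have FC: "Fit e n K \<subseteq> corner e" by (rule Fit_subset_corner[OF idem])
  have idx: "index (smul c ` free e n) (smul c ` K) = index D ((*) c ` Fit e n K)"
    by (rule Fit_scaled[OF K fin])
  have "index (smul c ` free e n) (smul c ` K) = index (free e n) K"
  proof (rule index_inj_image)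
    fix v assume v: "v \<in> free e n" "smul c v = 0"
    have "v i = 0" for i
    proof (cases "i < n")
      case True
      then have "v i \<in> corner e" using v(1) by (simp add: free_def)
      moreover have "c * v i = 0" using fun_cong[OF v(2), of i] by simp
      ultimately show ?thesis by (rule inj)
    qed (use v(1) in \<open>simp add: free_def\<close>)
    then show "v = 0" by (simp add: fun_eq_iff)
  qed (intro subspace_subgrp subspace_free K additive_mult)+
  moreover have "index D ((*) c ` Fit e n K) = index (corner e) (Fit e n K)"
    using inj FC by (intro index_inj_image subspace_subgrp subspace_corner subspace_Fit additive_mult) auto
  ultimately have eq: "index (free e n) K = index (corner e) (Fit e n K)" using idx by metis
  show "index (free e n) K \<le> index (corner e) (Fit e n K) \<and>
      ((\<exists>g. Fit e n K = (*) g ` corner e) \<longrightarrow> index (free e n) K = index (corner e) (Fit e n K))"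
    unfolding eq by blast
qed

text \<open>
  The factor \<open>f\<close> of a determinant may be distributed to its rows because \<open>f\<close> is idempotent.
\<close>

lemma Fit_component:
  assumes f: "f * f = f" "f * e = f"
  shows "(*) f ` Fit e n K = Fit f n (smul f ` K)"
proof
  have d: "f * det n (\<lambda>i. smul f (V i)) = f * (e * det n V)" for V
  proof -
    have "f * det n (\<lambda>i. smul f (V i)) = f * det n V" by (rule smul_det_cong) (simp add: f)
    then show ?thesis by (simp add: mult.assoc[symmetric] f)
  qed
  have "Fit e n K \<subseteq> {x. f * x \<in> Fit f n (smul f ` K)}"
    unfolding Fit_def[of e]
  proof (rule idl.span_minimal)
    show "idl.subspace {x. f * x \<in> Fit f n (smul f ` K)}"
      using Fit_zero Fit_add Fit_scale
      by (intro idl.subspaceI) (auto simp only: mem_Collect_eq distrib_left mult.left_commute[of f] mult_zero_right)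
    show "{e * det n V | V. \<forall>i<n. V i \<in> K} \<subseteq> {x. f * x \<in> Fit f n (smul f ` K)}"
    proof clarify
      fix V assume "\<forall>i<n. V i \<in> K"
      then show "f * (e * det n V) \<in> Fit f n (smul f ` K)"
        unfolding d[symmetric] by (intro Fit_det) blast
    qed
  qed
  then show "(*) f ` Fit e n K \<subseteq> Fit f n (smul f ` K)" by blast
  show "Fit f n (smul f ` K) \<subseteq> (*) f ` Fit e n K"
    unfolding Fit_def[of f]
  proof (rule idl.span_minimal)
    show "{f * det n V | V. \<forall>i<n. V i \<in> smul f ` K} \<subseteq> (*) f ` Fit e n K"
    proof clarify
      fix W assume "\<forall>i<n. W i \<in> smul f ` K"
      then have "\<forall>i. \<exists>v. i < n \<longrightarrow> v \<in> K \<and> W i = smul f v" by blast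
      then obtain V where V: "\<And>i. i < n \<Longrightarrow> V i \<in> K \<and> W i = smul f (V i)" by metis
      then have "det n W = det n (\<lambda>i. smul f (V i))" by (intro det_cong) auto
      then have "f * det n W = f * (e * det n V)" using d by simp
      moreover have "e * det n V \<in> Fit e n K" using V by (intro Fit_det) blast
      ultimately show "f * det n W \<in> (*) f ` Fit e n K" by blast
    qed
  qed (intro subspace_mult_image subspace_Fit)
qed

lemma corner_mono: "f * e = f \<Longrightarrow> corner f \<subseteq> corner e"
proof
  fix r assume "f * e = f" "r \<in> corner f"
  then show "r \<in> corner e" by (metis corner_def corner_unit(1) mem_Collect_eq mult.assoc mult.commute)
qed

lemma component_corner: "(*) f ` corner e = corner f" if f: "f * f = f" "f * e = f"
proof
  show "(*) f ` corner e \<subseteq> corner f" using cornerI[OF f(1)] by auto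
  show "corner f \<subseteq> (*) f ` corner e" using corner_mono[OF f(2)] corner_unit(1) by force
qed

lemma component_free: "smul f ` free e n = free f n" if f: "f * f = f" "f * e = f"
proof
  show "smul f ` free e n \<subseteq> free f n" using cornerI[OF f(1)] by (auto simp: free_def)
  show "free f n \<subseteq> smul f ` free e n"
  proof
    fix v assume v: "v \<in> free f n"
    then have "v \<in> free e n" using corner_mono[OF f(2)] by (auto simp: free_def)
    then show "v \<in> smul f ` free e n" using free_unit[OF v] by (metis image_eqI)
  qed
qed

lemma image_mult_commute: "(*) f ` (*) h ` S = (*) h ` (*) f ` (S :: 'a::comm_ring_1 set)"
  by (simp add: image_image mult.left_commute)

text \<open>
  The indices of \<open>K\<close> and of its Fitting ideal are the products of those of the components, and the
  components of a principal ideal are principal.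
\<close>

lemma fitting_bound_add:
  fixes f g :: "'a::comm_ring_1"
  assumes f: "f * f = f" and g: "g * g = g" and fg: "f * g = 0"
    and bound: "fitting_bound f" "fitting_bound g"
  shows "fitting_bound (f + g)"
  unfolding fitting_bound_def
proof (intro allI impI)
  let ?e = "f + g"
  fix n K
  assume K: "vec.subspace K" "K \<subseteq> free ?e n" and fin: "0 < index (free ?e n) K"
  have e: "?e * ?e = ?e" and fe: "f * ?e = f" and ge: "g * ?e = g"
    using f g fg by (simp_all add: distrib_left distrib_right mult.commute)
  let ?F = "Fit ?e n K"
  let ?k = "\<lambda>h. index (free h n) (smul h ` K)" and ?c = "\<lambda>h. index (corner h) ((*) h ` ?F)"
  have idxK: "index (free ?e n) K = ?k f * ?k g"
    using vec.index_component[OF fg subspace_free K(1) K(2) free_unit]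
    unfolding component_free[OF f fe] component_free[OF g ge] .
  have idxF: "index (corner ?e) ?F = ?c f * ?c g"
    using idl.index_component[OF fg subspace_corner subspace_Fit Fit_subset_corner[OF e] corner_unit(1)]
    unfolding component_corner[OF f fe] component_corner[OF g ge] .
  have part: "?k h \<le> ?c h \<and> (\<forall>d. ?F = (*) d ` corner ?e \<longrightarrow> ?k h = ?c h)"
    if h: "h * h = h" "h * ?e = h" "fitting_bound h" "0 < ?k h" for h
  proof -
    have "smul h ` K \<subseteq> free h n" using image_mono[OF K(2), of "smul h"] unfolding component_free[OF h(1,2)] .
    with h(3) have "?k h \<le> ?c h \<and> ((\<exists>d. (*) h ` ?F = (*) d ` corner h) \<longrightarrow> ?k h = ?c h)"
      unfolding fitting_bound_def Fit_component[OF h(1,2)] using subspace_smul_image[OF K(1)] h(4) by blast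
    moreover have "(*) h ` ?F = (*) d ` corner h" if "?F = (*) d ` corner ?e" for d
      unfolding that image_mult_commute[of h] component_corner[OF h(1,2)] ..
    ultimately show ?thesis by blast
  qed
  have "0 < ?k f" "0 < ?k g" using fin unfolding idxK nat_0_less_mult_iff by (rule conjunct1, rule conjunct2)
  note pf = part[OF f fe bound(1) this(1)] and pg = part[OF g ge bound(2) this(2)]
  show "index (free ?e n) K \<le> index (corner ?e) ?F \<and>
      ((\<exists>d. ?F = (*) d ` corner ?e) \<longrightarrow> index (free ?e n) K = index (corner ?e) ?F)"
    unfolding idxK idxF
  proof (intro conjI impI)
    show "?k f * ?k g \<le> ?c f * ?c g" by (intro mult_le_mono pf[THEN conjunct1] pg[THEN conjunct1])
    assume "\<exists>d. ?F = (*) d ` corner ?e"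
    then obtain d where d: "?F = (*) d ` corner ?e" ..
    show "?k f * ?k g = ?c f * ?c g"
      unfolding pf[THEN conjunct2, rule_format, OF d] pg[THEN conjunct2, rule_format, OF d] ..
  qed
qed

text \<open>
  Splitting off an idempotent splits the index of \<open>p R\<close> in \<open>R\<close> as a product, and by separatedness neither
  factor is \<open>1\<close>; so the splitting ends at primitive idempotents after finitely many steps.
\<close>

lemma fitting_bound_from_primitive:
  fixes e p :: "'a::comm_ring_1"
  assumes e: "e * e = e"
    and fin: "0 < index (corner e) ((*) p ` corner e)"
    and sep: "\<And>r. r \<in> corner e \<Longrightarrow> (\<And>i. \<exists>s. r = p ^ i * s) \<Longrightarrow> r = 0"
    and prim: "\<And>f. f * f = f \<Longrightarrow> f * e = f \<Longrightarrow> 0 < index (corner f) ((*) p ` corner f) \<Longrightarrow>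
      (\<And>g. g * g = g \<Longrightarrow> g * f = g \<Longrightarrow> g = 0 \<or> g = f) \<Longrightarrow> fitting_bound f"
  shows "fitting_bound e"
proof -
  have gt1: "1 < index (corner g) ((*) p ` corner g)"
    if g: "g * g = g" "g * e = g" "g \<noteq> 0" "0 < index (corner g) ((*) p ` corner g)" for g
  proof (rule ccontr)
    assume "\<not> 1 < index (corner g) ((*) p ` corner g)"
    then have "index (corner g) ((*) p ` corner g) = 1" using g(4) by simp
    moreover have "(*) p ` corner g \<subseteq> corner g" using corner_mult(1) by blast
    ultimately have eq: "corner g = (*) p ` corner g"
      by (intro index_eq_1 subspace_subgrp subspace_corner subspace_mult_image)
    have "\<exists>s\<in>corner g. g = p ^ i * s" for i
    proof (induction i)
      case 0
      then show ?case using g(1) by (intro bexI[of _ g]) (simp_all add: corner_def)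
    next
      case (Suc i)
      then obtain s where s: "s \<in> corner g" "g = p ^ i * s" by blast
      then obtain t where "t \<in> corner g" "s = p * t" using eq by blast
      then show ?case using s(2) by (intro bexI[of _ t]) (simp_all add: mult_ac)
    qed
    then have "g = 0" using g(2) by (intro sep) (auto simp: corner_def mult.commute)
    then show False using g(3) by simp
  qed
  have "fitting_bound f" if "f * f = f" "f * e = f" "0 < index (corner f) ((*) p ` corner f)" for f
    using that
  proof (induction "index (corner f) ((*) p ` corner f)" arbitrary: f rule: less_induct)
    case less
    show ?case
    proof (cases "\<exists>g. g * g = g \<and> g * f = g \<and> g \<noteq> 0 \<and> g \<noteq> f")
      case False
      then show ?thesis using prim less.prems by blast
    next
      case True
      then obtain g where g: "g * g = g" "g * f = g" "g \<noteq> 0" "g \<noteq> f" by blast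
      define h where "h = f - g"
      have h: "h * h = h" "g * h = 0" "h \<noteq> 0"
        using g less.prems(1) by (simp_all add: h_def algebra_simps)
      have f: "f = g + h" by (simp add: h_def)
      have ge: "g * e = g" using g(2) less.prems(2) by (metis mult.assoc)
      have he: "h * e = h" using ge less.prems(2) by (simp add: h_def algebra_simps)
      have hf: "h * f = h" using g(1,2) less.prems(1) by (simp add: h_def algebra_simps)
      have p_sub: "(*) p ` corner f \<subseteq> corner f" using corner_mult(1) by blast
      have idx: "index (corner f) ((*) p ` corner f) =
          index (corner g) ((*) p ` corner g) * index (corner h) ((*) p ` corner h)"
        using idl.index_component[OF h(2) subspace_corner subspace_mult_image[OF subspace_corner] p_sub,
            folded f, OF corner_unit(1)]
        unfolding image_mult_commute[of _ p] component_corner[OF g(1,2)] component_corner[OF h(1) hf] .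
      have pos: "0 < index (corner g) ((*) p ` corner g)" "0 < index (corner h) ((*) p ` corner h)"
        using less.prems(3) unfolding idx nat_0_less_mult_iff by (rule conjunct1, rule conjunct2)
      have big: "1 < index (corner g) ((*) p ` corner g)" "1 < index (corner h) ((*) p ` corner h)"
        using gt1 g(1,3) ge h(1,3) he pos by blast+
      have "fitting_bound g" using big pos by (intro less.hyps g(1) ge) (simp_all add: idx)
      moreover have "fitting_bound h" using big pos by (intro less.hyps h(1) he) (simp_all add: idx)
      ultimately show ?thesis unfolding f by (intro fitting_bound_add g(1) h(1,2))
    qed
  qed
  then show ?thesis using e fin by blast
qed

text \<open>
  The idempotent \<open>r h\<close> provided by \<open>split\<close> is \<open>f\<close> or \<open>0\<close>. In the first case \<open>r\<close> is a unit of the corner of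
  \<open>f\<close>. In the second a power of \<open>r\<close> is a multiple of \<open>p\<close>, hence in \<open>N\<close>, and the congruence
  \<open>r\<^sup>q \<equiv> r\<close> modulo \<open>N\<close> brings this down to \<open>r\<close>.
\<close>

lemma primitive_local:
  fixes e f p :: "'a::comm_ring_1"
  assumes f: "f * f = f" "f * e = f"
    and prim: "\<And>g. g * g = g \<Longrightarrow> g * f = g \<Longrightarrow> g = 0 \<or> g = f"
    and split: "\<And>r. r \<in> corner e \<Longrightarrow> \<exists>h m s. (r * h) * (r * h) = r * h \<and> (e - r * h) * r ^ m = p * s"
    and N: "idl.subspace N" "\<And>s. s \<in> corner e \<Longrightarrow> p * s \<in> N"
    and frob: "\<And>r. r \<in> corner e \<Longrightarrow> r ^ q - r \<in> N" and q: "1 < q"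
    and r: "r \<in> corner f"
  shows "(\<exists>s. r * s = f) \<or> r \<in> N"
proof -
  have re: "r \<in> corner e" using r f(2) by (metis corner_def corner_unit(1) mem_Collect_eq mult.assoc mult.commute)
  obtain h m s where hms: "(r * h) * (r * h) = r * h" "(e - r * h) * r ^ m = p * s" using split[OF re] by blast
  have "r * h * f = (f * r) * h" by (simp only: mult_ac)
  then have "r * h * f = r * h" unfolding corner_unit(1)[OF r] .
  then consider "r * h = f" | "r * h = 0" using prim[OF hms(1)] by blast
  then show ?thesis
  proof cases
    case 2
    have "f * r ^ m = f * (e * r ^ m)" using f(2) by (simp add: mult.assoc[symmetric])
    also have "e * r ^ m = p * s" using hms(2) 2 by simp
    also have "f * (p * s) = p * (e * (f * s))" using f(2) by (metis mult.assoc mult.commute)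
    finally have m: "f * r ^ m = p * (e * (f * s))" .
    have "e * (f * s) \<in> corner e"
    proof -
      have "e * (f * s) = f * s" using f(2) by (metis mult.assoc mult.commute)
      then show ?thesis by (simp add: corner_def)
    qed
    then have mN: "f * r ^ m \<in> N" using N(2) m by metis
    have "r ^ (q ^ j) - r \<in> N" for j
    proof (induction j)
      case 0
      then show ?case using idl.subspace_0[OF N(1)] by simp
    next
      case (Suc j)
      have "r ^ (q ^ j) \<in> corner e"
        using re q by (cases "q ^ j") (auto simp: corner_mult)
      then have "(r ^ (q ^ j)) ^ q - r ^ (q ^ j) \<in> N" by (rule frob)
      from idl.subspace_add[OF N(1) this Suc]
      show ?case by (simp add: power_mult[symmetric] mult.commute)
    qed
    moreover have "r ^ (q ^ m) \<in> N"
    proof -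
      have "m < q ^ m" using q by (intro power_gt_expt) simp
      then have "r ^ (q ^ m) = r ^ m * r ^ (q ^ m - m)" by (simp add: power_add[symmetric])
      moreover have "r ^ (q ^ m) = f * r ^ (q ^ m)"
      proof -
        have "0 < q ^ m" using q by simp
        then obtain k where "q ^ m = Suc k" using gr0_implies_Suc by blast
        then show ?thesis using corner_unit(1)[OF r] by (simp add: mult.assoc[symmetric])
      qed
      ultimately have "r ^ (q ^ m) = r ^ (q ^ m - m) * (f * r ^ m)" by (simp add: mult_ac)
      then show ?thesis using idl.subspace_scale[OF N(1) mN] by simp
    qed
    ultimately have "r ^ (q ^ m) - (r ^ (q ^ m) - r) \<in> N" using idl.subspace_diff[OF N(1)] by blast
    then show ?thesis by simp
  qed blast
qed

text \<open>
  The factors are discrete valuation rings with uniformizer \<open>p\<close>.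
\<close>

theorem fitting_bound_unramified:
  fixes e p :: "'a::comm_ring_1"
  assumes e: "e * e = e"
    and fin: "0 < index (corner e) ((*) p ` corner e)"
    and sep: "\<And>r. r \<in> corner e \<Longrightarrow> (\<And>i. \<exists>s. r = p ^ i * s) \<Longrightarrow> r = 0"
    and tf: "\<And>r. r \<in> corner e \<Longrightarrow> p * r = 0 \<Longrightarrow> r = 0"
    and split: "\<And>r. r \<in> corner e \<Longrightarrow> \<exists>h m s. (r * h) * (r * h) = r * h \<and> (e - r * h) * r ^ m = p * s"
    and frob: "\<And>r. r \<in> corner e \<Longrightarrow> r ^ q - r \<in> (*) p ` corner e" and q: "1 < q"
  shows "fitting_bound e"
proof (rule fitting_bound_from_primitive[OF e fin sep])
  fix f assume f: "f * f = f" "f * e = f" and prim: "\<And>g. g * g = g \<Longrightarrow> g * f = g \<Longrightarrow> g = 0 \<or> g = f"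
  have sub: "r \<in> corner e" if "r \<in> corner f" for r using corner_mono[OF f(2)] that by blast
  interpret uniformizer f p
  proof
    show "f * f = f" by (rule f)
    show "p * r = 0" if "r \<in> corner f" "p * (p * r) = 0" for r
      using tf[of "p * r"] that sub corner_mult(1) by blast
    show "r = 0" if "r \<in> corner f" "\<And>i. \<exists>s. r = p ^ i * s" for r using sep that sub by blast
    show "(\<exists>s. r * s = f) \<or> (\<exists>s\<in>corner f. p * r = p * (p * s))" if r: "r \<in> corner f" for r
    proof -
      have "(\<exists>s. r * s = f) \<or> r \<in> (*) p ` corner e"
        by (rule primitive_local[OF f prim split _ _ frob q r])
          (auto intro: subspace_mult_image subspace_corner)
      moreover have "\<exists>s\<in>corner f. p * r = p * (p * s)" if rp: "r \<in> (*) p ` corner e"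
      proof -
        obtain s where "r = p * s" using rp by blast
        then have "r = p * (f * s)" using corner_unit(1)[OF r] by (metis mult.left_commute)
        then show ?thesis using cornerI[OF f(1), of s] by metis
      qed
      ultimately show ?thesis by blast
    qed
  qed
  show "fitting_bound f" using tf sub by (intro fitting_bound_torsion_free) blast
qed

text \<open>
  The factors are nodes. Powers of \<open>a\<close> and \<open>b\<close> are multiples of \<open>p\<close>, so both branches inherit
  separatedness.
\<close>

theorem fitting_bound_nodal:
  fixes e p a b :: "'a::comm_ring_1"
  assumes e: "e * e = e"
    and fin: "0 < index (corner e) ((*) p ` corner e)"
    and sep: "\<And>r. r \<in> corner e \<Longrightarrow> (\<And>i. \<exists>s. r = p ^ i * s) \<Longrightarrow> r = 0"
    and split: "\<And>r. r \<in> corner e \<Longrightarrow> \<exists>h m s. (r * h) * (r * h) = r * h \<and> (e - r * h) * r ^ m = p * s"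
    and frob: "\<And>r. r \<in> corner e \<Longrightarrow> \<exists>s t. r ^ q - r = a * s + b * t" and q: "1 < q"
    and p: "p * e = a * s0 + b * t0"
    and nil: "a ^ k * e = p * s1" "b ^ l * e = p * t1"
    and ker_a: "\<And>r. r \<in> corner e \<Longrightarrow> a * r = 0 \<longleftrightarrow> (\<exists>s. r = b * (e * s))"
    and ker_b: "\<And>r. r \<in> corner e \<Longrightarrow> b * r = 0 \<longleftrightarrow> (\<exists>s. r = a * (e * s))"
    and ker_ab: "\<And>r. r \<in> corner e \<Longrightarrow> a * r = 0 \<Longrightarrow> b * r = 0 \<Longrightarrow> r = 0"
  shows "fitting_bound e"
proof (rule fitting_bound_from_primitive[OF e fin sep])
  fix f assume f: "f * f = f" "f * e = f" and fin_f: "0 < index (corner f) ((*) p ` corner f)"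
    and prim: "\<And>g. g * g = g \<Longrightarrow> g * f = g \<Longrightarrow> g = 0 \<or> g = f"
  have sub: "r \<in> corner e" if "r \<in> corner f" for r using corner_mono[OF f(2)] that by blast
  define N where "N = {a * s + b * t | s t. True}"
  have N: "idl.subspace N" unfolding N_def span_pair[symmetric] by (rule idl.subspace_span)
  have pN: "p * s \<in> N" if "s \<in> corner e" for s
  proof -
    have "p * s = s * (p * e)" using corner_unit(2)[OF that] by (metis mult.left_commute)
    moreover have "p * e \<in> N" unfolding p N_def by blast
    ultimately show ?thesis using idl.subspace_scale[OF N] by metis
  qed
  have N_corner: "\<exists>s\<in>corner f. \<exists>t\<in>corner f. r = a * s + b * t" if r: "r \<in> corner f" "r \<in> N" for r
  proof -
    obtain s t where "r = a * s + b * t" using r(2) unfolding N_def by blast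
    then have "f * r = a * (f * s) + b * (f * t)" by (simp add: algebra_simps)
    then show ?thesis using corner_unit(1)[OF r(1)] cornerI[OF f(1)] by metis
  qed
  have sep': "r = 0" if r: "r \<in> corner f" "\<And>i. \<exists>s. r = c ^ i * s" and c: "c ^ m * e = p * s2" for r c m s2
  proof (rule sep[OF sub[OF r(1)]])
    fix i
    obtain s where s: "r = c ^ (m * i) * s" using r(2) by blast
    have "e ^ i * r = r" by (induction i) (use corner_unit(1)[OF sub[OF r(1)]] in \<open>auto simp: mult.assoc\<close>)
    moreover have "(c ^ m * e) ^ i * s = e ^ i * (c ^ (m * i) * s)"
      by (simp only: power_mult_distrib power_mult[symmetric] mult_ac)
    ultimately have "r = (c ^ m * e) ^ i * s" using s by simp
    then show "\<exists>s. r = p ^ i * s" unfolding c by (auto simp: power_mult_distrib mult.assoc)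
  qed
  have ker': "c * r = 0 \<longleftrightarrow> (\<exists>s\<in>corner f. r = d * s)" if r: "r \<in> corner f"
    and ker: "\<And>r. r \<in> corner e \<Longrightarrow> c * r = 0 \<longleftrightarrow> (\<exists>s. r = d * (e * s))" for r c d
  proof
    assume "c * r = 0"
    then obtain s where "r = d * (e * s)" using ker[OF sub[OF r]] by blast
    then have "f * r = d * (f * (e * s))" by (simp add: mult_ac)
    then show "\<exists>s\<in>corner f. r = d * s" using corner_unit(1)[OF r] cornerI[OF f(1)] by metis
  next
    assume "\<exists>s\<in>corner f. r = d * s"
    then obtain s where "s \<in> corner f" "r = d * s" by blast
    then have "r = d * (e * s)" using corner_unit(1)[OF sub] by metis
    then show "c * r = 0" using ker[OF sub[OF r]] by blast
  qed
  interpret node f a b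
  proof
    show "f * f = f" by (rule f)
    show "a * r = 0 \<longleftrightarrow> (\<exists>s\<in>corner f. r = b * s)" if "r \<in> corner f" for r
      using ker'[OF that ker_a] .
    show "b * r = 0 \<longleftrightarrow> (\<exists>s\<in>corner f. r = a * s)" if "r \<in> corner f" for r
      using ker'[OF that ker_b] .
    show "r = 0" if "r \<in> corner f" "a * r = 0" "b * r = 0" for r
      using ker_ab[OF sub] that by blast
    show "r = 0" if "r \<in> corner f" "\<And>i. \<exists>s. r = a ^ i * s" for r using sep'[OF that nil(1)] .
    show "r = 0" if "r \<in> corner f" "\<And>i. \<exists>s. r = b ^ i * s" for r using sep'[OF that nil(2)] .
    show "(\<exists>s. r * s = f) \<or> (\<exists>s\<in>corner f. \<exists>t\<in>corner f. r = a * s + b * t)" if r: "r \<in> corner f" for r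
    proof -
      have "(\<exists>s. r * s = f) \<or> r \<in> N"
      proof (rule primitive_local[OF f prim split N pN _ q r])
        show "r ^ q - r \<in> N" if "r \<in> corner e" for r using frob[OF that] unfolding N_def by blast
      qed
      then show ?thesis using N_corner[OF r] by blast
    qed
    let ?J = "{a * s + b * t | s t. s \<in> corner f \<and> t \<in> corner f}"
    have J: "?J = N \<inter> corner f"
    proof
      show "?J \<subseteq> N \<inter> corner f"
        unfolding N_def using corner_mult(1) corner_add by blast
      show "N \<inter> corner f \<subseteq> ?J" using N_corner by blast
    qed
    have sub_N: "(*) p ` corner f \<subseteq> N \<inter> corner f" using pN sub corner_mult(1) by blast
    show "0 < index (corner f) ?J"
      unfolding J
    proof (rule index_le_of_subset(3)[OF _ _ _ sub_N _ fin_f])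
      show "subgrp (corner f)" by (rule subspace_subgrp(1)[OF subspace_corner])
      show "subgrp (N \<inter> corner f)"
        by (intro subgrp_Int subspace_subgrp(1) N subspace_corner)
      show "subgrp ((*) p ` corner f)" by (rule subspace_subgrp(1)[OF subspace_mult_image[OF subspace_corner]])
    qed simp
  qed
  show "fitting_bound f" by (rule fitting_bound)
qed

section \<open>Rings with a carrier as corners of a ring type\<close>

text \<open>
  The product of the integers and of all commutative rings whose carrier consists of elements of type
  \<open>'a\<close>. It is a single type of class \<open>comm_ring_1\<close> that has every such ring as a corner; the integer
  factor guarantees \<open>0 \<noteq> 1\<close>.
\<close>

typedef (overloaded) 'a ring_product =
  "{x :: int \<times> ('a ring \<Rightarrow> 'a). \<forall>R. if cring R then snd x R \<in> carrier R else snd x R = undefined}"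
proof
  show "(0, \<lambda>R. if cring R then \<zero>\<^bsub>R\<^esub> else undefined)
      \<in> {x :: int \<times> ('a ring \<Rightarrow> 'a). \<forall>R. if cring R then snd x R \<in> carrier R else snd x R = undefined}"
    by (auto intro: ring.ring_simprules simp: cring.axioms)
qed

definition int_part :: "'a ring_product \<Rightarrow> int" where
  "int_part x = fst (Rep_ring_product x)"

definition proj :: "'a ring \<Rightarrow> 'a ring_product \<Rightarrow> 'a" where
  "proj R x = snd (Rep_ring_product x) R"

definition tuple :: "int \<Rightarrow> ('a ring \<Rightarrow> 'a) \<Rightarrow> 'a ring_product" where
  "tuple k c = Abs_ring_product (k, \<lambda>R. if cring R then c R else undefined)"

lemma proj_closed [simp, intro]: "cring R \<Longrightarrow> proj R x \<in> carrier R"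
  using Rep_ring_product[of x] by (auto simp: proj_def split: if_splits)

lemma tuple_sel:
  assumes "\<And>R. cring R \<Longrightarrow> c R \<in> carrier R"
  shows "int_part (tuple k c) = k" "cring R \<Longrightarrow> proj R (tuple k c) = c R"
  using assms by (simp_all add: int_part_def proj_def tuple_def Abs_ring_product_inverse)

lemma ring_product_eqI:
  assumes "int_part x = int_part y" "\<And>R. cring R \<Longrightarrow> proj R x = proj R y"
  shows "x = y"
proof -
  have "snd (Rep_ring_product x) R = snd (Rep_ring_product y) R" for R
  proof (cases "cring R")
    case True
    then show ?thesis using assms(2) by (simp add: proj_def)
  next
    case False
    then show ?thesis using Rep_ring_product[of x] Rep_ring_product[of y] by (auto split: if_splits)
  qed
  then have "Rep_ring_product x = Rep_ring_product y"
    using assms(1) by (intro prod_eqI) (auto simp: int_part_def)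
  then show ?thesis by (simp add: Rep_ring_product_inject)
qed

instantiation ring_product :: (type) comm_ring_1
begin

definition "0 = tuple 0 (\<lambda>R. \<zero>\<^bsub>R\<^esub>)"
definition "1 = tuple 1 (\<lambda>R. \<one>\<^bsub>R\<^esub>)"
definition "x + y = tuple (int_part x + int_part y) (\<lambda>R. proj R x \<oplus>\<^bsub>R\<^esub> proj R y)"
definition "x * y = tuple (int_part x * int_part y) (\<lambda>R. proj R x \<otimes>\<^bsub>R\<^esub> proj R y)"
definition "- x = tuple (- int_part x) (\<lambda>R. \<ominus>\<^bsub>R\<^esub> proj R x)"
definition "x - y = tuple (int_part x - int_part y) (\<lambda>R. proj R x \<ominus>\<^bsub>R\<^esub> proj R y)" for x y :: "'a ring_product"

lemma int_part_simps [simp]: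
  "int_part (0 :: 'a ring_product) = 0" "int_part (1 :: 'a ring_product) = 1"
  "int_part (x + y) = int_part x + int_part y" "int_part (x * y) = int_part x * int_part y"
  "int_part (- x) = - int_part x" "int_part (x - y) = int_part x - int_part (y :: 'a ring_product)"
  unfolding zero_ring_product_def one_ring_product_def plus_ring_product_def times_ring_product_def
    uminus_ring_product_def minus_ring_product_def
  by (rule tuple_sel(1), simp add: cring.cring_simprules)+

lemma proj_simps [simp]:
  assumes "cring R"
  shows "proj R 0 = \<zero>\<^bsub>R\<^esub>" "proj R 1 = \<one>\<^bsub>R\<^esub>"
    "proj R (x + y) = proj R x \<oplus>\<^bsub>R\<^esub> proj R y" "proj R (x * y) = proj R x \<otimes>\<^bsub>R\<^esub> proj R y"
    "proj R (- x) = \<ominus>\<^bsub>R\<^esub> proj R x" "proj R (x - y) = proj R x \<ominus>\<^bsub>R\<^esub> proj R y"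
  unfolding zero_ring_product_def one_ring_product_def plus_ring_product_def times_ring_product_def
    uminus_ring_product_def minus_ring_product_def
  by (rule tuple_sel(2), simp add: cring.cring_simprules, rule assms)+

instance
proof
  fix x y z :: "'a ring_product"
  show "x + y + z = x + (y + z)" "x + y = y + x" "0 + x = x" "- x + x = 0" "x - y = x + - y"
    "x * y * z = x * (y * z)" "x * y = y * x" "1 * x = x" "(x + y) * z = x * z + y * z"
    by (rule ring_product_eqI; simp add: cring.cring_simprules algebra_simps)+
  show "0 \<noteq> (1 :: 'a ring_product)" using int_part_simps(1,2) by (metis zero_neq_one)
qed

end

text \<open>
  The inclusion of one factor into the product; the image of the unit of \<open>R\<close> is an idempotent whose corner
  is a copy of \<open>R\<close>.
\<close>

definition emb :: "'a ring \<Rightarrow> 'a \<Rightarrow> 'a ring_product" where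
  "emb R r = tuple 0 (\<lambda>R'. if R' = R then r else \<zero>\<^bsub>R'\<^esub>)"

context
  fixes R :: "'a ring"
  assumes R: "cring R"
begin

interpretation R: cring R by (rule R)

lemma emb_sel:
  assumes "r \<in> carrier R"
  shows "int_part (emb R r) = 0" "cring R' \<Longrightarrow> proj R' (emb R r) = (if R' = R then r else \<zero>\<^bsub>R'\<^esub>)"
proof -
  have c: "(if R' = R then r else \<zero>\<^bsub>R'\<^esub>) \<in> carrier R'" if "cring R'" for R'
    using assms that by (simp add: cring.cring_simprules)
  show "int_part (emb R r) = 0" unfolding emb_def by (rule tuple_sel(1)[OF c])
  show "cring R' \<Longrightarrow> proj R' (emb R r) = (if R' = R then r else \<zero>\<^bsub>R'\<^esub>)"
    unfolding emb_def using tuple_sel(2)[of "\<lambda>R'. if R' = R then r else \<zero>\<^bsub>R'\<^esub>", OF c] by simp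
qed

lemma proj_emb [simp]: "r \<in> carrier R \<Longrightarrow> proj R (emb R r) = r"
  using emb_sel(2)[OF _ R] by simp

lemma emb_one_mult: "emb R \<one>\<^bsub>R\<^esub> * x = emb R (proj R x)"
  by (rule ring_product_eqI) (auto simp: emb_sel R cring.cring_simprules)

lemma emb_one_idem: "emb R \<one>\<^bsub>R\<^esub> * emb R \<one>\<^bsub>R\<^esub> = emb R \<one>\<^bsub>R\<^esub>"
  by (simp add: emb_one_mult)

lemma corner_emb_iff: "x \<in> corner (emb R \<one>\<^bsub>R\<^esub>) \<longleftrightarrow> emb R (proj R x) = x"
  by (simp add: corner_def emb_one_mult)

lemma emb_corner: "r \<in> carrier R \<Longrightarrow> emb R r \<in> corner (emb R \<one>\<^bsub>R\<^esub>)"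
  by (simp add: corner_emb_iff)

lemma proj_corner_eqI:
  "x \<in> corner (emb R \<one>\<^bsub>R\<^esub>) \<Longrightarrow> y \<in> corner (emb R \<one>\<^bsub>R\<^esub>) \<Longrightarrow> proj R x = proj R y \<Longrightarrow> x = y"
  by (metis corner_emb_iff)

lemma proj_unit: "proj R (emb R \<one>\<^bsub>R\<^esub> * x) = proj R x"
  by (simp add: R)

lemma proj_sum: "finite A \<Longrightarrow> proj R (sum f A) = (\<Oplus>\<^bsub>R\<^esub>i\<in>A. proj R (f i))"
  by (induction A rule: finite_induct) (simp_all add: R)

lemma proj_prod: "finite A \<Longrightarrow> proj R (prod f A) = (\<Otimes>\<^bsub>R\<^esub>i\<in>A. proj R (f i))"
  by (induction A rule: finite_induct) (simp_all add: R)

lemma proj_sign: "proj R (of_int (sign \<sigma>) * x) = [sign \<sigma>] \<cdot>\<^bsub>R\<^esub> proj R x"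
proof (cases "evenperm \<sigma>")
  case True
  then show ?thesis by (simp add: sign_def R add_pow_int_ge)
next
  case False
  then show ?thesis by (simp add: sign_def R add_pow_int_lt)
qed

lemma proj_det:
  "proj R (det n V) = det_vectors R n (\<lambda>i. \<lambda>j\<in>{..<n}. proj R (V i j))"
proof -
  have "proj R (det n V) = (\<Oplus>\<^bsub>R\<^esub>\<sigma>\<in>{\<sigma>. \<sigma> permutes {..<n}}. [sign \<sigma>] \<cdot>\<^bsub>R\<^esub> (\<Otimes>\<^bsub>R\<^esub>i\<in>{..<n}. proj R (V i (\<sigma> i))))"
    unfolding det_def by (simp only: proj_sum[OF finite_perms] proj_sign proj_prod[OF finite_lessThan])
  also have "\<dots> = det_vectors R n (\<lambda>i. \<lambda>j\<in>{..<n}. proj R (V i j))"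
    unfolding det_vectors_def
  proof (intro R.finsum_cong' refl)
    show "(\<lambda>\<sigma>. [sign \<sigma>] \<cdot>\<^bsub>R\<^esub> (\<Otimes>\<^bsub>R\<^esub>i\<in>{..<n}. (\<lambda>j\<in>{..<n}. proj R (V i j)) (\<sigma> i)))
        \<in> {\<sigma>. \<sigma> permutes {..<n}} \<rightarrow> carrier R"
      by (auto intro!: R.add.int_pow_closed R.finprod_closed simp: perm_less R)
    fix \<sigma> assume "\<sigma> \<in> {\<sigma>. \<sigma> permutes {..<n}}"
    then have "(\<Otimes>\<^bsub>R\<^esub>i\<in>{..<n}. proj R (V i (\<sigma> i))) = (\<Otimes>\<^bsub>R\<^esub>i\<in>{..<n}. (\<lambda>j\<in>{..<n}. proj R (V i j)) (\<sigma> i))"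
      by (intro R.finprod_cong') (auto simp: perm_less R)
    then show "[sign \<sigma>] \<cdot>\<^bsub>R\<^esub> (\<Otimes>\<^bsub>R\<^esub>i\<in>{..<n}. proj R (V i (\<sigma> i)))
        = [sign \<sigma>] \<cdot>\<^bsub>R\<^esub> (\<Otimes>\<^bsub>R\<^esub>i\<in>{..<n}. (\<lambda>j\<in>{..<n}. proj R (V i j)) (\<sigma> i))" by simp
  qed
  finally show ?thesis .
qed

end

lemma (in Module.module) free_presentation_exists:
  assumes fin: "finite (carrier M)"
  shows "\<exists>t f. free_presentation R M t f"
proof -
  obtain m where m: "bij_betw m {..<card (carrier M)} (carrier M)"
    using ex_bij_betw_nat_finite[OF fin] by (auto simp: atLeast0LessThan)
  define t where "t = card (carrier M)"
  have m_car: "m i \<in> carrier M" if "i < t" for i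
    using bij_betwE[OF m] that by (auto simp: t_def)
  define f where "f v = (\<Oplus>\<^bsub>M\<^esub>i\<in>{..<t}. v i \<odot>\<^bsub>M\<^esub> m i)" for v
  have v: "v i \<in> carrier R" if "v \<in> carrier (free_module R t)" "i < t" for v i
    using that by (auto simp: free_module_def)
  have f_car: "f v \<in> carrier M" if "v \<in> carrier (free_module R t)" for v
    unfolding f_def using v[OF that] m_car by (intro M.finsum_closed) auto
  have "f \<in> module_hom R (free_module R t) M"
    unfolding Defs.module_hom_def
  proof (intro CollectI conjI ballI)
    show "f \<in> carrier (free_module R t) \<rightarrow> carrier M" using f_car by blast
    fix v assume vc: "v \<in> carrier (free_module R t)"
    show "f (v \<oplus>\<^bsub>free_module R t\<^esub> w) = f v \<oplus>\<^bsub>M\<^esub> f w" if wc: "w \<in> carrier (free_module R t)" for w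
    proof -
      have "f (v \<oplus>\<^bsub>free_module R t\<^esub> w) = (\<Oplus>\<^bsub>M\<^esub>i\<in>{..<t}. v i \<odot>\<^bsub>M\<^esub> m i \<oplus>\<^bsub>M\<^esub> w i \<odot>\<^bsub>M\<^esub> m i)"
        unfolding f_def using v[OF vc] v[OF wc] m_car
        by (intro M.finsum_cong') (auto simp: free_module_def smult_l_distr)
      also have "\<dots> = f v \<oplus>\<^bsub>M\<^esub> f w"
        unfolding f_def using v[OF vc] v[OF wc] m_car by (intro M.finsum_addf) auto
      finally show ?thesis .
    qed
    show "f (r \<odot>\<^bsub>free_module R t\<^esub> v) = r \<odot>\<^bsub>M\<^esub> f v" if r: "r \<in> carrier R" for r
    proof -
      have "f (r \<odot>\<^bsub>free_module R t\<^esub> v) = (\<Oplus>\<^bsub>M\<^esub>i\<in>{..<t}. r \<odot>\<^bsub>M\<^esub> (v i \<odot>\<^bsub>M\<^esub> m i))"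
        unfolding f_def using v[OF vc] r m_car
        by (intro M.finsum_cong') (auto simp: free_module_def smult_assoc1)
      also have "\<dots> = r \<odot>\<^bsub>M\<^esub> f v"
        unfolding f_def using v[OF vc] r m_car by (intro finsum_smult_ldistr[symmetric]) auto
      finally show ?thesis .
    qed
  qed
  moreover have "f ` carrier (free_module R t) = carrier M"
  proof
    show "f ` carrier (free_module R t) \<subseteq> carrier M" using f_car by blast
    show "carrier M \<subseteq> f ` carrier (free_module R t)"
    proof
      fix x assume "x \<in> carrier M"
      then obtain j where j: "j < t" "x = m j" using m by (auto simp: bij_betw_def t_def)
      let ?u = "\<lambda>i\<in>{..<t}. if i = j then \<one>\<^bsub>R\<^esub> else \<zero>\<^bsub>R\<^esub>"
      have "f ?u = (\<Oplus>\<^bsub>M\<^esub>i\<in>{..<t}. if j = i then m i else \<zero>\<^bsub>M\<^esub>)"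
        unfolding f_def using m_car by (intro M.finsum_cong') auto
      also have "\<dots> = m j" using j m_car by (intro M.finsum_singleton) auto
      finally have "x = f ?u" using j by simp
      moreover have "?u \<in> carrier (free_module R t)" by (auto simp: free_module_def)
      ultimately show "x \<in> f ` carrier (free_module R t)" by blast
    qed
  qed
  ultimately show ?thesis unfolding free_presentation_def by blast
qed

text \<open>
  The kernel of the presentation, carried over to the corner of \<open>R\<close>, has the size of \<open>M\<close> as its index, and
  its determinants span the copy of the Fitting ideal. This holds for each presentation, hence for
  the one chosen in the definition of the Fitting ideal.
\<close>

lemma presentation_index:
  fixes R :: "'a ring"
  assumes M: "Module.module R M" and pres: "free_presentation R M t f"
  defines "e \<equiv> emb R \<one>\<^bsub>R\<^esub>"
  defines "coords \<equiv> \<lambda>w. \<lambda>j\<in>{..<t}. proj R (w j)"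
  defines "K \<equiv> {w \<in> free e t. f (coords w) = \<zero>\<^bsub>M\<^esub>}"
  defines "F \<equiv> fitting_ideal_wrt R M t f"
  shows "vec.subspace K" "index (free e t) K = card (carrier M)"
    "ideal F R" "Fit e t K = {x\<in>corner e. proj R x \<in> F}"
proof -
  interpret M: Module.module R M by (rule M)
  have R: "cring R" ..
  let ?L = "free_module R t"
  have hom: "f v \<in> carrier M" "f (v \<oplus>\<^bsub>?L\<^esub> w) = f v \<oplus>\<^bsub>M\<^esub> f w" "f (r \<odot>\<^bsub>?L\<^esub> v) = r \<odot>\<^bsub>M\<^esub> f v"
    if "v \<in> carrier ?L" "w \<in> carrier ?L" "r \<in> carrier R" for v w r
    using pres that unfolding free_presentation_def Defs.module_hom_def by auto
  have coords_car: "coords w \<in> carrier ?L" for w by (auto simp: coords_def free_module_def R)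
  have coords_add: "coords (v + w) = coords v \<oplus>\<^bsub>?L\<^esub> coords w" for v w
    by (auto simp: coords_def free_module_def R fun_eq_iff)
  have coords_smul: "coords (smul r w) = proj R r \<odot>\<^bsub>?L\<^esub> coords w" for r w
    by (auto simp: coords_def free_module_def R fun_eq_iff)
  have fadd: "f (coords (v + w)) = f (coords v) \<oplus>\<^bsub>M\<^esub> f (coords w)" for v w
    unfolding coords_add using hom(2)[OF coords_car coords_car M.R.one_closed] .
  have fsmul: "f (coords (smul r w)) = proj R r \<odot>\<^bsub>M\<^esub> f (coords w)" for r w
    unfolding coords_smul using hom(3)[OF coords_car coords_car proj_closed[OF R]] .
  have fc: "f (coords w) \<in> carrier M" for w using hom(1)[OF coords_car coords_car M.R.one_closed] .
  have f0: "f (coords 0) = \<zero>\<^bsub>M\<^esub>"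
  proof -
    have "f (coords (smul 0 0)) = \<zero>\<^bsub>M\<^esub>" unfolding fsmul using fc by (simp add: R)
    then show ?thesis by simp
  qed
  show K: "vec.subspace K"
    unfolding K_def
  proof (rule vec.subspaceI, goal_cases)
    case 1
    then show ?case using f0 vec.subspace_0[OF subspace_free] by blast
  next
    case (2 x y)
    then show ?case using vec.subspace_add[OF subspace_free] by (auto simp: fadd)
  next
    case (3 c x)
    then show ?case using vec.subspace_scale[OF subspace_free] by (auto simp: fsmul R)
  qed
  have "index (free e t) K = card ((\<lambda>w. f (coords w)) ` free e t)"
  proof (rule index_eq_card_image)
    show "subgrp K" by (rule subspace_subgrp(2)[OF K])
    fix v w assume vw: "v \<in> free e t" "w \<in> free e t"
    have "f (coords v) = f (coords (v - w)) \<oplus>\<^bsub>M\<^esub> f (coords w)" unfolding fadd[symmetric] by simp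
    then have "f (coords v) = f (coords w) \<longleftrightarrow> f (coords (v - w)) = \<zero>\<^bsub>M\<^esub>"
      using fc by (metis M.M.add.r_cancel_one M.M.l_zero)
    then show "f (coords v) = f (coords w) \<longleftrightarrow> v - w \<in> K"
      unfolding K_def using vec.subspace_diff[OF subspace_free vw] by blast
  qed
  also have "(\<lambda>w. f (coords w)) ` free e t = f ` coords ` free e t" by (simp add: image_image)
  also have "coords ` free e t = carrier ?L"
  proof
    show "coords ` free e t \<subseteq> carrier ?L" using coords_car by blast
    show "carrier ?L \<subseteq> coords ` free e t"
    proof
      fix v assume v: "v \<in> carrier ?L"
      have vc: "v i \<in> carrier R" if "i < t" for i using v that by (auto simp: free_module_def)
      let ?w = "\<lambda>i. if i < t then emb R (v i) else 0"
      have w: "?w \<in> free e t" using vc emb_corner[OF R] by (auto simp: free_def e_def)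
      have eq: "coords ?w = v"
      proof
        fix j
        show "coords ?w j = v j"
        proof (cases "j < t")
          case True
          then show ?thesis using proj_emb[OF R vc] by (simp add: coords_def)
        next
          case False
          then have "v j = undefined" using v by (intro PiE_arb[of v "{..<t}"]) (auto simp: free_module_def)
          then show ?thesis using False by (simp add: coords_def)
        qed
      qed
      show "v \<in> coords ` free e t" using imageI[OF w, of coords] unfolding eq .
    qed
  qed
  also have "f ` carrier ?L = carrier M" using pres by (simp add: free_presentation_def)
  finally show "index (free e t) K = card (carrier M)" .
  let ?S = "{det_vectors R t V | V. \<forall>i<t. V i \<in> carrier ?L \<and> f (V i) = \<zero>\<^bsub>M\<^esub>}"
  have F: "F = Idl\<^bsub>R\<^esub> ?S" by (simp add: F_def fitting_ideal_wrt_def)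
  have det_cong_R: "det_vectors R t V = det_vectors R t W" if "\<And>i. i < t \<Longrightarrow> V i = W i"
    "\<And>i. i < t \<Longrightarrow> W i \<in> carrier ?L" for V W
  proof -
    have W: "W i j \<in> carrier R" if "i < t" "j < t" for i j
      using \<open>\<And>i. i < t \<Longrightarrow> W i \<in> carrier ?L\<close>[OF that(1)] that(2) by (auto simp: free_module_def dest: PiE_mem)
    have "(\<Otimes>\<^bsub>R\<^esub>i\<in>{..<t}. V i (\<sigma> i)) = (\<Otimes>\<^bsub>R\<^esub>i\<in>{..<t}. W i (\<sigma> i))" if "\<sigma> permutes {..<t}" for \<sigma>
      using \<open>\<And>i. i < t \<Longrightarrow> V i = W i\<close> W perm_less[OF that] by (intro M.R.finprod_cong') auto
    moreover have "[sign \<sigma>] \<cdot>\<^bsub>R\<^esub> (\<Otimes>\<^bsub>R\<^esub>i\<in>{..<t}. W i (\<sigma> i)) \<in> carrier R" if "\<sigma> permutes {..<t}" for \<sigma>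
      using W perm_less[OF that] by (intro M.R.add.int_pow_closed M.R.finprod_closed) auto
    ultimately show ?thesis
      unfolding det_vectors_def by (intro M.R.finsum_cong') auto
  qed
  have lift: "\<exists>W. (\<forall>i<t. W i \<in> K) \<and> proj R (det t W) = det_vectors R t V"
    if V: "\<forall>i<t. V i \<in> carrier ?L \<and> f (V i) = \<zero>\<^bsub>M\<^esub>" for V
  proof -
    have "\<exists>w. i < t \<longrightarrow> w \<in> K \<and> coords w = V i" for i
    proof (cases "i < t")
      case True
      then have "V i \<in> coords ` free e t" using V \<open>coords ` free e t = carrier ?L\<close> by blast
      then obtain w where "w \<in> free e t" "V i = coords w" by blast
      moreover have "f (V i) = \<zero>\<^bsub>M\<^esub>" using V True by blast
      ultimately show ?thesis unfolding K_def by (intro exI[of _ w]) simp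
    qed blast
    then obtain W where W: "\<And>i. i < t \<Longrightarrow> W i \<in> K \<and> coords (W i) = V i" by metis
    have "proj R (det t W) = det_vectors R t (\<lambda>i. coords (W i))"
      using proj_det[OF R] by (simp add: coords_def)
    also have "\<dots> = det_vectors R t V" using W V by (intro det_cong_R) auto
    finally show ?thesis using W by blast
  qed
  have S_car: "?S \<subseteq> carrier R"
  proof
    fix x assume "x \<in> ?S"
    then obtain W where "x = proj R (det t W)" using lift by auto metis
    then show "x \<in> carrier R" using R by simp
  qed
  show ideal_F: "ideal F R" unfolding F by (rule M.R.genideal_ideal[OF S_car])
  interpret F: ideal F R by (rule ideal_F)
  have e: "e * e = e" unfolding e_def by (rule emb_one_idem[OF R])
  show "Fit e t K = {x\<in>corner e. proj R x \<in> F}"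
  proof
    show "Fit e t K \<subseteq> {x\<in>corner e. proj R x \<in> F}"
      unfolding Fit_def
    proof (rule idl.span_minimal)
      show "idl.subspace {x\<in>corner e. proj R x \<in> F}"
      proof (rule idl.subspaceI, goal_cases)
        case 1
        then show ?case using corner_zero by (simp add: R)
      next
        case (2 x y)
        then show ?case using idl.subspace_add[OF subspace_corner, of x e y] by (simp add: R F.a_closed)
      next
        case (3 c x)
        then show ?case using corner_mult(1)[of x e c] F.I_l_closed by (simp add: R)
      qed
      show "{e * det t V | V. \<forall>i<t. V i \<in> K} \<subseteq> {x\<in>corner e. proj R x \<in> F}"
      proof clarify
        fix V assume V: "\<forall>i<t. V i \<in> K"
        have "proj R (e * det t V) = det_vectors R t (\<lambda>i. coords (V i))"
          unfolding e_def proj_unit[OF R] using proj_det[OF R] by (simp add: coords_def)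
        moreover have "\<dots> \<in> ?S" using V coords_car by (auto simp: K_def)
        ultimately have "proj R (e * det t V) \<in> F" unfolding F using M.R.genideal_self[OF S_car] by auto
        then show "e * det t V \<in> corner e \<and> proj R (e * det t V) \<in> F" using cornerI[OF e] by blast
      qed
    qed
    have "F \<subseteq> {r\<in>carrier R. emb R r \<in> Fit e t K}"
      unfolding F
    proof (rule M.R.genideal_minimal)
      have emb_add: "emb R (x \<oplus>\<^bsub>R\<^esub> y) = emb R x + emb R y" if "x \<in> carrier R" "y \<in> carrier R" for x y
        using that R corner_add emb_corner[OF R]
        by (intro proj_corner_eqI[OF R]) (auto simp: proj_emb[OF R])
      have emb_mult: "emb R (x \<otimes>\<^bsub>R\<^esub> y) = emb R x * emb R y" if "x \<in> carrier R" "y \<in> carrier R" for x y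
        using that R corner_mult(1) emb_corner[OF R]
        by (intro proj_corner_eqI[OF R]) (auto simp: proj_emb[OF R])
      have emb_neg: "emb R (\<ominus>\<^bsub>R\<^esub> x) = - emb R x" if "x \<in> carrier R" for x
        using that R idl.subspace_neg[OF subspace_corner] emb_corner[OF R]
        by (intro proj_corner_eqI[OF R]) (auto simp: proj_emb[OF R])
      have emb_0: "emb R \<zero>\<^bsub>R\<^esub> = 0"
        using R corner_zero emb_corner[OF R]
        by (intro proj_corner_eqI[OF R]) (auto simp: proj_emb[OF R])
      show "ideal {r\<in>carrier R. emb R r \<in> Fit e t K} R"
      proof (rule idealI)
        show "ring R" ..
        show "subgroup {r\<in>carrier R. emb R r \<in> Fit e t K} (add_monoid R)"
          by (rule M.R.add.subgroupI)
            (auto simp: emb_0 emb_add emb_neg Fit_zero Fit_add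
              idl.subspace_neg[OF subspace_Fit] intro!: exI[of _ "\<zero>\<^bsub>R\<^esub>"])
        show "x \<otimes>\<^bsub>R\<^esub> a \<in> {r\<in>carrier R. emb R r \<in> Fit e t K}"
          "a \<otimes>\<^bsub>R\<^esub> x \<in> {r\<in>carrier R. emb R r \<in> Fit e t K}"
          if "a \<in> {r\<in>carrier R. emb R r \<in> Fit e t K}" "x \<in> carrier R" for a x
          using that Fit_scale by (auto simp: emb_mult mult.commute)
      qed
      show "?S \<subseteq> {r\<in>carrier R. emb R r \<in> Fit e t K}"
      proof
        fix x assume x: "x \<in> ?S"
        then obtain W where W: "\<forall>i<t. W i \<in> K" "x = proj R (det t W)" using lift by auto metis
        have "emb R x = e * det t W" unfolding e_def W(2) by (rule emb_one_mult[OF R, symmetric])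
        then show "x \<in> {r\<in>carrier R. emb R r \<in> Fit e t K}" using Fit_det W(1) S_car x by auto
      qed
    qed
    then show "{x\<in>corner e. proj R x \<in> F} \<subseteq> Fit e t K"
      using corner_emb_iff[OF R] unfolding e_def by auto
  qed
qed

theorem card_le_card_quotient_Fitting:
  fixes R :: "'a ring"
  assumes M: "Module.module R M" and fin: "finite (carrier M)" and bound: "fitting_bound (emb R \<one>\<^bsub>R\<^esub>)"
  shows "card (carrier M) \<le> card (carrier (R Quot fitting_ideal R M)) \<and>
    (principalideal (fitting_ideal R M) R \<longrightarrow>
      card (carrier M) = card (carrier (R Quot fitting_ideal R M)))"
proof -
  interpret M: Module.module R M by (rule M)
  have R: "cring R" ..
  obtain t f where tf: "(SOME (t, f). free_presentation R M t f) = (t, f)" by force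
  have pres: "free_presentation R M t f"
  proof -
    have "\<exists>tf. case tf of (t, f) \<Rightarrow> free_presentation R M t f" using M.free_presentation_exists[OF fin] by auto
    then have "case (SOME (t, f). free_presentation R M t f) of (t, f) \<Rightarrow> free_presentation R M t f" by (rule someI_ex)
    then show ?thesis unfolding tf by simp
  qed
  define F where "F = fitting_ideal R M"
  have F_wrt: "fitting_ideal_wrt R M t f = F" unfolding F_def fitting_ideal_def tf by simp
  define e where "e = emb R \<one>\<^bsub>R\<^esub>"
  define K where "K = {w \<in> free e t. f (\<lambda>j\<in>{..<t}. proj R (w j)) = \<zero>\<^bsub>M\<^esub>}"
  note P = presentation_index[OF M pres, folded e_def, folded K_def, unfolded F_wrt]
  interpret F: ideal F R by (rule P(3))
  have idx: "index (corner e) (Fit e t K) = card (carrier (R Quot F))"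
  proof -
    let ?h = "\<lambda>x. F +>\<^bsub>R\<^esub> proj R x"
    have "index (corner e) (Fit e t K) = card (?h ` corner e)"
    proof (rule index_eq_card_image[OF subspace_subgrp(1)[OF subspace_Fit]])
      fix x y assume "x \<in> corner e" "y \<in> corner e"
      then have "x - y \<in> Fit e t K \<longleftrightarrow> proj R x \<ominus>\<^bsub>R\<^esub> proj R y \<in> F"
        unfolding P(4) using corner_diff by (auto simp: R)
      then show "?h x = ?h y \<longleftrightarrow> x - y \<in> Fit e t K"
        using M.R.quotient_eq_iff_same_a_r_cos[OF P(3) proj_closed[OF R] proj_closed[OF R]] by blast
    qed
    also have "?h ` corner e = (\<lambda>r. F +>\<^bsub>R\<^esub> r) ` carrier R"
    proof
      show "(\<lambda>r. F +>\<^bsub>R\<^esub> r) ` carrier R \<subseteq> ?h ` corner e"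
      proof clarify
        fix r assume "r \<in> carrier R"
        then have "emb R r \<in> corner e" "proj R (emb R r) = r"
          using emb_corner[OF R] proj_emb[OF R] by (auto simp: e_def)
        then show "F +>\<^bsub>R\<^esub> r \<in> ?h ` corner e" by force
      qed
    qed (use R in auto)
    also have "\<dots> = carrier (R Quot F)" by (auto simp: FactRing_def A_RCOSETS_def')
    finally show ?thesis .
  qed
  have "K \<subseteq> free e t" unfolding K_def by blast
  moreover have "0 < index (free e t) K"
    unfolding P(2) using fin M.M.zero_closed by (auto simp: card_gt_0_iff)
  ultimately have B: "index (free e t) K \<le> index (corner e) (Fit e t K) \<and>
      ((\<exists>g. Fit e t K = (*) g ` corner e) \<longrightarrow> index (free e t) K = index (corner e) (Fit e t K))"
    using bound P(1) unfolding fitting_bound_def e_def[symmetric] by blast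
  have "\<exists>g. Fit e t K = (*) g ` corner e" if prin: "principalideal F R"
  proof -
    obtain i where i: "i \<in> carrier R" "F = Idl\<^bsub>R\<^esub> {i}" using principalideal.generate[OF prin] by blast
    then have Fi: "F = {x \<otimes>\<^bsub>R\<^esub> i | x. x \<in> carrier R}"
      using M.R.cgenideal_eq_genideal by (simp add: cgenideal_def)
    have "Fit e t K = (*) (emb R i) ` corner e"
    proof
      show "Fit e t K \<subseteq> (*) (emb R i) ` corner e"
      proof
        fix x assume "x \<in> Fit e t K"
        then obtain r where x: "x \<in> corner e" and r: "r \<in> carrier R" "proj R x = r \<otimes>\<^bsub>R\<^esub> i"
          unfolding P(4) Fi by auto
        have "x = emb R i * emb R r"
          using x r i R emb_corner[OF R] corner_mult(1) unfolding e_def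
          by (intro proj_corner_eqI[OF R]) (auto simp: proj_emb[OF R] M.R.m_comm)
        then show "x \<in> (*) (emb R i) ` corner e" using emb_corner[OF R] r unfolding e_def by blast
      qed
      show "(*) (emb R i) ` corner e \<subseteq> Fit e t K"
      proof clarify
        fix x assume x: "x \<in> corner e"
        have "proj R (emb R i * x) = proj R x \<otimes>\<^bsub>R\<^esub> i"
          using i(1) R proj_emb[OF R] by (simp add: M.R.m_comm)
        then have "proj R (emb R i * x) \<in> F" unfolding Fi using proj_closed[OF R] by blast
        then show "emb R i * x \<in> Fit e t K" unfolding P(4) using corner_mult(1)[OF x] by blast
      qed
    qed
    then show ?thesis by blast
  qed
  then show ?thesis using B unfolding idx P(2) F_def by blast
qed

section \<open>Coefficients and completeness of the group ring\<close>

text \<open>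
  Sums of \<open>p\<close>-adic integers are computed residue by residue.
\<close>

lemma finsum_padic:
  assumes "finite A" "\<And>y. y \<in> A \<Longrightarrow> f y \<in> carrier (padic_int_ring p)" and p: "0 < p"
  shows "(\<Oplus>\<^bsub>padic_int_ring p\<^esub>y\<in>A. f y) = (\<lambda>n. (\<Sum>y\<in>A. f y n) mod int p ^ n)"
proof -
  let ?Z = "padic_int_ring p"
  have closed: "(\<lambda>n. (x n + y n) mod int p ^ n) \<in> carrier ?Z" if "x \<in> carrier ?Z" "y \<in> carrier ?Z" for x y
  proof -
    have "(x (Suc n) + y (Suc n)) mod int p ^ Suc n mod int p ^ n = (x n + y n) mod int p ^ n" for n
    proof -
      have "(x (Suc n) + y (Suc n)) mod int p ^ Suc n mod int p ^ n = (x (Suc n) + y (Suc n)) mod int p ^ n"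
        by (simp add: mod_mod_cancel)
      also have "\<dots> = (x (Suc n) mod int p ^ n + y (Suc n) mod int p ^ n) mod int p ^ n"
        by (simp add: mod_add_eq)
      finally show ?thesis using that by (simp add: padic_int_ring_def)
    qed
    then show ?thesis using p by (simp add: padic_int_ring_def)
  qed
  interpret Z: abelian_monoid ?Z
  proof (rule abelian_monoidI)
    show "x \<oplus>\<^bsub>?Z\<^esub> y \<in> carrier ?Z" if "x \<in> carrier ?Z" "y \<in> carrier ?Z" for x y
      using closed[OF that] by (simp add: padic_int_ring_def)
    show "\<zero>\<^bsub>?Z\<^esub> \<in> carrier ?Z" using p by (simp add: padic_int_ring_def)
    show "x \<oplus>\<^bsub>?Z\<^esub> y \<oplus>\<^bsub>?Z\<^esub> z = x \<oplus>\<^bsub>?Z\<^esub> (y \<oplus>\<^bsub>?Z\<^esub> z)" for x y z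
      by (simp add: padic_int_ring_def mod_simps add.assoc)
    show "\<zero>\<^bsub>?Z\<^esub> \<oplus>\<^bsub>?Z\<^esub> x = x" if "x \<in> carrier ?Z" for x
      using that by (simp add: padic_int_ring_def)
    show "x \<oplus>\<^bsub>?Z\<^esub> y = y \<oplus>\<^bsub>?Z\<^esub> x" for x y by (simp add: padic_int_ring_def add.commute)
  qed
  show ?thesis using assms(1,2)
  proof (induction A rule: finite_induct)
    case empty
    show ?case unfolding Z.finsum_empty by (simp add: padic_int_ring_def)
  next
    case (insert a A)
    have "(\<Oplus>\<^bsub>?Z\<^esub>y\<in>insert a A. f y) = f a \<oplus>\<^bsub>?Z\<^esub> (\<Oplus>\<^bsub>?Z\<^esub>y\<in>A. f y)"
      using insert by (intro Z.finsum_insert) auto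
    also have "\<dots> = (\<lambda>n. (\<Sum>y\<in>insert a A. f y n) mod int p ^ n)"
      using insert by (simp add: padic_int_ring_def mod_simps)
    finally show ?case .
  qed
qed

text \<open>
  The last assumption is part of what it means to have a module over the group ring.
\<close>

locale padic_group =
  fixes p :: nat and G :: "('g, 'x) monoid_scheme" (structure)
  assumes prime: "prime p" and comm: "comm_group G" and finite_G: "finite (carrier G)"
    and cring: "cring (padic_group_ring p G)"
begin

sublocale G: comm_group G by (rule comm)

abbreviation "Z \<equiv> padic_int_ring p"
abbreviation "R \<equiv> padic_group_ring p G"
abbreviation "e \<equiv> emb R \<one>\<^bsub>R\<^esub>"
abbreviation "P \<equiv> of_nat p :: ('g \<Rightarrow> nat \<Rightarrow> int) ring_product"

definition coeff :: "('g \<Rightarrow> nat \<Rightarrow> int) ring_product \<Rightarrow> nat \<Rightarrow> 'g \<Rightarrow> int" where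
  "coeff x n g = proj R x g n"

lemma p_pos: "0 < p" using prime prime_gt_0_nat by blast

lemma e_idem: "e * e = e" by (rule emb_one_idem[OF cring])

lemma proj_Z: "g \<in> carrier G \<Longrightarrow> proj R x g \<in> carrier Z"
  using proj_closed[OF cring, of x] by (auto simp: group_ring_def)

lemma coeff_range: "g \<in> carrier G \<Longrightarrow> 0 \<le> coeff x n g \<and> coeff x n g < int p ^ n"
  using proj_Z[of g x] by (auto simp: coeff_def padic_int_ring_def)

lemma coeff_Suc: "g \<in> carrier G \<Longrightarrow> coeff x (Suc n) g mod int p ^ n = coeff x n g"
  using proj_Z[of g x] by (simp add: coeff_def padic_int_ring_def)

lemma coeff_mod [simp]: "g \<in> carrier G \<Longrightarrow> coeff x n g mod int p ^ n = coeff x n g"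
  using coeff_range by simp

lemma coeff_mono: "g \<in> carrier G \<Longrightarrow> m \<le> n \<Longrightarrow> coeff x n g mod int p ^ m = coeff x m g"
proof (induction n)
  case (Suc n)
  show ?case
  proof (cases "m = Suc n")
    case False
    then have "m \<le> n" using Suc.prems by simp
    then have "coeff x (Suc n) g mod int p ^ m = coeff x (Suc n) g mod int p ^ n mod int p ^ m"
      by (simp add: mod_mod_cancel le_imp_power_dvd)
    then show ?thesis using Suc \<open>m \<le> n\<close> by (simp add: coeff_Suc)
  qed (use coeff_mod[OF Suc.prems(1)] in blast)
qed (use coeff_mod[of g x 0] in simp)

lemma coeff_zero [simp]: "g \<in> carrier G \<Longrightarrow> coeff 0 n g = 0"
  using cring by (simp add: coeff_def group_ring_def padic_int_ring_def)

lemma coeff_add: "g \<in> carrier G \<Longrightarrow> coeff (x + y) n g = (coeff x n g + coeff y n g) mod int p ^ n"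
proof -
  assume g: "g \<in> carrier G"
  have "proj R (x + y) = proj R x \<oplus>\<^bsub>R\<^esub> proj R y" using cring by simp
  then have "proj R (x + y) g = proj R x g \<oplus>\<^bsub>Z\<^esub> proj R y g" using g by (simp add: group_ring_def)
  then show ?thesis by (simp add: coeff_def padic_int_ring_def)
qed

lemma coeff_mult:
  assumes g: "g \<in> carrier G"
  shows "coeff (x * y) n g = (\<Sum>h\<in>carrier G. coeff x n h * coeff y n (inv h \<otimes> g)) mod int p ^ n"
proof -
  have "proj R (x * y) = proj R x \<otimes>\<^bsub>R\<^esub> proj R y" using cring by simp
  then have "proj R (x * y) g = (\<Oplus>\<^bsub>Z\<^esub>h\<in>carrier G. proj R x h \<otimes>\<^bsub>Z\<^esub> proj R y (inv h \<otimes> g))"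
    using g by (simp add: group_ring_def)
  also have "\<dots> = (\<lambda>n. (\<Sum>h\<in>carrier G. (proj R x h \<otimes>\<^bsub>Z\<^esub> proj R y (inv h \<otimes> g)) n) mod int p ^ n)"
  proof (rule finsum_padic[OF finite_G _ p_pos])
    fix h assume h: "h \<in> carrier G"
    let ?a = "proj R x h" and ?b = "proj R y (inv h \<otimes> g)"
    have ab: "?a \<in> carrier Z" "?b \<in> carrier Z" using proj_Z g h by auto
    have "(?a (Suc n) * ?b (Suc n)) mod int p ^ Suc n mod int p ^ n = (?a n * ?b n) mod int p ^ n" for n
    proof -
      have "(?a (Suc n) * ?b (Suc n)) mod int p ^ Suc n mod int p ^ n = (?a (Suc n) * ?b (Suc n)) mod int p ^ n"
        by (simp add: mod_mod_cancel)
      also have "\<dots> = ((?a (Suc n) mod int p ^ n) * (?b (Suc n) mod int p ^ n)) mod int p ^ n"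
        by (simp add: mod_mult_eq)
      finally show ?thesis using ab by (simp add: padic_int_ring_def)
    qed
    then show "?a \<otimes>\<^bsub>Z\<^esub> ?b \<in> carrier Z" using p_pos by (simp add: padic_int_ring_def)
  qed
  finally show ?thesis by (simp add: coeff_def padic_int_ring_def mod_simps mod_sum_eq)
qed

lemma coeff_of_nat_mult: "g \<in> carrier G \<Longrightarrow> coeff (of_nat m * x) n g = (int m * coeff x n g) mod int p ^ n"
proof (induction m)
  case (Suc m)
  have "coeff (of_nat (Suc m) * x) n g = coeff (x + of_nat m * x) n g" by (simp add: algebra_simps)
  then show ?case using Suc by (simp add: coeff_add mod_simps algebra_simps)
qed simp

lemma coeff_diff_zero_iff:
  assumes g: "g \<in> carrier G"
  shows "coeff (x - y) n g = 0 \<longleftrightarrow> coeff x n g = coeff y n g"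
proof -
  have eq: "coeff x n g = (coeff (x - y) n g + coeff y n g) mod int p ^ n" using coeff_add[OF g, of "x - y" y n] by simp
  show ?thesis
  proof
    assume "coeff (x - y) n g = 0"
    then show "coeff x n g = coeff y n g" using eq g by simp
  next
    assume "coeff x n g = coeff y n g"
    then have "(coeff (x - y) n g + coeff y n g) mod int p ^ n = (0 + coeff y n g) mod int p ^ n" using eq g by simp
    then have "int p ^ n dvd coeff (x - y) n g" by (simp add: mod_eq_dvd_iff)
    then show "coeff (x - y) n g = 0" using coeff_range[OF g, of "x - y" n] by (metis coeff_mod dvd_imp_mod_0 g)
  qed
qed

lemma corner_eqI:
  assumes "x \<in> corner e" "y \<in> corner e" "\<And>n g. g \<in> carrier G \<Longrightarrow> coeff x n g = coeff y n g"
  shows "x = y"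
proof (rule proj_corner_eqI[OF cring assms(1,2)], rule PiE_ext)
  show "proj R x \<in> carrier G \<rightarrow>\<^sub>E carrier Z" "proj R y \<in> carrier G \<rightarrow>\<^sub>E carrier Z"
    using proj_closed[OF cring] by (auto simp: group_ring_def)
  show "proj R x g = proj R y g" if "g \<in> carrier G" for g
    using assms(3)[OF that] by (auto simp: coeff_def)
qed

definition of_coeffs :: "(nat \<Rightarrow> 'g \<Rightarrow> int) \<Rightarrow> ('g \<Rightarrow> nat \<Rightarrow> int) ring_product" where
  "of_coeffs c = emb R (\<lambda>g\<in>carrier G. \<lambda>n. c n g)"

lemma of_coeffs_sel:
  assumes "\<And>n g. g \<in> carrier G \<Longrightarrow> 0 \<le> c n g \<and> c n g < int p ^ n \<and> c (Suc n) g mod int p ^ n = c n g"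
  shows "of_coeffs c \<in> corner e" "g \<in> carrier G \<Longrightarrow> coeff (of_coeffs c) n g = c n g"
proof -
  have "(\<lambda>g\<in>carrier G. \<lambda>n. c n g) \<in> carrier R"
    using assms by (auto simp: group_ring_def padic_int_ring_def)
  then show "of_coeffs c \<in> corner e" "g \<in> carrier G \<Longrightarrow> coeff (of_coeffs c) n g = c n g"
    unfolding of_coeffs_def coeff_def using emb_corner[OF cring] proj_emb[OF cring] by auto
qed

text \<open>
  If all residues modulo \<open>p\<^sup>i\<close> vanish, the quotient by \<open>p\<^sup>i\<close> has the residue modulo \<open>p\<^sup>n\<close> that is
  read off from the one modulo \<open>p\<^bsup>n+i\<^esup>\<close>.
\<close>

lemma P_power_dvd_iff:
  assumes x: "x \<in> corner e"
  shows "P ^ i dvd x \<longleftrightarrow> (\<forall>g\<in>carrier G. coeff x i g = 0)"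
proof
  assume "P ^ i dvd x"
  then obtain s where "x = of_nat (p ^ i) * s" by auto
  then have "coeff x i g = (int p ^ i * coeff s i g) mod int p ^ i" if "g \<in> carrier G" for g
    using coeff_of_nat_mult[OF that, of "p ^ i" s i] by simp
  then show "\<forall>g\<in>carrier G. coeff x i g = 0" by simp
next
  assume z: "\<forall>g\<in>carrier G. coeff x i g = 0"
  define c where "c n g = coeff x (n + i) g div int p ^ i" for n g
  have dvd: "int p ^ i dvd coeff x (n + i) g" if "g \<in> carrier G" for n g
    using coeff_mono[OF that, of i "n + i" x] z that by (simp add: dvd_eq_mod_eq_0)
  have c: "0 \<le> c n g \<and> c n g < int p ^ n \<and> c (Suc n) g mod int p ^ n = c n g" if g: "g \<in> carrier G" for n g
  proof (intro conjI)
    show "0 \<le> c n g" unfolding c_def using coeff_range[OF g, of x "n + i"] p_pos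
      by (simp add: pos_imp_zdiv_nonneg_iff)
    have "c n g * int p ^ i < int p ^ n * int p ^ i"
      unfolding c_def using dvd[OF g, of n] coeff_range[OF g, of x "n + i"] by (simp add: power_add)
    then show "c n g < int p ^ n" using p_pos by simp
    have "coeff x (Suc n + i) g = coeff x (n + i) g + int p ^ (n + i) * (coeff x (Suc n + i) g div int p ^ (n + i))"
      using coeff_mono[OF g, of "n + i" "Suc n + i" x] by (metis add_Suc le_Suc_eq mod_mult_div_eq order_refl)
    then have "c (Suc n) g = (coeff x (n + i) g + int p ^ i * (int p ^ n * (coeff x (Suc n + i) g div int p ^ (n + i)))) div int p ^ i"
      unfolding c_def by (simp add: power_add mult_ac)
    also have "\<dots> = c n g + int p ^ n * (coeff x (Suc n + i) g div int p ^ (n + i))"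
      unfolding c_def using p_pos by (subst div_mult_self2) auto
    finally have "c (Suc n) g mod int p ^ n = c n g mod int p ^ n" by simp
    also have "\<dots> = c n g" using \<open>0 \<le> c n g\<close> \<open>c n g < int p ^ n\<close> by simp
    finally show "c (Suc n) g mod int p ^ n = c n g" .
  qed
  have M: "of_coeffs c \<in> corner e" "\<And>n g. g \<in> carrier G \<Longrightarrow> coeff (of_coeffs c) n g = c n g"
    using of_coeffs_sel[of c] c by blast+
  have "x = of_nat (p ^ i) * of_coeffs c"
  proof (rule corner_eqI[OF x corner_mult(1)[OF M(1)]])
    fix n g assume g: "g \<in> carrier G"
    have "coeff (of_nat (p ^ i) * of_coeffs c) n g = (int p ^ i * c n g) mod int p ^ n"
      using g M(2)[OF g] by (simp add: coeff_of_nat_mult del: of_nat_power) (simp)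
    also have "int p ^ i * c n g = coeff x (n + i) g" unfolding c_def using dvd[OF g] by simp
    also have "\<dots> mod int p ^ n = coeff x n g" using coeff_mono[OF g] by simp
    finally show "coeff x n g = coeff (of_nat (p ^ i) * of_coeffs c) n g" by simp
  qed
  then show "P ^ i dvd x" by simp
qed

lemma P_power_dvd_diff_iff:
  assumes "x \<in> corner e" "y \<in> corner e"
  shows "P ^ i dvd x - y \<longleftrightarrow> (\<forall>g\<in>carrier G. coeff x i g = coeff y i g)"
  using P_power_dvd_iff[OF idl.subspace_diff[OF subspace_corner assms]] by (simp add: coeff_diff_zero_iff)

lemma separated: "r \<in> corner e \<Longrightarrow> (\<And>i. \<exists>s. r = P ^ i * s) \<Longrightarrow> r = 0"
  using P_power_dvd_iff[of r] corner_zero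
  by (intro corner_eqI) (auto simp: dvd_def)

lemma torsion_free:
  assumes r: "r \<in> corner e" and z: "P * r = 0"
  shows "r = 0"
proof (rule corner_eqI[OF r corner_zero])
  fix n g assume g: "g \<in> carrier G"
  have "(int p * coeff r (Suc n) g) mod int p ^ Suc n = 0" using coeff_of_nat_mult[OF g, of p r "Suc n"] z g by simp
  then have "int p * int p ^ n dvd int p * coeff r (Suc n) g" by (simp add: dvd_eq_mod_eq_0)
  then have "int p ^ n dvd coeff r (Suc n) g" using p_pos by simp
  then show "coeff r n g = coeff 0 n g" using coeff_Suc[OF g, of r n] g by simp
qed

lemma finite_index: "0 < index (corner e) ((*) (P ^ i) ` corner e)"
proof -
  let ?h = "\<lambda>x. \<lambda>g\<in>carrier G. coeff x i g"
  have "index (corner e) ((*) (P ^ i) ` corner e) = card (?h ` corner e)"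
  proof (rule index_eq_card_image)
    show "subgrp ((*) (P ^ i) ` corner e)"
      by (rule subspace_subgrp(1)[OF subspace_mult_image[OF subspace_corner]])
    fix x y assume xy: "x \<in> corner e" "y \<in> corner e"
    have "x - y \<in> (*) (P ^ i) ` corner e \<longleftrightarrow> P ^ i dvd x - y"
    proof
      assume "P ^ i dvd x - y"
      then obtain s where "x - y = P ^ i * s" by (rule dvdE)
      then have "x - y = P ^ i * (e * s)"
        using corner_unit(1)[OF idl.subspace_diff[OF subspace_corner xy]] by (metis mult.left_commute)
      then show "x - y \<in> (*) (P ^ i) ` corner e" using cornerI[OF e_idem] by blast
    qed auto
    also have "\<dots> \<longleftrightarrow> ?h x = ?h y" unfolding P_power_dvd_diff_iff[OF xy] by (auto simp: fun_eq_iff)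
    finally show "?h x = ?h y \<longleftrightarrow> x - y \<in> (*) (P ^ i) ` corner e" by simp
  qed
  moreover have "finite (?h ` corner e)"
  proof (rule finite_subset)
    show "?h ` corner e \<subseteq> carrier G \<rightarrow>\<^sub>E {0..<int p ^ i}" using coeff_range by auto
    show "finite (carrier G \<rightarrow>\<^sub>E {0..<int p ^ i})" using finite_G by (intro finite_PiE) auto
  qed
  moreover have "corner e \<noteq> {}" using corner_zero by blast
  ultimately show ?thesis by (simp add: card_gt_0_iff)
qed

lemma complete:
  fixes x :: "nat \<Rightarrow> ('g \<Rightarrow> nat \<Rightarrow> int) ring_product"
  assumes x: "\<And>k. x k \<in> corner e" and cauchy: "\<And>n. \<exists>N. \<forall>k\<ge>N. P ^ n dvd x k - x N"
  shows "\<exists>y\<in>corner e. \<forall>n. \<exists>N. \<forall>k\<ge>N. P ^ n dvd x k - y"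
proof -
  obtain N where N: "\<And>n k. N n \<le> k \<Longrightarrow> P ^ n dvd x k - x (N n)" using cauchy by metis
  define c where "c n g = coeff (x (N n)) n g" for n g
  have eq: "coeff (x k) n g = c n g" if "g \<in> carrier G" "N n \<le> k" for n k g
    using N[OF that(2)] P_power_dvd_diff_iff[OF x x] that(1) by (auto simp: c_def)
  have c: "0 \<le> c n g \<and> c n g < int p ^ n \<and> c (Suc n) g mod int p ^ n = c n g" if g: "g \<in> carrier G" for n g
  proof -
    let ?k = "max (N n) (N (Suc n))"
    have "c (Suc n) g mod int p ^ n = coeff (x ?k) (Suc n) g mod int p ^ n"
      unfolding eq[OF g max.cobounded2] ..
    also have "\<dots> = c n g" unfolding coeff_Suc[OF g] by (rule eq[OF g max.cobounded1])
    finally show ?thesis unfolding c_def using coeff_range[OF g] by auto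
  qed
  have M: "of_coeffs c \<in> corner e" "\<And>n g. g \<in> carrier G \<Longrightarrow> coeff (of_coeffs c) n g = c n g"
    using of_coeffs_sel[of c] c by blast+
  have "P ^ n dvd x k - of_coeffs c" if "N n \<le> k" for n k
    using P_power_dvd_diff_iff[OF x M(1)] eq M(2) that by simp
  then show ?thesis using M(1) by blast
qed

text \<open>
  There are finitely many classes modulo \<open>p\<^sup>n\<close>, so two powers of \<open>r\<close> agree.
\<close>

lemma power_periodic:
  assumes r: "r \<in> corner e"
  shows "\<exists>i d. 0 < i \<and> 0 < d \<and> (\<forall>k\<ge>i. \<forall>c. P ^ n dvd r ^ (k + d * c) - r ^ k)"
proof -
  have pc: "r ^ Suc k \<in> corner e" for k using corner_mult(2)[OF r] by simp
  let ?h = "\<lambda>k. (+) (r ^ Suc k) ` (*) (P ^ n) ` corner e"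
  have sub: "subgrp ((*) (P ^ n) ` corner e)"
    by (rule subspace_subgrp(1)[OF subspace_mult_image[OF subspace_corner]])
  have "finite (cosets (corner e) ((*) (P ^ n) ` corner e))" using finite_index[of n] by (simp add: index_pos_iff)
  moreover have "range ?h \<subseteq> cosets (corner e) ((*) (P ^ n) ` corner e)" unfolding cosets_def using pc by blast
  ultimately have "\<not> inj ?h" using finite_subset finite_imageD infinite_UNIV_nat by blast
  then obtain i j where ij: "i < j" "?h i = ?h j" unfolding inj_def by (metis linorder_neqE_nat)
  define d where "d = j - i"
  have "r ^ Suc j - r ^ Suc i \<in> (*) (P ^ n) ` corner e" using ij(2) coset_eq_iff[OF sub] by metis
  then have base: "P ^ n dvd r ^ (Suc i + d) - r ^ Suc i" using ij(1) by (auto simp: d_def)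
  have step: "P ^ n dvd r ^ (k + d) - r ^ k" if "Suc i \<le> k" for k
  proof -
    have "r ^ (k + d) - r ^ k = r ^ (k - Suc i) * (r ^ (Suc i + d) - r ^ Suc i)"
      using that by (simp add: right_diff_distrib power_add[symmetric] del: power_Suc)
    then show ?thesis using base by simp
  qed
  have "P ^ n dvd r ^ (k + d * c) - r ^ k" if "Suc i \<le> k" for k c
  proof (induction c)
    case (Suc c)
    have "P ^ n dvd (r ^ (k + d * c + d) - r ^ (k + d * c)) + (r ^ (k + d * c) - r ^ k)"
      using that by (intro dvd_add step Suc) simp
    then show ?case by (simp add: add_ac)
  qed simp
  then show ?thesis using ij(1) by (intro exI[of _ "Suc i"] exI[of _ d]) (simp add: d_def)
qed

text \<open>
  Modulo \<open>p\<^sup>n\<close> the powers of \<open>r\<close> are eventually periodic. As \<open>k!\<close> is eventually a multiple of each period,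
  \<open>r\<^bsup>k!\<^esup>\<close> converges to an idempotent, and \<open>r\<^bsup>k!-1\<^esup>\<close> to an element \<open>h\<close> such that this idempotent is
  \<open>r h\<close>.
\<close>

lemma split:
  assumes r: "r \<in> corner e"
  shows "\<exists>h m s. (r * h) * (r * h) = r * h \<and> (e - r * h) * r ^ m = P * s"
proof -
  \<comment> \<open>the shift by \<open>2\<close> makes \<open>(k + 2)! - 1\<close> positive, so that all these powers lie in the corner\<close>
  define x :: "nat \<Rightarrow> ('g \<Rightarrow> nat \<Rightarrow> int) ring_product"
    where "x k = r ^ (fact (k + 2) - 1)" for k
  have f2: "2 \<le> (fact (k + 2) :: nat)" for k :: nat using fact_ge_self[of "k + 2"] by linarith
  have xc: "x k \<in> corner e" for k
  proof -
    have "(fact (k + 2) :: nat) - 1 = Suc (fact (k + 2) - 2)" using f2[of k] by simp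
    then show ?thesis unfolding x_def using corner_mult(2)[OF r] by simp
  qed
  have rx: "r * x k = r ^ fact (k + 2)" for k
  proof -
    have "Suc (fact (k + 2) - 1) = (fact (k + 2) :: nat)" using f2[of k] by simp
    then show ?thesis unfolding x_def power_Suc[symmetric] by simp
  qed
  have per: "\<exists>N. \<forall>k\<ge>N. P ^ n dvd x k - x N \<and> P ^ n dvd r * x k * (r * x k) - r * x k" for n
  proof -
    obtain i d where id: "0 < i" "0 < d" "\<And>k c. i \<le> k \<Longrightarrow> P ^ n dvd r ^ (k + d * c) - r ^ k"
      using power_periodic[OF r, of n] by blast
    let ?N = "i + d"
    have "P ^ n dvd x k - x ?N \<and> P ^ n dvd r * x k * (r * x k) - r * x k" if "?N \<le> k" for k
    proof
      have dN: "d dvd (fact (?N + 2) :: nat)" using id(2) by (intro dvd_fact) auto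
      have dk: "d dvd (fact (k + 2) :: nat)" using id(2) that by (intro dvd_fact) auto
      have le: "fact (?N + 2) \<le> (fact (k + 2) :: nat)" using that by (intro fact_mono_nat) simp
      have self: "?N + 2 \<le> (fact (?N + 2) :: nat)" "k + 2 \<le> (fact (k + 2) :: nat)" by (rule fact_ge_self)+
      obtain c where c: "(fact (k + 2) :: nat) - fact (?N + 2) = d * c" using dvd_diff_nat[OF dk dN] by (rule dvdE)
      have "(fact (k + 2) :: nat) - 1 = (fact (?N + 2) - 1) + d * c" using c le f2[of ?N] by simp
      then show "P ^ n dvd x k - x ?N" unfolding x_def using id(3)[of "fact (?N + 2) - 1" c] self by simp
      obtain c where c: "(fact (k + 2) :: nat) = d * c" using dk by (rule dvdE)
      have "r * x k * (r * x k) = r ^ (fact (k + 2) + d * c)" unfolding rx power_add[symmetric] c[symmetric] ..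
      then show "P ^ n dvd r * x k * (r * x k) - r * x k" unfolding rx using id(3)[of "fact (k + 2)" c] self that by simp
    qed
    then show ?thesis by blast
  qed
  then have "\<exists>N. \<forall>k\<ge>N. P ^ n dvd x k - x N" for n by blast
  then have "\<exists>h\<in>corner e. \<forall>n. \<exists>N. \<forall>k\<ge>N. P ^ n dvd x k - h" by (rule complete[of x, OF xc])
  then obtain h where h: "h \<in> corner e" "\<And>n. \<exists>N. \<forall>k\<ge>N. P ^ n dvd x k - h" by blast
  have near: "\<exists>k. P ^ n dvd r * x k - r * h \<and> P ^ n dvd r * x k * (r * x k) - r * x k" for n
  proof -
    obtain N where N: "\<And>k. N \<le> k \<Longrightarrow> P ^ n dvd x k - h" using h(2) by blast
    obtain N' where N': "\<And>k. N' \<le> k \<Longrightarrow> P ^ n dvd r * x k * (r * x k) - r * x k" using per[of n] by blast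
    have "P ^ n dvd r * (x (max N N') - h)" using N[of "max N N'"] by simp
    then show ?thesis using N'[of "max N N'"] by (intro exI[of _ "max N N'"]) (simp add: right_diff_distrib)
  qed
  have rhc: "r * h \<in> corner e" using corner_mult(2)[OF r] .
  have "r * h * (r * h) - r * h = 0"
  proof (rule separated)
    show "r * h * (r * h) - r * h \<in> corner e"
      using idl.subspace_diff[OF subspace_corner corner_mult(2)[OF rhc] rhc] .
    fix n
    obtain k where k: "P ^ n dvd r * x k - r * h" "P ^ n dvd r * x k * (r * x k) - r * x k" using near by blast
    let ?u = "r * x k" and ?v = "r * h"
    have "?v * ?v - ?v = (?u * ?u - ?u) - (?u + ?v - 1) * (?u - ?v)" by (simp add: algebra_simps)
    then have "P ^ n dvd ?v * ?v - ?v" using k by simp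
    then show "\<exists>s. r * h * (r * h) - r * h = P ^ n * s" by (auto simp: dvd_def)
  qed
  moreover have "\<exists>m s. (e - r * h) * r ^ m = P * s"
  proof -
    obtain k where k: "P ^ 1 dvd r * x k - r * h" "P ^ 1 dvd r * x k * (r * x k) - r * x k" using near by blast
    have "e * (r * x k) = r * x k" using corner_unit(1)[OF corner_mult(2)[OF r]] .
    then have "(e - r * h) * (r * x k) = (r * x k - r * h) * (r * x k) - (r * x k * (r * x k) - r * x k)"
      by (simp add: algebra_simps)
    also have "P dvd \<dots>" using k by simp
    finally show ?thesis unfolding rx by (auto simp: dvd_def)
  qed
  ultimately show ?thesis by auto
qed

end

section \<open>Frobenius, the node of the group ring, and the conclusion\<close>

lemma binomial_prime_dvd:
  fixes u v :: "'a::comm_ring_1"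
  assumes p: "prime p"
  shows "of_nat p dvd (u + v) ^ p - (u ^ p + v ^ p)"
proof -
  have p1: "1 < p" using p prime_gt_1_nat by blast
  have "(u + v) ^ p = (\<Sum>k\<le>p. of_nat (p choose k) * u ^ k * v ^ (p - k))" by (rule binomial_ring)
  also have "{..p} = insert 0 (insert p {1..<p})" using p1 by auto
  also have "(\<Sum>k\<in>\<dots>. of_nat (p choose k) * u ^ k * v ^ (p - k))
      = u ^ p + v ^ p + (\<Sum>k=1..<p. of_nat (p choose k) * u ^ k * v ^ (p - k))" using p1 by simp
  finally have "(u + v) ^ p - (u ^ p + v ^ p) = (\<Sum>k=1..<p. of_nat (p choose k) * u ^ k * v ^ (p - k))" by simp
  moreover have "of_nat p dvd (of_nat (p choose k) * u ^ k * v ^ (p - k) :: 'a)" if "k \<in> {1..<p}" for k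
  proof -
    have "p dvd p choose k" using that by (intro dvd_choose_prime p) auto
    then obtain m where "p choose k = p * m" by (rule dvdE)
    then show ?thesis by (simp add: mult.assoc)
  qed
  ultimately show ?thesis by (metis (no_types, lifting) dvd_sum)
qed

lemma sum_power_prime_dvd:
  fixes f :: "'b \<Rightarrow> 'a::comm_ring_1"
  assumes p: "prime p" and A: "finite A"
  shows "of_nat p dvd (\<Sum>i\<in>A. f i) ^ p - (\<Sum>i\<in>A. f i ^ p)"
  using A
proof (induction A rule: finite_induct)
  case empty
  have "0 < p" using p prime_gt_0_nat by blast
  then show ?case by (simp add: zero_power)
next
  case (insert a A)
  let ?s = "\<Sum>i\<in>A. f i"
  have "of_nat p dvd ((f a + ?s) ^ p - (f a ^ p + ?s ^ p)) + (?s ^ p - (\<Sum>i\<in>A. f i ^ p))"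
    by (intro dvd_add insert.IH binomial_prime_dvd p)
  also have "\<dots> = (f a + ?s) ^ p - (f a ^ p + (\<Sum>i\<in>A. f i ^ p))" by simp
  finally show ?case using insert.hyps by simp
qed

lemma of_nat_power_prime_dvd:
  assumes p: "prime p"
  shows "of_nat p dvd (of_nat c ^ p - of_nat c :: 'a::comm_ring_1)"
proof -
  have "of_nat p dvd ((\<Sum>i<c. 1) ^ p - (\<Sum>i<c. 1 ^ p) :: 'a)" by (intro sum_power_prime_dvd p) simp
  then show ?thesis by simp
qed

lemma diff_dvd_power_diff: "(u - v) dvd (u ^ k - v ^ k :: 'a::comm_ring_1)"
  by (simp add: power_diff_sumr2)

lemma corner_power: "r \<in> corner e \<Longrightarrow> 0 < k \<Longrightarrow> r ^ k \<in> corner e"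
  by (cases k) (auto simp: corner_mult(2))

context padic_group
begin

definition delta :: "'g \<Rightarrow> ('g \<Rightarrow> nat \<Rightarrow> int) ring_product" where
  "delta h = of_coeffs (\<lambda>n g. if g = h then 1 mod int p ^ n else 0)"

lemma p_gt_1: "1 < p" using prime prime_gt_1_nat by blast

lemma delta_coeffs: "delta h \<in> corner e" "g \<in> carrier G \<Longrightarrow> coeff (delta h) n g = (if g = h then 1 mod int p ^ n else 0)"
proof -
  have "0 \<le> (if g = h then 1 mod int p ^ n else 0) \<and> (if g = h then 1 mod int p ^ n else 0) < int p ^ n \<and>
      (if g = h then 1 mod int p ^ Suc n else 0) mod int p ^ n = (if g = h then 1 mod int p ^ n else 0)" for g n
    using p_pos by (auto simp: mod_mod_cancel)
  then show "delta h \<in> corner e" "g \<in> carrier G \<Longrightarrow> coeff (delta h) n g = (if g = h then 1 mod int p ^ n else 0)"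
    unfolding delta_def using of_coeffs_sel[of "\<lambda>n g. if g = h then 1 mod int p ^ n else 0"] by blast+
qed

lemma coeff_delta_mult:
  assumes h: "h \<in> carrier G" and g: "g \<in> carrier G"
  shows "coeff (delta h * y) n g = coeff y n (inv h \<otimes> g)"
proof -
  let ?g = "inv h \<otimes> g"
  have "coeff (delta h * y) n g = (\<Sum>k\<in>carrier G. coeff (delta h) n k * coeff y n (inv k \<otimes> g)) mod int p ^ n"
    by (rule coeff_mult[OF g])
  also have "(\<Sum>k\<in>carrier G. coeff (delta h) n k * coeff y n (inv k \<otimes> g))
      = (\<Sum>k\<in>carrier G. if k = h then (1 mod int p ^ n) * coeff y n ?g else 0)"
    by (intro sum.cong) (auto simp: delta_coeffs(2))
  also have "\<dots> = (1 mod int p ^ n) * coeff y n ?g" using h finite_G by simp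
  also have "\<dots> mod int p ^ n = coeff y n ?g" using g h by (simp add: mod_simps)
  finally show ?thesis .
qed

lemma delta_mult:
  assumes h: "h \<in> carrier G" and k: "k \<in> carrier G"
  shows "delta h * delta k = delta (h \<otimes> k)"
proof (rule corner_eqI[OF corner_mult(1)[OF delta_coeffs(1)] delta_coeffs(1)])
  fix n g assume g: "g \<in> carrier G"
  have "inv h \<otimes> g = k \<longleftrightarrow> g = h \<otimes> k"
    using g h k by (metis G.inv_solve_left G.m_closed)
  then show "coeff (delta h * delta k) n g = coeff (delta (h \<otimes> k)) n g"
    using g h by (simp add: coeff_delta_mult delta_coeffs(2))
qed

lemma delta_one: "delta \<one> = e"
proof -
  have "delta \<one> * e = e"
  proof (rule corner_eqI)
    show "delta \<one> * e \<in> corner e" "e \<in> corner e" using corner_mult(2)[OF delta_coeffs(1)] e_idem by (auto simp: corner_def)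
    show "coeff (delta \<one> * e) n g = coeff e n g" if "g \<in> carrier G" for n g using that by (simp add: coeff_delta_mult)
  qed
  then show ?thesis using corner_unit(2)[OF delta_coeffs(1)] by simp
qed

lemma delta_pow: "h \<in> carrier G \<Longrightarrow> delta h ^ k * e = delta (h [^] k)"
proof (induction k)
  case 0
  then show ?case by (simp add: delta_one)
next
  case (Suc k)
  have "delta h ^ Suc k * e = delta h * (delta h ^ k * e)" by (simp add: mult.assoc)
  also have "\<dots> = delta (h \<otimes> h [^] k)" using Suc by (simp add: delta_mult)
  also have "h \<otimes> h [^] k = h [^] Suc k" using Suc.prems by (simp add: G.m_comm)
  finally show ?case .
qed

lemma delta_power: "h \<in> carrier G \<Longrightarrow> 0 < k \<Longrightarrow> delta h ^ k = delta (h [^] k)"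
proof -
  assume h: "h \<in> carrier G" and k: "0 < k"
  obtain j where "k = Suc j" using k gr0_implies_Suc by blast
  then have "delta h ^ k \<in> corner e" using corner_mult(2)[OF delta_coeffs(1)] by simp
  then show ?thesis using delta_pow[OF h] corner_unit(2) by metis
qed

text \<open>
  Modulo \<open>p\<close>, the power \<open>r ^ (p ^ k)\<close> arises from \<open>r\<close> by moving each coefficient from \<open>g\<close> to
  \<open>g ^ (p ^ k)\<close>: raising to the \<open>p\<close>-th power is additive, and it fixes integers.
\<close>

lemma Frobenius:
  assumes r: "r \<in> corner e"
    and N: "idl.subspace N" "\<And>x. P * x \<in> N"
    and fixed: "\<And>g. g \<in> carrier G \<Longrightarrow> delta (g [^] (p ^ k)) - delta g \<in> N"
  shows "r ^ (p ^ k) - r \<in> N"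
proof -
  have P_N: "x \<in> N" if dvd: "P dvd x" for x
  proof -
    obtain s where "x = P * s" using dvd by (rule dvdE)
    then show ?thesis using N(2) by simp
  qed
  define c where "c g = nat (coeff r 1 g)" for g
  define S where "S j = (\<Sum>g\<in>carrier G. of_nat (c g) * delta (g [^] (p ^ j)))" for j
  have S0: "P dvd r - S 0"
  proof -
    have S_corner: "S 0 \<in> corner e" unfolding S_def
      by (intro idl.subspace_sum[OF subspace_corner] corner_mult(1) delta_coeffs(1))
    have coeff_sum: "coeff (\<Sum>g\<in>A. f g) 1 h = (\<Sum>g\<in>A. coeff (f g) 1 h) mod int p ^ 1"
      if "h \<in> carrier G" "finite A" for f :: "'g \<Rightarrow> ('g \<Rightarrow> nat \<Rightarrow> int) ring_product" and A h
      using that(2,1) by (induction A rule: finite_induct) (simp_all add: coeff_add mod_simps)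
    have "coeff (S 0) 1 h = coeff r 1 h" if h: "h \<in> carrier G" for h
    proof -
      have c: "int (c h) = coeff r 1 h" using coeff_range[OF h] by (simp add: c_def)
      have "coeff (S 0) 1 h = (\<Sum>g\<in>carrier G. coeff (of_nat (c g) * delta g) 1 h) mod int p ^ 1"
        unfolding S_def by (subst coeff_sum[OF h finite_G]) (auto intro!: arg_cong2[of _ _ _ _ "(mod)"] sum.cong)
      also have "(\<Sum>g\<in>carrier G. coeff (of_nat (c g) * delta g) 1 h) = (\<Sum>g\<in>carrier G. if g = h then coeff r 1 h else 0)"
      proof (intro sum.cong refl)
        fix g assume "g \<in> carrier G"
        show "coeff (of_nat (c g) * delta g) 1 h = (if g = h then coeff r 1 h else 0)"
          unfolding coeff_of_nat_mult[OF h] delta_coeffs(2)[OF h] using c p_gt_1 coeff_mod[OF h, of r 1] by auto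
      qed
      finally show ?thesis using h finite_G coeff_mod[OF h, of r 1] by simp
    qed
    then show ?thesis using P_power_dvd_diff_iff[OF r S_corner, of 1] by simp
  qed
  have S_Suc: "P dvd S j ^ p - S (Suc j)" for j
  proof -
    have pow: "(of_nat (c g) * delta (g [^] (p ^ j))) ^ p = of_nat (c g) ^ p * delta (g [^] (p ^ Suc j))"
      if "g \<in> carrier G" for g
      using that p_pos by (simp add: power_mult_distrib delta_power G.nat_pow_pow mult.commute)
    have 1: "P dvd S j ^ p - (\<Sum>g\<in>carrier G. of_nat (c g) ^ p * delta (g [^] (p ^ Suc j)))"
      using sum_power_prime_dvd[OF prime finite_G, of "\<lambda>g. of_nat (c g) * delta (g [^] (p ^ j))"] pow
      unfolding S_def by (simp cong: sum.cong)
    have "(\<Sum>g\<in>carrier G. of_nat (c g) ^ p * delta (g [^] (p ^ Suc j))) - S (Suc j)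
        = (\<Sum>g\<in>carrier G. (of_nat (c g) ^ p - of_nat (c g)) * delta (g [^] (p ^ Suc j)))"
      unfolding S_def by (simp only: sum_subtractf left_diff_distrib)
    also have "P dvd \<dots>" by (intro dvd_sum dvd_mult2 of_nat_power_prime_dvd prime)
    finally show ?thesis using dvd_add[OF 1] by fastforce
  qed
  have power: "P dvd r ^ (p ^ j) - S j" for j
  proof (induction j)
    case 0
    then show ?case using S0 by simp
  next
    case (Suc j)
    have "P dvd (r ^ (p ^ j)) ^ p - S j ^ p" using Suc diff_dvd_power_diff dvd_trans by blast
    from dvd_add[OF this S_Suc[of j]] show ?case by (simp add: power_mult[symmetric] mult.commute[of p])
  qed
  have "S k - S 0 = (\<Sum>g\<in>carrier G. of_nat (c g) * (delta (g [^] (p ^ k)) - delta g))"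
    unfolding S_def by (simp add: sum_subtractf right_diff_distrib cong: sum.cong)
  also have "\<dots> \<in> N" by (intro idl.subspace_sum[OF N(1)] idl.subspace_scale[OF N(1)] fixed)
  finally have "(r ^ (p ^ k) - S k) + (S k - S 0) - (r - S 0) \<in> N"
    by (rule idl.subspace_diff[OF N(1) idl.subspace_add[OF N(1) P_N[OF power]] P_N[OF S0]])
  then show ?thesis by simp
qed

text \<open>
  With \<open>p\<^sup>k \<equiv> 1\<close> modulo the order of \<open>G\<close>, the \<open>k\<close>-th power of Frobenius fixes every group element.
\<close>

lemma fitting_bound_coprime:
  assumes "\<not> p dvd order G"
  shows "fitting_bound e"
proof -
  define k where "k = totient (order G)"
  have pos: "0 < order G" using finite_G G.order_gt_0_iff_finite by simp
  have k: "0 < k" using pos by (simp add: k_def)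
  have "coprime p (order G)" using prime assms by (simp add: prime_imp_coprime)
  then have "[p ^ k = 1] (mod order G)" unfolding k_def by (rule euler_theorem)
  then obtain c where c: "p ^ k = 1 + order G * c"
    using p_pos by (metis cong_sym cong_le_nat cong_to_1'_nat One_nat_def Suc_leI add.commute mult.commute zero_less_power)
  have fixed: "g [^] (p ^ k) = g" if "g \<in> carrier G" for g
    unfolding c using that by (simp add: G.nat_pow_mult[symmetric] G.nat_pow_pow[symmetric] G.pow_order_eq_1)
  show ?thesis
  proof (rule fitting_bound_unramified[OF e_idem _ separated torsion_free split])
    show "0 < index (corner e) ((*) P ` corner e)" using finite_index[of 1] by simp
    show "1 < p ^ k" using p_gt_1 k by (rule one_less_power)
    fix r assume r: "r \<in> corner e"
    have N: "idl.subspace (range ((*) P))" by (intro subspace_mult_image idl.subspace_UNIV)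
    have "r ^ (p ^ k) - r \<in> range ((*) P)"
      using idl.subspace_0[OF N] fixed by (intro Frobenius[OF r N]) auto
    then obtain s where "r ^ (p ^ k) - r = P * s" by blast
    moreover have "r ^ (p ^ k) \<in> corner e"
      using r p_pos by (intro corner_power) simp_all
    then have "e * (r ^ (p ^ k) - r) = r ^ (p ^ k) - r"
      using corner_unit(1) corner_diff r by blast
    ultimately have "r ^ (p ^ k) - r = P * (e * s)" by (metis mult.left_commute)
    then show "r ^ (p ^ k) - r \<in> (*) P ` corner e" using cornerI[OF e_idem] by blast
  qed
qed

end

text \<open>
  Here \<open>x\<close> generates the subgroup \<open>H\<close> of order \<open>p\<close>.
\<close>

locale padic_group_node = padic_group p G for p and G :: "('g, 'x) monoid_scheme" (structure) +
  fixes x :: 'g and H :: "'g set"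
  assumes x: "x \<in> carrier G" and H: "subgroup H G" and bij: "bij_betw (\<lambda>i. x [^] i) {..<p} H"
    and x_p: "x [^] p = \<one>"
begin

abbreviation "y \<equiv> delta x"
definition "a = y - 1"
definition "b = (\<Sum>i<p. y ^ i)"

lemma y_power_p: "y ^ p = e"
  using delta_power[OF x p_pos] x_p by (simp add: delta_one)

lemma ab: "r \<in> corner e \<Longrightarrow> a * (b * r) = 0"
proof -
  assume r: "r \<in> corner e"
  have "a * b = y ^ p - 1" unfolding a_def b_def by (rule power_diff_1_eq[symmetric])
  then have "a * (b * r) = e * r - r" by (simp add: mult.assoc[symmetric] y_power_p left_diff_distrib)
  then show ?thesis using corner_unit(1)[OF r] by simp
qed

text \<open>
  This element exhibits \<open>p\<close> in the ideal generated by \<open>a\<close> and \<open>b\<close>: by telescoping, \<open>a D + b = p\<close> on the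
  group ring.
\<close>

definition "D = (\<Sum>i<p. of_nat i * y ^ i)"

lemma aD: "r \<in> corner e \<Longrightarrow> a * (D * r) + b * r = P * r"
proof -
  assume r: "r \<in> corner e"
  have "(y - 1) * (\<Sum>i<k. of_nat i * y ^ i) + (\<Sum>i<k. y ^ i) = of_nat k * y ^ k - y ^ k + 1" for k
    by (induction k) (simp_all add: algebra_simps)
  from this[of p] have "a * D + b = P * e - e + 1" unfolding a_def b_def D_def y_power_p .
  then have "(a * D + b) * r = (P * e - e + 1) * r" by simp
  also have "\<dots> = P * (e * r) - e * r + r" by (simp only: distrib_right left_diff_distrib mult.assoc mult_1)
  finally have "(a * D + b) * r = P * (e * r) - e * r + r" .
  then show ?thesis unfolding corner_unit(1)[OF r] by (simp add: algebra_simps)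
qed

text \<open>
  A \<open>y\<close>-invariant element is constant on the cosets of \<open>H\<close>, so it is \<open>b\<close> times its restriction to a
  transversal. The restriction does not depend on \<open>n\<close>, and the argument works for each residue
  separately; so the lemma covers both invariance and invariance modulo \<open>p\<close>.
\<close>

lemma invariant_multiple:
  assumes r: "r \<in> corner e"
  shows "\<exists>s\<in>corner e. \<forall>n. (\<forall>g\<in>carrier G. coeff (y * r) n g = coeff r n g) \<longrightarrow>
    (\<forall>g\<in>carrier G. coeff (b * s) n g = coeff r n g)"
proof -
  define t where "t g = (SOME h. h \<in> H #> g)" for g
  define c where "c n g = (if t g = g then coeff r n g else 0)" for n g
  have "0 \<le> c n g \<and> c n g < int p ^ n \<and> c (Suc n) g mod int p ^ n = c n g" if "g \<in> carrier G" for n g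
    using coeff_range[OF that] coeff_Suc[OF that] p_pos by (auto simp: c_def)
  then have s: "of_coeffs c \<in> corner e" "\<And>n g. g \<in> carrier G \<Longrightarrow> coeff (of_coeffs c) n g = c n g"
    using of_coeffs_sel[of c] by blast+
  have sub: "H \<subseteq> carrier G" using H by (rule subgroup.subset)
  have xi: "x [^] (i::nat) \<in> carrier G" for i using x by simp
  have "coeff (b * of_coeffs c) n g = coeff r n g"
    if inv: "\<forall>g\<in>carrier G. coeff (y * r) n g = coeff r n g" and g: "g \<in> carrier G" for n g
  proof -
    have shift: "coeff r n (inv (x [^] i) \<otimes> g) = coeff r n g" if "g \<in> carrier G" for i :: nat and g
      using that
    proof (induction i arbitrary: g)
      case (Suc i)
      have "inv (x [^] Suc i) \<otimes> g = inv x \<otimes> (inv (x [^] i) \<otimes> g)"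
        using x Suc.prems by (simp add: G.inv_mult_group G.m_assoc)
      then have "coeff r n (inv (x [^] Suc i) \<otimes> g) = coeff (y * r) n (inv (x [^] i) \<otimes> g)"
        using x Suc.prems by (simp add: coeff_delta_mult)
      also have "\<dots> = coeff r n (inv (x [^] i) \<otimes> g)" using inv xi Suc.prems by simp
      finally show ?case using Suc by simp
    qed simp
    have same: "H #> (inv (x [^] i) \<otimes> g) = H #> g" if "i < p" for i
    proof -
      have "x [^] i \<in> H" using bij that by (auto simp: bij_betw_def)
      then have "inv (x [^] i) \<in> H" by (rule subgroup.m_inv_closed[OF H])
      then have "inv (x [^] i) \<otimes> g \<in> H #> g" using g sub by (auto simp: r_coset_def)
      then show ?thesis using G.repr_independence[OF _ g H] by simp
    qed
    have "t g \<in> H #> g" unfolding t_def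
      using G.rcos_self[OF g H] by (rule someI)
    then obtain h where h: "h \<in> H" "t g = h \<otimes> g" by (auto simp: r_coset_def)
    have "inv h \<in> H" using h by (intro subgroup.m_inv_closed[OF H])
    then obtain j where j: "j < p" "inv h = x [^] j" using bij by (auto simp: bij_betw_def)
    then have tj: "inv (x [^] j) \<otimes> g = t g" using h sub by (metis G.inv_inv subsetD)
    have fix_iff: "t (inv (x [^] i) \<otimes> g) = inv (x [^] i) \<otimes> g \<longleftrightarrow> i = j" if i: "i < p" for i
    proof -
      have "t (inv (x [^] i) \<otimes> g) = t g" unfolding t_def same[OF i] ..
      then have "?thesis \<longleftrightarrow> (inv (x [^] j) \<otimes> g = inv (x [^] i) \<otimes> g \<longleftrightarrow> i = j)" unfolding tj by simp
      moreover have "inv (x [^] j) \<otimes> g = inv (x [^] i) \<otimes> g \<longleftrightarrow> x [^] j = x [^] i"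
        using g xi[of i] xi[of j] G.inv_inj by (auto simp: inj_on_def)
      moreover have "x [^] j = x [^] i \<longleftrightarrow> i = j"
        using bij i j(1) by (auto simp: bij_betw_def inj_on_def)
      ultimately show ?thesis by blast
    qed
    have "b * of_coeffs c = (\<Sum>i<p. delta (x [^] i) * of_coeffs c)"
    proof -
      have "y ^ i * of_coeffs c = delta (x [^] i) * of_coeffs c" for i
        unfolding delta_pow[OF x, of i, symmetric] mult.assoc corner_unit(1)[OF s(1)] ..
      then show ?thesis by (simp add: b_def sum_distrib_right)
    qed
    moreover have "coeff (\<Sum>i\<in>A. f i) n g = (\<Sum>i\<in>A. coeff (f i) n g) mod int p ^ n" if "finite A"
      for A and f :: "nat \<Rightarrow> ('g \<Rightarrow> nat \<Rightarrow> int) ring_product"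
      using that by (induction A rule: finite_induct) (simp_all add: coeff_add g mod_simps)
    ultimately have "coeff (b * of_coeffs c) n g = (\<Sum>i<p. coeff (delta (x [^] i) * of_coeffs c) n g) mod int p ^ n" by simp
    also have "(\<Sum>i<p. coeff (delta (x [^] i) * of_coeffs c) n g) = (\<Sum>i<p. if i = j then coeff r n g else 0)"
    proof (intro sum.cong refl)
      fix i assume "i \<in> {..<p}"
      then show "coeff (delta (x [^] i) * of_coeffs c) n g = (if i = j then coeff r n g else 0)"
        using fix_iff[of i] shift[OF g, of j] g xi by (simp add: coeff_delta_mult s(2) c_def)
    qed
    also have "\<dots> mod int p ^ n = coeff r n g" using j(1) g by simp
    finally show ?thesis .
  qed
  then show ?thesis using s(1) by blast
qed

lemma ker_a: assumes r: "r \<in> corner e" shows "a * r = 0 \<longleftrightarrow> (\<exists>s. r = b * (e * s))"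
proof
  assume "a * r = 0"
  then have yr: "y * r = r" by (simp add: a_def left_diff_distrib)
  obtain s where s: "s \<in> corner e" "\<And>n. (\<forall>g\<in>carrier G. coeff (y * r) n g = coeff r n g) \<longrightarrow>
      (\<forall>g\<in>carrier G. coeff (b * s) n g = coeff r n g)" using invariant_multiple[OF r] by blast
  have "r = b * s" using s yr by (intro corner_eqI r corner_mult(1)) auto
  then have "r = b * (e * s)" using corner_unit(1)[OF s(1)] by simp
  then show "\<exists>s. r = b * (e * s)" ..
next
  assume "\<exists>s. r = b * (e * s)"
  then show "a * r = 0" using ab cornerI[OF e_idem] by blast
qed

text \<open>
  If \<open>b r = 0\<close>, then \<open>p r = a D r\<close>. So \<open>D r\<close> is invariant modulo \<open>p\<close>, hence of the form \<open>b s - p w\<close>, and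
  multiplying by \<open>a\<close> and dividing by \<open>p\<close> gives \<open>r = - a w\<close>.
\<close>

lemma ker_b: assumes r: "r \<in> corner e" shows "b * r = 0 \<longleftrightarrow> (\<exists>s. r = a * (e * s))"
proof
  assume br: "b * r = 0"
  let ?z = "D * r"
  have z: "?z \<in> corner e" by (rule corner_mult(1)[OF r])
  have az: "a * ?z = P * r" using aD[OF r] br by simp
  then have "P ^ 1 dvd y * ?z - ?z" by (simp add: a_def left_diff_distrib)
  then have inv: "\<forall>g\<in>carrier G. coeff (y * ?z) 1 g = coeff ?z 1 g"
    using P_power_dvd_diff_iff[OF corner_mult(1)[OF z] z] by blast
  obtain s where s: "s \<in> corner e" "\<forall>g\<in>carrier G. coeff (b * s) 1 g = coeff ?z 1 g"
    using invariant_multiple[OF z] inv by blast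
  then have "P ^ 1 dvd b * s - ?z" using P_power_dvd_diff_iff[OF corner_mult(1)[OF s(1)] z] by blast
  then obtain w where w: "b * s - ?z = P * w" by (auto elim: dvdE)
  have "P * r = a * (b * s) - a * (b * s - ?z)" using az by (simp add: algebra_simps)
  also have "\<dots> = P * (a * (- w))" unfolding w ab[OF s(1)] by (simp add: mult_ac)
  finally have "P * r = P * (a * (- w))" .
  then have "e * (P * r) = e * (P * (a * (- w)))" by (rule arg_cong)
  then have "P * (e * r) = P * (a * (e * - w))" by (simp only: mult_ac)
  then have "P * (r - a * (e * - w)) = 0" unfolding corner_unit(1)[OF r] by (simp only: right_diff_distrib diff_self)
  moreover have "r - a * (e * - w) \<in> corner e"
    by (intro corner_diff r corner_mult(1) cornerI[OF e_idem])
  ultimately have "r - a * (e * - w) = 0" using torsion_free by blast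
  then have "r = a * (e * - w)" by (simp only: eq_iff_diff_eq_0[symmetric])
  then show "\<exists>s. r = a * (e * s)" ..
next
  assume "\<exists>s. r = a * (e * s)"
  then obtain s where "r = a * (e * s)" by blast
  then have "b * r = a * (b * (e * s))" by (simp add: mult.left_commute)
  then show "b * r = 0" using ab cornerI[OF e_idem] by metis
qed

lemma nilpotent: "\<exists>s. a ^ p * e = P * s" "\<exists>s. b ^ 2 * e = P * s"
proof -
  have "P dvd ((y - 1) + 1) ^ p - ((y - 1) ^ p + 1 ^ p)" by (rule binomial_prime_dvd[OF prime])
  then obtain s where "y ^ p - (a ^ p + 1) = P * s" unfolding a_def by (auto elim: dvdE)
  then have "e - a ^ p - 1 = P * s" by (simp add: y_power_p diff_diff_eq)
  then have "(e - a ^ p - 1) * e = P * s * e" by simp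
  then have "- (a ^ p * e) = P * (s * e)" by (simp add: left_diff_distrib e_idem mult.assoc)
  from arg_cong[OF this, of uminus] have "a ^ p * e = P * (- s * e)" by simp
  then show "\<exists>s. a ^ p * e = P * s" ..
  have e: "e \<in> corner e" using e_idem by (simp add: corner_def)
  have "y * (b * e) = b * e" using ab[OF e] by (simp add: a_def left_diff_distrib)
  then have "y ^ i * (b * e) = b * e" for i by (induction i) (simp_all add: mult.assoc)
  then have "b * (b * e) = P * (b * e)" by (subst (1) b_def) (simp add: sum_distrib_right)
  then show "\<exists>s. b ^ 2 * e = P * s" by (auto simp: power2_eq_square mult.assoc)
qed

lemma delta_H: assumes h: "h \<in> H" shows "\<exists>s. delta h - e = a * s"
proof -
  obtain i :: nat where i: "h = x [^] i" using bij h by (auto simp: bij_betw_def)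
  have "delta h - e = (y ^ i - 1) * e" using delta_pow[OF x, of i] i by (simp add: left_diff_distrib)
  also have "\<dots> = a * ((\<Sum>j<i. y ^ j) * e)" unfolding a_def power_diff_1_eq by (simp add: mult.assoc)
  finally show ?thesis ..
qed

text \<open>
  By \<open>pow\<close> the \<open>k\<close>-th power of Frobenius moves \<open>g\<close> within its coset of \<open>H\<close>, and elements of the same coset
  are congruent modulo \<open>a\<close>.
\<close>

lemma fitting_bound_node:
  assumes k: "0 < k" and pow: "\<And>g. g \<in> carrier G \<Longrightarrow> \<exists>h\<in>H. g [^] (p ^ k) = g \<otimes> h"
  shows "fitting_bound e"
proof -
  have e: "e \<in> corner e" using e_idem by (simp add: corner_def)
  obtain s1 t1 where nil: "a ^ p * e = P * s1" "b ^ 2 * e = P * t1" using nilpotent by blast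
  define N where "N = idl.span {P, a, b}"
  have N: "idl.subspace N" unfolding N_def by (rule idl.subspace_span)
  have "a \<in> N" "P \<in> N" unfolding N_def by (simp_all add: idl.span_base)
  then have aN: "a * s \<in> N" and PN: "P * s \<in> N" for s
    using idl.subspace_scale[OF N, of _ s] by (simp_all add: mult.commute[of _ s])
  show ?thesis
  proof (rule fitting_bound_nodal[OF e_idem _ separated split _ _ _ nil ker_a ker_b])
    show "0 < index (corner e) ((*) P ` corner e)" using finite_index[of 1] by simp
    show "1 < p ^ k" using p_gt_1 k by (rule one_less_power)
    show "P * e = a * (D * e) + b * e" using aD[OF e] by simp
    show "r = 0" if "r \<in> corner e" "a * r = 0" "b * r = 0" for r
    proof -
      have "a * (D * r) = D * (a * r)" by (simp add: mult.left_commute)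
      then have "P * r = 0" using aD[OF that(1)] that by simp
      then show ?thesis by (rule torsion_free[OF that(1)])
    qed
    fix r assume r: "r \<in> corner e"
    have "r ^ (p ^ k) - r \<in> N"
    proof (rule Frobenius[OF r N PN])
      fix g assume g: "g \<in> carrier G"
      obtain h where h: "h \<in> H" "g [^] (p ^ k) = g \<otimes> h" using pow[OF g] by blast
      obtain s where s: "delta h - e = a * s" using delta_H[OF h(1)] by blast
      have "h \<in> carrier G" using h(1) subgroup.subset[OF H] by blast
      then have "delta (g [^] (p ^ k)) - delta g = delta g * (delta h - e)"
        unfolding h(2) using g corner_unit(2)[OF delta_coeffs(1)] by (simp add: delta_mult right_diff_distrib)
      also have "\<dots> = a * (delta g * s)" unfolding s by (simp add: mult.left_commute)
      finally show "delta (g [^] (p ^ k)) - delta g \<in> N" using aN by simp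
    qed
    then obtain u where "r ^ (p ^ k) - r - u * P \<in> idl.span {a, b}"
      unfolding N_def idl.span_breakdown_eq[of _ P] by blast
    then obtain s t where "r ^ (p ^ k) - r - u * P = a * s + b * t" unfolding span_pair by blast
    then have stu: "r ^ (p ^ k) - r = a * s + b * t + P * u" by (simp add: algebra_simps)
    have "r ^ (p ^ k) \<in> corner e"
      using r p_pos by (intro corner_power) simp_all
    then have "r ^ (p ^ k) - r = e * (r ^ (p ^ k) - r)"
      using corner_unit(1) corner_diff r by metis
    also have "\<dots> = a * (e * s) + b * (e * t) + P * (e * u)" unfolding stu by (simp add: algebra_simps)
    also have "P * (e * u) = a * (D * (e * u)) + b * (e * u)" using aD[OF cornerI[OF e_idem]] by simp
    finally have "r ^ (p ^ k) - r = a * (e * s + D * (e * u)) + b * (e * t + e * u)" by (simp add: algebra_simps)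
    then show "\<exists>s t. r ^ (p ^ k) - r = a * s + b * t" by blast
  qed
qed

end

context padic_group
begin

text \<open>
  If the order of \<open>G\<close> is \<open>p m\<close> with \<open>m\<close> prime to \<open>p\<close>, all \<open>m\<close>-th powers lie in the subgroup \<open>H\<close> of order
  \<open>p\<close>, because \<open>G / H\<close> has order \<open>m\<close>. So \<open>p\<^sup>k \<equiv> 1\<close> modulo \<open>m\<close> suffices for Frobenius to preserve
  the cosets of \<open>H\<close>.
\<close>

lemma fitting_bound_dvd:
  assumes dvd: "p dvd order G" and not_dvd: "\<not> p\<^sup>2 dvd order G"
  shows "fitting_bound e"
proof -
  obtain m where m: "order G = p * m" using dvd by (rule dvdE)
  have pm: "\<not> p dvd m" using not_dvd unfolding m by (auto simp: power2_eq_square)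
  obtain H where HS: "subgroup H G" "card H = p"
    using sylow_thm[OF prime G.is_group, of 1 m] m finite_G by auto
  have sub: "H \<subseteq> carrier G" using HS(1) by (rule subgroup.subset)
  have "H \<noteq> {\<one>}" using HS(2) p_gt_1 by auto
  then obtain x where x: "x \<in> H" "x \<noteq> \<one>" using subgroup.one_closed[OF HS(1)] by blast
  then have xG: "x \<in> carrier G" using sub by blast
  interpret HG: group "G\<lparr>carrier := H\<rparr>" by (rule subgroup.subgroup_is_group[OF HS(1) G.is_group])
  have x_p: "x [^] p = \<one>"
  proof -
    have "x [^]\<^bsub>G\<lparr>carrier := H\<rparr>\<^esub> order (G\<lparr>carrier := H\<rparr>) = \<one>\<^bsub>G\<lparr>carrier := H\<rparr>\<^esub>"
      using x(1) by (intro HG.pow_order_eq_1) simp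
    then show ?thesis using HS(2) by (simp add: order_def nat_pow_def)
  qed
  have "G.ord x dvd p" using x_p xG by (simp add: G.pow_eq_id)
  moreover have "G.ord x \<noteq> 1" using x(2) xG G.ord_eq_1 by blast
  ultimately have ord: "G.ord x = p" using prime by (auto simp: prime_nat_iff)
  have inj: "inj_on (\<lambda>i. x [^] i) {..<p}"
  proof -
    have "{..<p} = {0..G.ord x - 1}" using p_pos unfolding ord by auto
    then show ?thesis using G.ord_inj[OF xG] by simp
  qed
  have in_H: "x [^] i \<in> H" for i :: nat
    by (induction i) (auto intro: subgroup.one_closed[OF HS(1)] subgroup.m_closed[OF HS(1)] x(1))
  have "(\<lambda>i. x [^] i) ` {..<p} = H"
    using in_H HS(2) p_pos card_image[OF inj] by (intro card_subset_eq) (auto simp: card_ge_0_finite)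
  then have bij: "bij_betw (\<lambda>i. x [^] i) {..<p} H" using inj by (simp add: bij_betw_def)
  interpret padic_group_node p G x H
    using xG HS(1) bij x_p by (intro padic_group_node.intro padic_group_node_axioms.intro padic_group_axioms)
  have m_pos: "0 < m" using m finite_G G.order_gt_0_iff_finite by (cases m) auto
  define k where "k = totient m"
  have k: "0 < k" using m_pos by (simp add: k_def)
  have "coprime p m" using prime pm by (simp add: prime_imp_coprime)
  then have "[p ^ k = 1] (mod m)" unfolding k_def by (rule euler_theorem)
  then obtain c where c: "p ^ k = 1 + m * c"
    using p_pos by (metis cong_sym cong_le_nat cong_to_1'_nat One_nat_def Suc_leI add.commute mult.commute zero_less_power)
  have pow_m: "g [^] m \<in> H" if g: "g \<in> carrier G" for g
  proof -
    have normal: "H \<lhd> G" by (rule G.subgroup_imp_normal[OF HS(1)])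
    interpret Q: group "G Mod H" by (rule normal.factorgroup_is_group[OF normal])
    have "order (G Mod H) * p = p * m"
      using G.lagrange[OF HS(1)] HS(2) m by (simp add: order_def FactGroup_def)
    then have ord_Q: "order (G Mod H) = m" using p_pos by simp
    have power: "(H #> g) [^]\<^bsub>G Mod H\<^esub> (i::nat) = H #> (g [^] i)" for i
    proof (induction i)
      case 0
      then show ?case using G.coset_mult_one[OF sub] by (simp add: FactGroup_def)
    next
      case (Suc i)
      then show ?case using g normal.rcos_sum[OF normal] by (simp add: FactGroup_def)
    qed
    have "H #> g \<in> carrier (G Mod H)" using g by (auto simp: FactGroup_def RCOSETS_def)
    then have "(H #> g) [^]\<^bsub>G Mod H\<^esub> m = \<one>\<^bsub>G Mod H\<^esub>" using Q.pow_order_eq_1 unfolding ord_Q by blast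
    then have "H #> (g [^] m) = H" unfolding power by (simp add: FactGroup_def)
    then show ?thesis using G.rcos_self[OF _ HS(1), of "g [^] m"] g by simp
  qed
  show ?thesis
  proof (rule fitting_bound_node[OF k])
    fix g assume g: "g \<in> carrier G"
    have "(g [^] m) [^] i \<in> H" for i :: nat
      by (induction i) (auto intro: subgroup.one_closed[OF HS(1)] subgroup.m_closed[OF HS(1)] pow_m[OF g])
    moreover have "g [^] (p ^ k) = g \<otimes> (g [^] m) [^] c"
      unfolding c using g by (simp add: G.nat_pow_mult[symmetric] G.nat_pow_pow G.m_comm)
    ultimately show "\<exists>h\<in>H. g [^] (p ^ k) = g \<otimes> h" by blast
  qed
qed

end

theorem corollary1p2:
  fixes p :: nat
    and G :: "('g, 'x) monoid_scheme"
    and M :: "('g \<Rightarrow> nat \<Rightarrow> int, 'm, 'y) module_scheme"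
  assumes "prime p"
    and "comm_group G" and "finite (carrier G)"
    and "\<not> p\<^sup>2 dvd order G"
    and "module (padic_group_ring p G) M" and "finite (carrier M)"
  shows "card (carrier M)
           \<le> card (carrier (padic_group_ring p G Quot fitting_ideal (padic_group_ring p G) M)) \<and>
         (principalideal (fitting_ideal (padic_group_ring p G) M) (padic_group_ring p G) \<longrightarrow>
           card (carrier M)
           = card (carrier (padic_group_ring p G Quot fitting_ideal (padic_group_ring p G) M)))"
proof -
  interpret M: Module.module "padic_group_ring p G" M by (rule assms(5))
  interpret padic_group p G
    by (intro padic_group.intro assms M.R.cring_axioms)
  have "fitting_bound e"
    using fitting_bound_coprime fitting_bound_dvd assms(4) by blast
  then show ?thesis by (rule card_le_card_quotient_Fitting[OF assms(5,6)])
qed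

end
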